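(* Let $C$ be a (nonzero) commutative ring of positive characteristic, let $A\supseteq C$ be a commutative $C$-algebra, and let $\lambda\in C$. Let $\mathrm{Sh}_C(A)$ and $\widehat{\mathrm{Sh}}_C(A)$ be the shuffle Baxter algebra and the complete shuffle Baxter algebra on $A$ of weight $\lambda$. Write $N(R)$ for the nilradical of a ring $R$. 1. $\mathrm{Sh}_C(A)$ (hence $\widehat{\mathrm{Sh}}_C(A)$) is not an integral domain. 2. If $\lambda=0$, then $\mathrm{Sh}_C(A)$ (hence $\widehat{\mathrm{Sh}}_C(A)$) is not reduced. Moreover $$N(\mathrm{Sh}_C(A))=N(A)\oplus\Big(\bigoplus_{n\ge 1}A^{\otimes(n+1)}\Big),\qquad N(\widehat{\mathrm{Sh}}_C(A))\subseteq N(A)\times\prod_{n\ge 1}A^{\otimes(n+1)}.$$ 3. If $\lambda\ne 0$, and if for every $k\ge 1$ the element $\lambda$ has trivial annihilator in the $C$-module $A^{\otimes k}$ and the tensor power algebra $A^{\otimes k}$ is reduced, then $\mathrm{Sh}_C(A)$ and $\widehat{\mathrm{Sh}}_C(A)$ are reduced.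
   Context: All rings are commutative with identity. $\mathbb N=\{0,1,2,\dots\}$. Tensor products are over $C$. The tensor power algebra $A^{\otimes k}$ carries the usual factorwise multiplication. "$\lambda$ has trivial annihilator in a module $N$" means: $\lambda x=0$, $x\in N$, implies $x=0$. Mixable shuffles. For $m,n\ge 1$, let $S(m,n)$ be the set of $\sigma\in S_{m+n}$ with $\sigma^{-1}(1)<\dots<\sigma^{-1}(m)$ and $\sigma^{-1}(m+1)<\dots<\sigma^{-1}(m+n)$. A pair $(k,k+1)$, $1\le k<m+n$, is admissible for $\sigma$ if $\sigma(k)\le m<\sigma(k+1)$; let $\mathcal T^\sigma$ be the set of admissible pairs, and $\bar S(m,n)=\{(\sigma,T)\mid \sigma\in S(m,n),\ T\subseteq\mathcal T^\sigma\}$. For $x=x_1\otimes\dots\otimes x_m$, $y=y_1\otimes\dots\otimes y_n$, set $u_k=x_k$ for $k\le m$ and $u_k=y_{k-m}$ for $k>m$. Then $\sigma(x\otimes y;T)\in A^{\otimes(m+n-|T|)}$ is obtained from $u_{\sigma(1)}\otimes\dots\otimes u_{\sigma(m+n)}$ by replacing, for each $(k,k+1)\in T$, the tensor sign between $u_{\sigma(k)}$ and $u_{\sigma(k+1)}$ by the product in $A$. Shuffle Baxter algebra. $\mathrm{Sh}_{C}(A)=\mathrm{Sh}_{C,\lambda}(A)=\bigoplus_{k\in\mathbb N}A^{\otimes(k+1)}$ as a $C$-module, with the $C$-bilinear commutative product $$(x_0\otimes x^+)\diamond(y_0\otimes y^+)=\sum_{(\sigma,T)\in\bar S(m,n)}\lambda^{|T|}\,x_0y_0\otimes\sigma(x^+\otimes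 y^+;T)$$ for $x^+\in A^{\otimes m}$, $y^+\in A^{\otimes n}$ pure tensors, $m,n\geq 1$; when $m=0$ or $n=0$ the product is $x_0y_0\otimes y^+$, resp. $x_0y_0\otimes x^+$ (and $x_0y_0$ if both are $0$). The identity is $1_A\in A$. Complete version. Let $\mathrm{Fil}^k=\bigoplus_{n\ge k}A^{\otimes(n+1)}$, an ideal of $\mathrm{Sh}_{C}(A)$. Then $\widehat{\mathrm{Sh}}_{C}(A)=\varprojlim_k\mathrm{Sh}_{C}(A)/\mathrm{Fil}^k$, identified with $\prod_{k\in\mathbb N}A^{\otimes(k+1)}$ with the product extended by continuity. *)

theory Defs
  imports "HOL-Algebra.QuotRing" "HOL-Algebra.Module" "HOL-Combinatorics.Permutations"
begin

section \<open>Ring-theoretic notions\<close>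

definition ring_characteristic :: "('a, 'm) ring_scheme \<Rightarrow> nat" where
  "ring_characteristic R =
     (if \<exists>n::nat. 0 < n \<and> [n] \<cdot>\<^bsub>R\<^esub> \<one>\<^bsub>R\<^esub> = \<zero>\<^bsub>R\<^esub>
      then LEAST n. 0 < n \<and> [n] \<cdot>\<^bsub>R\<^esub> \<one>\<^bsub>R\<^esub> = \<zero>\<^bsub>R\<^esub> else 0)"

definition nilradical :: "('a, 'm) ring_scheme \<Rightarrow> 'a set" where
  "nilradical R = {x \<in> carrier R. \<exists>n::nat. x [^]\<^bsub>R\<^esub> n = \<zero>\<^bsub>R\<^esub>}"

definition reduced :: "('a, 'm) ring_scheme \<Rightarrow> bool" where
  "reduced R \<longleftrightarrow> nilradical R = {\<zero>\<^bsub>R\<^esub>}"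

definition trivial_annihilator_in :: "'c \<Rightarrow> ('c, 'b, 'm) module_scheme \<Rightarrow> bool" where
  "trivial_annihilator_in c M \<longleftrightarrow> (\<forall>x\<in>carrier M. c \<odot>\<^bsub>M\<^esub> x = \<zero>\<^bsub>M\<^esub> \<longrightarrow> x = \<zero>\<^bsub>M\<^esub>)"


section \<open>Tensor powers\<close>

text \<open>
  The $k$-th tensor power of a $C$-algebra $A$ is constructed as the free $C$-module on
  $A^k$ modulo the relations of $C$-multilinearity.  The generator
  $(x_1,\dots,x_k)$ is the list \<open>[x\<^sub>1, \<dots>, x\<^sub>k]\<close>, and an element of the free module is its
  finitely supported coefficient function.
\<close>

definition word_gen :: "('c, 'm) ring_scheme \<Rightarrow> 'a list \<Rightarrow> 'a list \<Rightarrow> 'c" where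
  "word_gen C w = (\<lambda>v. if v = w then \<one>\<^bsub>C\<^esub> else \<zero>\<^bsub>C\<^esub>)"

definition word_supp :: "('c, 'm) ring_scheme \<Rightarrow> ('a list \<Rightarrow> 'c) \<Rightarrow> 'a list set" where
  "word_supp C f = {w. f w \<noteq> \<zero>\<^bsub>C\<^esub>}"

text \<open>
  \<open>\<beta> u v\<close> is the value on the pair of generators \<open>u\<close>, \<open>v\<close> of the bilinear map that is
  applied to \<open>f\<close> and \<open>g\<close>.
\<close>

definition bilinear_extension ::
    "('c, 'm) ring_scheme \<Rightarrow> ('a list \<Rightarrow> 'a list \<Rightarrow> 'a list \<Rightarrow> 'c) \<Rightarrow>
     ('a list \<Rightarrow> 'c) \<Rightarrow> ('a list \<Rightarrow> 'c) \<Rightarrow> 'a list \<Rightarrow> 'c" where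
  "bilinear_extension C \<beta> f g = (\<lambda>w.
     \<Oplus>\<^bsub>C\<^esub>u\<in>word_supp C f. \<Oplus>\<^bsub>C\<^esub>v\<in>word_supp C g. f u \<otimes>\<^bsub>C\<^esub> g v \<otimes>\<^bsub>C\<^esub> \<beta> u v w)"

definition free_tensors ::
    "('c, 'm) ring_scheme \<Rightarrow> ('c, 'a, 'n) module_scheme \<Rightarrow> nat \<Rightarrow> ('c, 'a list \<Rightarrow> 'c) module" where
  "free_tensors C A k =
     \<lparr>carrier = {f. (\<forall>w. f w \<in> carrier C) \<and> finite (word_supp C f) \<and>
                    (\<forall>w\<in>word_supp C f. length w = k \<and> set w \<subseteq> carrier A)},
      monoid.mult = bilinear_extension C (\<lambda>u v. word_gen C (map2 (\<lambda>x y. x \<otimes>\<^bsub>A\<^esub> y) u v)),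
      one = word_gen C (replicate k \<one>\<^bsub>A\<^esub>),
      zero = (\<lambda>w. \<zero>\<^bsub>C\<^esub>),
      add = (\<lambda>f g w. f w \<oplus>\<^bsub>C\<^esub> g w),
      smult = (\<lambda>c f w. c \<otimes>\<^bsub>C\<^esub> f w)\<rparr>"

definition multilinear_relators ::
    "('c, 'm) ring_scheme \<Rightarrow> ('c, 'a, 'n) module_scheme \<Rightarrow> nat \<Rightarrow> ('a list \<Rightarrow> 'c) set" where
  "multilinear_relators C A k =
     {word_gen C (us @ [a \<oplus>\<^bsub>A\<^esub> b] @ vs) \<ominus>\<^bsub>free_tensors C A k\<^esub>
        (word_gen C (us @ [a] @ vs) \<oplus>\<^bsub>free_tensors C A k\<^esub> word_gen C (us @ [b] @ vs)) | us vs a b.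
        length us + 1 + length vs = k \<and> set us \<union> set vs \<union> {a, b} \<subseteq> carrier A}
   \<union> {word_gen C (us @ [c \<odot>\<^bsub>A\<^esub> a] @ vs) \<ominus>\<^bsub>free_tensors C A k\<^esub>
        (c \<odot>\<^bsub>free_tensors C A k\<^esub> word_gen C (us @ [a] @ vs)) | us vs a c.
        length us + 1 + length vs = k \<and> set us \<union> set vs \<union> {a} \<subseteq> carrier A \<and> c \<in> carrier C}"

definition tensor_relations ::
    "('c, 'm) ring_scheme \<Rightarrow> ('c, 'a, 'n) module_scheme \<Rightarrow> nat \<Rightarrow> ('a list \<Rightarrow> 'c) set" where
  "tensor_relations C A k =
     \<Inter>{H. submodule H C (free_tensors C A k) \<and> multilinear_relators C A k \<subseteq> H}"

text \<open>
  The ring operations are those of the quotient \<open>Quot\<close> of \<open>HOL-Algebra\<close>.  As there, an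
  operation on cosets is the union of the cosets obtained from all representatives; all of
  them are equal, because the relation submodule is an ideal for the factorwise
  multiplication.
\<close>

definition tensor_power ::
    "('c, 'm) ring_scheme \<Rightarrow> ('c, 'a, 'n) module_scheme \<Rightarrow> nat \<Rightarrow> ('c, ('a list \<Rightarrow> 'c) set) module" where
  "tensor_power C A k =
     \<lparr>carrier = a_rcosets\<^bsub>free_tensors C A k\<^esub> (tensor_relations C A k),
      monoid.mult = rcoset_mult (free_tensors C A k) (tensor_relations C A k),
      one = tensor_relations C A k +>\<^bsub>free_tensors C A k\<^esub> \<one>\<^bsub>free_tensors C A k\<^esub>,
      zero = tensor_relations C A k,
      add = set_add (free_tensors C A k),
      smult = (\<lambda>c X. \<Union>f\<in>X. tensor_relations C A k +>\<^bsub>free_tensors C A k\<^esub>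
                              (c \<odot>\<^bsub>free_tensors C A k\<^esub> f))\<rparr>"

definition pure_tensor ::
    "('c, 'm) ring_scheme \<Rightarrow> ('c, 'a, 'n) module_scheme \<Rightarrow> 'a list \<Rightarrow> ('a list \<Rightarrow> 'c) set" where
  "pure_tensor C A w =
     tensor_relations C A (length w) +>\<^bsub>free_tensors C A (length w)\<^esub> word_gen C w"


section \<open>Mixable shuffles\<close>

definition shuffle_perms :: "nat \<Rightarrow> nat \<Rightarrow> (nat \<Rightarrow> nat) set" where
  "shuffle_perms m n =
     {\<sigma>. \<sigma> permutes {1..m+n} \<and> strict_mono_on {1..m} (inv_into UNIV \<sigma>) \<and>
         strict_mono_on {m+1..m+n} (inv_into UNIV \<sigma>)}"

text \<open>The admissible pair \<open>(k, k + 1)\<close> is represented by \<open>k\<close>.\<close>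

definition admissible :: "nat \<Rightarrow> nat \<Rightarrow> (nat \<Rightarrow> nat) \<Rightarrow> nat set" where
  "admissible m n \<sigma> = {k. 1 \<le> k \<and> k < m + n \<and> \<sigma> k \<le> m \<and> m < \<sigma> (k + 1)}"

text \<open>
  If \<open>m = 0\<close> or \<open>n = 0\<close>, the only element is \<open>(id, {})\<close>, so that the
  product below then specialises to the one prescribed for these degrees.
\<close>

definition mixable_shuffles :: "nat \<Rightarrow> nat \<Rightarrow> ((nat \<Rightarrow> nat) \<times> nat set) set" where
  "mixable_shuffles m n = {(\<sigma>, T). \<sigma> \<in> shuffle_perms m n \<and> T \<subseteq> admissible m n \<sigma>}"

text \<open>
  \<open>merge_at A T k xs\<close> replaces tensor signs by products in \<open>A\<close>; the sign after the first
  entry of \<open>xs\<close> has number \<open>k\<close> and is replaced if \<open>k \<in> T\<close>.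
\<close>

fun merge_at :: "('a, 'm) ring_scheme \<Rightarrow> nat set \<Rightarrow> nat \<Rightarrow> 'a list \<Rightarrow> 'a list" where
  "merge_at A T k (x # y # zs) =
     (if k \<in> T then merge_at A T (k + 1) ((x \<otimes>\<^bsub>A\<^esub> y) # zs)
      else x # merge_at A T (k + 1) (y # zs))"
| "merge_at A T k xs = xs"

definition mixed_word ::
    "('a, 'm) ring_scheme \<Rightarrow> (nat \<Rightarrow> nat) \<Rightarrow> nat set \<Rightarrow> 'a list \<Rightarrow> 'a list \<Rightarrow> 'a list" where
  "mixed_word A \<sigma> T xs ys =
     merge_at A T 1 (map (\<lambda>k. (xs @ ys) ! (\<sigma> k - 1)) [1..<length xs + length ys + 1])"

text \<open>
  The coefficient at \<open>w\<close> of the product of the generators \<open>u = x\<^sub>0 # xs\<close> and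
  \<open>v = y\<^sub>0 # ys\<close> in $\bigoplus_k A^{\otimes(k+1)}$, before passing to the quotient by the
  multilinearity relations.
\<close>

definition word_shuffle ::
    "('c, 'm) ring_scheme \<Rightarrow> ('c, 'a, 'n) module_scheme \<Rightarrow> 'c \<Rightarrow>
     'a list \<Rightarrow> 'a list \<Rightarrow> 'a list \<Rightarrow> 'c" where
  "word_shuffle C A lam u v w =
     (\<Oplus>\<^bsub>C\<^esub>p\<in>{(\<sigma>, T). (\<sigma>, T) \<in> mixable_shuffles (length (tl u)) (length (tl v)) \<and>
               (hd u \<otimes>\<^bsub>A\<^esub> hd v) # mixed_word A \<sigma> T (tl u) (tl v) = w}.
        lam [^]\<^bsub>C\<^esub> card (snd p))"

text \<open>
  The $A^{\otimes(n+1)}$-component of the product of \<open>X\<close> in $A^{\otimes(i+1)}$ and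
  \<open>Y\<close> in $A^{\otimes(j+1)}$, for arbitrary \<open>i\<close>, \<open>j\<close>.
\<close>

definition shuffle_component ::
    "('c, 'm) ring_scheme \<Rightarrow> ('c, 'a, 'n) module_scheme \<Rightarrow> 'c \<Rightarrow> nat \<Rightarrow>
     ('a list \<Rightarrow> 'c) set \<Rightarrow> ('a list \<Rightarrow> 'c) set \<Rightarrow> ('a list \<Rightarrow> 'c) set" where
  "shuffle_component C A lam n X Y =
     (\<Union>f\<in>X. \<Union>g\<in>Y. tensor_relations C A (n+1) +>\<^bsub>free_tensors C A (n+1)\<^esub>
        (\<lambda>w. if length w = n + 1 then bilinear_extension C (word_shuffle C A lam) f g w
             else \<zero>\<^bsub>C\<^esub>))"


section \<open>Shuffle Baxter algebras\<close>

text \<open>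
  An element \<open>F\<close> of $\prod_k A^{\otimes(k+1)}$ has the component \<open>F k\<close> in $A^{\otimes(k+1)}$.
  The product of components of degrees \<open>i\<close> and \<open>j\<close> lies in degrees \<open>max i j\<close> to \<open>i + j\<close>, so
  only the finitely many pairs \<open>i, j \<le> n\<close> contribute to the component of degree \<open>n\<close>.  This
  is the bilinear product on the direct sum, and its continuous extension to the product.
\<close>

definition complete_shuffle_algebra ::
    "('c, 'm) ring_scheme \<Rightarrow> ('c, 'a, 'n) module_scheme \<Rightarrow> 'c \<Rightarrow>
     (nat \<Rightarrow> ('a list \<Rightarrow> 'c) set) ring" where
  "complete_shuffle_algebra C A lam =
     \<lparr>carrier = {F. \<forall>k. F k \<in> carrier (tensor_power C A (k+1))},
      monoid.mult = (\<lambda>F G n. \<Oplus>\<^bsub>tensor_power C A (n+1)\<^esub>i\<in>{..n}. \<Oplus>\<^bsub>tensor_power C A (n+1)\<^esub>j\<in>{..n}.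
                         shuffle_component C A lam n (F i) (G j)),
      one = (\<lambda>k. if k = 0 then pure_tensor C A [\<one>\<^bsub>A\<^esub>] else \<zero>\<^bsub>tensor_power C A (k+1)\<^esub>),
      zero = (\<lambda>k. \<zero>\<^bsub>tensor_power C A (k+1)\<^esub>),
      add = (\<lambda>F G k. F k \<oplus>\<^bsub>tensor_power C A (k+1)\<^esub> G k)\<rparr>"

definition shuffle_algebra ::
    "('c, 'm) ring_scheme \<Rightarrow> ('c, 'a, 'n) module_scheme \<Rightarrow> 'c \<Rightarrow>
     (nat \<Rightarrow> ('a list \<Rightarrow> 'c) set) ring" where
  "shuffle_algebra C A lam =
     (complete_shuffle_algebra C A lam)
       \<lparr>carrier := {F \<in> carrier (complete_shuffle_algebra C A lam).
                     finite {k. F k \<noteq> \<zero>\<^bsub>tensor_power C A (k+1)\<^esub>}}\<rparr>"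

end

theory Submission
  imports Defs
begin

text \<open>
  The sum over the mixable shuffles of two words satisfies the quasi-shuffle recursion: the first
  letter of the result comes from the left word, from the right word, or is the product of both
  first letters.  All computations are made with finitely supported functions on words, before
  dividing by the multilinearity relations.  Let \<open>N\<close> be the characteristic of \<open>C\<close>
  and let \<open>e\<^sub>k\<close> be the tensor \<open>1 \<otimes> \<dots> \<otimes> 1\<close> of degree \<open>k\<close>.

  The recursion gives \<open>e\<^sub>1 e\<^sub>n = (n + 1) e\<^sub>n\<^sub>+\<^sub>1 + n \<lambda> e\<^sub>n\<close>, so for \<open>n = N - 1\<close> the product of
  \<open>e\<^sub>1 - n \<lambda>\<close> and \<open>e\<^sub>n\<close> vanishes, while neither factor does, because the
  multiplication map of \<open>A\<close> sends \<open>e\<^sub>k\<close> to \<open>1\<close>.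

  If \<open>\<lambda> = 0\<close>, then deleting a given letter \<open>c\<close> right after the head is a derivation
  \<open>\<partial>\<close>.  Hence \<open>\<partial>(f\<^sup>K) = K f\<^sup>K\<^sup>-\<^sup>1 \<partial>f\<close> vanishes for every \<open>c\<close> if \<open>N\<close> divides \<open>K\<close>,
  that is, \<open>f\<^sup>K\<close> lives in degree \<open>0\<close>, where it is the \<open>K\<close>-th power of the component of
  \<open>f\<close>.

  If \<open>x\<close> is the lowest component of \<open>F\<close>, of degree \<open>n\<close>, then the lowest component of
  the power \<open>F\<^sup>k\<^sup>+\<^sup>1\<close> is \<open>\<lambda>\<^sup>n\<^sup>k x\<^sup>k\<^sup>+\<^sup>1\<close>, because two words of length \<open>n\<close> have only one mixable
  shuffle of length \<open>n\<close>, the one that merges all letters.  This settles the case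
  \<open>\<lambda> \<noteq> 0\<close>.
\<close>

section \<open>Mixable shuffles and the quasi-shuffle recursion\<close>

text \<open>Deleting a letter compares letters literally, so it does not respect multilinearity and
  does not descend to tensor powers. Hence the weight-zero argument needs exact identities between
  functions on words. One of them is the right commutativity (f g) h = (f h) g behind the power
  rule. For the same reason a representative whose degree-zero part is a single letter is chosen
  before powers are taken. The price is that the product of words, which lands in several degrees at
  once, has to be compatible with relations that are given in each degree separately. The recursion
  makes this provable: a linear relation at one letter either stays at that letter, with other
  letters placed before it, or is multiplied by a letter of the other word, and multiplication in A
  turns it into a relation again.\<close>

lemma sorted_wrt_filter_iff:
  "sorted_wrt R (filter P zs) \<longleftrightarrow>
     (\<forall>i j. i < j \<and> j < length zs \<and> P (zs ! i) \<and> P (zs ! j) \<longrightarrow> R (zs ! i) (zs ! j))"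
proof (induction zs)
  case (Cons z zs)
  have "(\<forall>i j. i < j \<and> j < length (z # zs) \<and> P ((z # zs) ! i) \<and> P ((z # zs) ! j)
            \<longrightarrow> R ((z # zs) ! i) ((z # zs) ! j)) \<longleftrightarrow>
        (P z \<longrightarrow> (\<forall>j<length zs. P (zs ! j) \<longrightarrow> R z (zs ! j))) \<and>
        (\<forall>i j. i < j \<and> j < length zs \<and> P (zs ! i) \<and> P (zs ! j) \<longrightarrow> R (zs ! i) (zs ! j))"
    (is "?L \<longleftrightarrow> ?R1 \<and> ?R2")
  proof
    assume L: ?L
    have ?R1
      using L[rule_format, of 0 "Suc j" for j] by auto
    moreover have ?R2
      using L[rule_format, of "Suc i" "Suc j" for i j] by auto
    ultimately show "?R1 \<and> ?R2" ..
  next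
    assume R: "?R1 \<and> ?R2"
    show ?L
    proof (intro allI impI)
      fix i j
      assume "i < j \<and> j < length (z # zs) \<and> P ((z # zs) ! i) \<and> P ((z # zs) ! j)"
      then show "R ((z # zs) ! i) ((z # zs) ! j)"
        using R by (cases i; cases j) auto
    qed
  qed
  then show ?case
    using Cons by (auto simp: in_set_conv_nth)
qed simp

section \<open>Shuffle permutations as interleavings of two lists\<close>

definition shuffle_word :: "nat \<Rightarrow> nat \<Rightarrow> (nat \<Rightarrow> nat) \<Rightarrow> nat list" where
  "shuffle_word m n \<sigma> = map \<sigma> [1..<m + n + 1]"

text \<open>In the one-line notation \<open>map \<sigma> [1..<N + 1]\<close>, the inverse of
  \<sigma> gives the position of a value. It increases on \<open>I\<close> exactly when the values
  from \<open>I\<close> occur in increasing order, which turns conditions on inverses into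
  conditions on lists.\<close>

lemma strict_mono_on_inv_iff_sorted:
  assumes "\<sigma> permutes {1..N}" and "I \<subseteq> {1..N}"
  shows "strict_mono_on I (inv_into UNIV \<sigma>) \<longleftrightarrow>
         sorted_wrt (<) (filter (\<lambda>i. i \<in> I) (map \<sigma> [1..<N + 1]))"
proof -
  have inv: "inv_into UNIV \<sigma> (\<sigma> k) = k" "\<sigma> (inv_into UNIV \<sigma> k) = k" for k
    using permutes_inverses[OF assms(1)] by auto
  have N: "\<sigma> k \<in> {1..N} \<longleftrightarrow> k \<in> {1..N}" for k
    using permutes_in_image[OF assms(1)] by blast
  have "strict_mono_on I (inv_into UNIV \<sigma>) \<longleftrightarrow>
        (\<forall>p q. p \<in> {1..N} \<and> q \<in> {1..N} \<and> \<sigma> p \<in> I \<and> \<sigma> q \<in> I \<and> p < q \<longrightarrow> \<sigma> p < \<sigma> q)"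
    (is "?L \<longleftrightarrow> ?R")
  proof
    assume L: ?L
    show ?R
    proof (intro allI impI)
      fix p q assume pq: "p \<in> {1..N} \<and> q \<in> {1..N} \<and> \<sigma> p \<in> I \<and> \<sigma> q \<in> I \<and> p < q"
      have "\<not> \<sigma> q < \<sigma> p"
        using strict_mono_onD[OF L, of "\<sigma> q" "\<sigma> p"] pq inv by auto
      moreover have "\<sigma> p \<noteq> \<sigma> q"
        using pq inv by (metis less_irrefl)
      ultimately show "\<sigma> p < \<sigma> q" by linarith
    qed
  next
    assume R: ?R
    show ?L
    proof (rule strict_mono_onI)
      fix a b assume ab: "a \<in> I" "b \<in> I" "a < b"
      let ?p = "inv_into UNIV \<sigma> a" and ?q = "inv_into UNIV \<sigma> b"
      have "?p \<in> {1..N}" "?q \<in> {1..N}"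
        using ab assms(2) N[of ?p] N[of ?q] inv by auto
      then have "\<not> ?q < ?p" using R[rule_format, of ?q ?p] ab inv by auto
      moreover have "?p \<noteq> ?q" using ab inv by (metis less_irrefl)
      ultimately show "?p < ?q" by linarith
    qed
  qed
  also have "\<dots> \<longleftrightarrow> (\<forall>i j. i < j \<and> j < N \<and> \<sigma> (Suc i) \<in> I \<and> \<sigma> (Suc j) \<in> I \<longrightarrow> \<sigma> (Suc i) < \<sigma> (Suc j))"
    (is "?L \<longleftrightarrow> ?R")
  proof
    assume R: ?R
    show ?L
    proof (intro allI impI)
      fix p q assume "p \<in> {1..N} \<and> q \<in> {1..N} \<and> \<sigma> p \<in> I \<and> \<sigma> q \<in> I \<and> p < q"
      then show "\<sigma> p < \<sigma> q" using R[rule_format, of "p - 1" "q - 1"] by (auto simp: diff_less_mono)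
    qed
  qed auto
  also have "\<dots> \<longleftrightarrow> sorted_wrt (<) (filter (\<lambda>i. i \<in> I) (map \<sigma> [1..<N + 1]))"
    by (auto simp: sorted_wrt_filter_iff simp del: upt_Suc)
  finally show ?thesis .
qed

text \<open>Filtering an interleaving of two disjoint lists by the entries of either list returns
  that list, and conversely every word interleaves its two filtered parts. The two monotonicity
  conditions therefore say that the one-line notation interleaves the two intervals.\<close>

lemma bij_betw_shuffle_word:
  "bij_betw (shuffle_word m n) (shuffle_perms m n) (shuffles [1..<m+1] [m+1..<m+n+1])"
proof (rule bij_betwI')
  fix \<sigma> \<tau> assume st: "\<sigma> \<in> shuffle_perms m n" "\<tau> \<in> shuffle_perms m n"
  then have p: "\<sigma> permutes {1..m+n}" "\<tau> permutes {1..m+n}"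
    by (auto simp: shuffle_perms_def)
  show "(shuffle_word m n \<sigma> = shuffle_word m n \<tau>) = (\<sigma> = \<tau>)"
  proof
    assume eq: "shuffle_word m n \<sigma> = shuffle_word m n \<tau>"
    have "\<sigma> k = \<tau> k" for k
    proof (cases "k \<in> {1..m+n}")
      case True
      then have "k \<in> set [1..<m+n+1]" by auto
      then show ?thesis using eq by (metis map_eq_conv shuffle_word_def)
    next
      case False
      then show ?thesis using p by (metis permutes_not_in)
    qed
    then show "\<sigma> = \<tau>" by blast
  qed simp
next
  fix \<sigma> assume s: "\<sigma> \<in> shuffle_perms m n"
  then have p: "\<sigma> permutes {1..m+n}" by (auto simp: shuffle_perms_def)
  let ?z = "shuffle_word m n \<sigma>"
  have set: "set ?z = {1..m+n}"
    using permutes_image[OF p] by (simp add: shuffle_word_def atLeastLessThanSuc_atLeastAtMost del: upt_Suc)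
  have "sorted_wrt (<) (filter (\<lambda>i. i \<in> {1..m}) ?z)" "sorted_wrt (<) (filter (\<lambda>i. i \<in> {m+1..m+n}) ?z)"
    using s strict_mono_on_inv_iff_sorted[OF p, of "{1..m}"] strict_mono_on_inv_iff_sorted[OF p, of "{m+1..m+n}"]
    by (auto simp: shuffle_perms_def shuffle_word_def)
  moreover have "filter (\<lambda>i. i \<in> {1..m}) ?z = filter (\<lambda>i. i \<le> m) ?z"
      "filter (\<lambda>i. i \<in> {m+1..m+n}) ?z = filter (\<lambda>i. \<not> i \<le> m) ?z"
    using set by (auto intro!: filter_cong)
  ultimately have "sorted_wrt (<) (filter (\<lambda>i. i \<le> m) ?z)" "sorted_wrt (<) (filter (\<lambda>i. \<not> i \<le> m) ?z)"
    by metis+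
  moreover have "set (filter (\<lambda>i. i \<le> m) ?z) = set [1..<m+1]"
      "set (filter (\<lambda>i. \<not> i \<le> m) ?z) = set [m+1..<m+n+1]"
    using set by auto
  \<comment> \<open>A strictly increasing list is determined by its set of entries.\<close>
  ultimately have f: "filter (\<lambda>i. i \<le> m) ?z = [1..<m+1]" "filter (\<lambda>i. \<not> i \<le> m) ?z = [m+1..<m+n+1]"
    by (auto intro!: strict_sorted_equal simp del: upt_Suc)
  have "?z \<in> shuffles (filter (\<lambda>i. i \<le> m) ?z) (filter (\<lambda>i. \<not> i \<le> m) ?z)"
    by (rule partition_in_shuffles)
  then show "?z \<in> shuffles [1..<m+1] [m+1..<m+n+1]"
    by (simp only: f)
next
  fix z assume z: "z \<in> shuffles [1..<m+1] [m+1..<m+n+1]"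
  have "set z = {1..<m+1} \<union> {m+1..<m+n+1}" using set_shuffles[OF z] unfolding set_upt .
  also have "\<dots> = {1..m+n}" by auto
  finally have set: "set z = {1..m+n}" .
  have len: "length z = m + n" using length_shuffles[OF z] by simp
  have dis: "distinct z" by (rule distinct_disjoint_shuffles[OF _ _ _ z]) (auto simp del: upt_Suc)
  \<comment> \<open>The word determines \<sigma> on \<open>{1..m+n}\<close> only; the identity
    elsewhere makes it a permutation of that set.\<close>
  define \<sigma> where "\<sigma> k = (if k \<in> {1..m+n} then z ! (k - 1) else k)" for k
  have zs: "z = map \<sigma> [1..<m+n+1]"
    by (rule nth_equalityI) (auto simp: len \<sigma>_def simp del: upt_Suc)
  have N: "set [1..<m+n+1] = {1..m+n}" unfolding set_upt by auto
  have "bij_betw \<sigma> (set [1..<m+n+1]) (set z)"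
    using dis zs by (metis bij_betw_def distinct_map set_map)
  then have p: "\<sigma> permutes {1..m+n}"
    unfolding set N by (rule bij_imp_permutes) (auto simp: \<sigma>_def)
  have dj: "set [1..<m+1] \<inter> set [m+1..<m+n+1] = {}" unfolding set_upt by auto
  have I: "(i \<in> set [1..<m+1]) = (i \<in> {1..m})" "(i \<in> set [m+1..<m+n+1]) = (i \<in> {m+1..m+n})" for i unfolding set_upt by auto
  have "filter (\<lambda>i. i \<in> {1..m}) z = [1..<m+1]"  "filter (\<lambda>i. i \<in> {m+1..m+n}) z = [m+1..<m+n+1]"
    using filter_shuffles_disjoint1(1)[OF dj z] filter_shuffles_disjoint2(1)[OF dj z] unfolding I by auto
  then have "sorted_wrt (<) (filter (\<lambda>i. i \<in> {1..m}) z)" "sorted_wrt (<) (filter (\<lambda>i. i \<in> {m+1..m+n}) z)"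
    by (simp_all only: sorted_wrt_upt)
  moreover have "{1..m} \<subseteq> {1..m+n}" "{m+1..m+n} \<subseteq> {1..m+n}" by auto
  ultimately have "strict_mono_on {1..m} (inv_into UNIV \<sigma>)" "strict_mono_on {m+1..m+n} (inv_into UNIV \<sigma>)"
    by (simp_all only: strict_mono_on_inv_iff_sorted[OF p] zs[symmetric])
  then have "\<sigma> \<in> shuffle_perms m n"
    using p by (simp only: shuffle_perms_def mem_Collect_eq simp_thms)
  then show "\<exists>\<sigma>\<in>shuffle_perms m n. z = shuffle_word m n \<sigma>"
    by (rule bexI[rotated]) (simp only: shuffle_word_def zs[symmetric])
qed

section \<open>Admissible signs and merging along a list of indices\<close>

definition merge_positions :: "nat set \<Rightarrow> nat set \<Rightarrow> nat \<Rightarrow> nat list \<Rightarrow> nat set" where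
  "merge_positions I J k zs = {k + i | i. i + 1 < length zs \<and> zs ! i \<in> I \<and> zs ! (i + 1) \<in> J}"

lemma merge_positions_Nil [simp]: "merge_positions I J k [] = {}"
  and merge_positions_single [simp]: "merge_positions I J k [a] = {}"
  by (auto simp: merge_positions_def)

lemma Ex_nat_iff_zero_or_Suc: "(\<exists>i. P i) \<longleftrightarrow> P 0 \<or> (\<exists>i. P (Suc i))"
  by (metis not0_implies_Suc)

text \<open>The offset \<open>k\<close> is the number of the sign after the first entry, counted as
  in \<open>merge_at\<close>, so both advance together when an entry is dropped.\<close>

lemma merge_positions_Cons_Cons:
  "merge_positions I J k (a # b # zs) =
     (if a \<in> I \<and> b \<in> J then {k} else {}) \<union> merge_positions I J (k + 1) (b # zs)"
proof -
  have "p \<in> merge_positions I J k (a # b # zs) \<longleftrightarrow>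
        p \<in> (if a \<in> I \<and> b \<in> J then {k} else {}) \<union> merge_positions I J (k + 1) (b # zs)" for p
  proof -
    have "p \<in> merge_positions I J k (a # b # zs) \<longleftrightarrow>
       (\<exists>i. p = k + i \<and> i < length zs + 1 \<and> (a # b # zs) ! i \<in> I \<and> (b # zs) ! i \<in> J)"
      by (auto simp: merge_positions_def)
    also have "\<dots> \<longleftrightarrow> p = k \<and> a \<in> I \<and> b \<in> J \<or>
       (\<exists>i. p = k + 1 + i \<and> i < length zs \<and> (b # zs) ! i \<in> I \<and> zs ! i \<in> J)"
      (is "(\<exists>i. ?P i) \<longleftrightarrow> ?A \<or> (\<exists>i. ?Q i)")
    proof -
      have "(\<exists>i. ?P i) \<longleftrightarrow> ?P 0 \<or> (\<exists>i. ?P (Suc i))"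
        by (subst Ex_nat_iff_zero_or_Suc) (rule refl)
      then show ?thesis by simp
    qed
    also have "\<dots> \<longleftrightarrow> p \<in> (if a \<in> I \<and> b \<in> J then {k} else {}) \<union> merge_positions I J (k + 1) (b # zs)"
      by (auto simp: merge_positions_def)
    finally show ?thesis .
  qed
  then show ?thesis by blast
qed

lemma merge_positions_Cons_notin:
  "a \<notin> I \<Longrightarrow> merge_positions I J k (a # zs) = merge_positions I J (k + 1) zs"
  by (cases zs) (auto simp: merge_positions_Cons_Cons)

lemma merge_positions_ge: "p \<in> merge_positions I J k zs \<Longrightarrow> k \<le> p"
  by (auto simp: merge_positions_def)

lemma finite_merge_positions [simp]: "finite (merge_positions I J k zs)"
  by (rule finite_subset[of _ "{..<k + length zs}"]) (auto simp: merge_positions_def)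

lemma merge_positions_disjoint: "set zs \<inter> I = {} \<Longrightarrow> merge_positions I J k zs = {}"
  by (auto simp: merge_positions_def disjoint_iff dest: nth_mem Suc_lessD)

lemma merge_positions_disjoint': "set zs \<inter> J = {} \<Longrightarrow> merge_positions I J k zs = {}"
  by (auto simp: merge_positions_def disjoint_iff dest: nth_mem)

text \<open>Sign numbers start at 1 and list positions at 0, hence the offset 1. All values of the
  word lie in \<open>{1..m+n}\<close>, so the inequalities with \<open>m\<close> become membership
  in one of the two intervals.\<close>

lemma admissible_eq_merge_positions:
  assumes "\<sigma> permutes {1..m+n}"
  shows "admissible m n \<sigma> = merge_positions {1..m} {m+1..m+n} 1 (shuffle_word m n \<sigma>)"
proof -
  have N: "\<sigma> k \<in> {1..m+n} \<longleftrightarrow> k \<in> {1..m+n}" for k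
    using permutes_in_image[OF assms] by blast
  have nth: "shuffle_word m n \<sigma> ! i = \<sigma> (i + 1)" if "i < m + n" for i
    using that by (simp add: shuffle_word_def del: upt_Suc)
  have len: "length (shuffle_word m n \<sigma>) = m + n" by (simp add: shuffle_word_def del: upt_Suc)
  show ?thesis
  proof (rule subset_antisym; rule subsetI)
    fix k assume k: "k \<in> admissible m n \<sigma>"
    then have "k \<in> {1..m+n}" "k + 1 \<in> {1..m+n}" by (auto simp: admissible_def)
    then have "\<sigma> k \<in> {1..m+n}" "\<sigma> (k + 1) \<in> {1..m+n}" by (simp_all only: N)
    moreover obtain i where i: "k = Suc i" using k by (cases k) (auto simp: admissible_def)
    ultimately have "k = 1 + i \<and> i + 1 < length (shuffle_word m n \<sigma>) \<and>
      shuffle_word m n \<sigma> ! i \<in> {1..m} \<and> shuffle_word m n \<sigma> ! (i + 1) \<in> {m+1..m+n}"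
      using k nth[of i] nth[of "i + 1"] by (simp add: admissible_def len)
    then show "k \<in> merge_positions {1..m} {m+1..m+n} 1 (shuffle_word m n \<sigma>)"
      unfolding merge_positions_def by blast
  next
    fix k assume "k \<in> merge_positions {1..m} {m+1..m+n} 1 (shuffle_word m n \<sigma>)"
    then show "k \<in> admissible m n \<sigma>"
      using nth by (auto simp: merge_positions_def admissible_def len)
  qed
qed

lemma merge_at_empty [simp]: "merge_at A {} k xs = xs"
  by (induction A "{} :: nat set" k xs rule: merge_at.induct) auto

lemma merge_at_Cons_notin: "k \<notin> T \<Longrightarrow> merge_at A T k (x # xs) = x # merge_at A T (k + 1) xs"
  by (cases xs) auto

text \<open>Signs before \<open>k\<close> have been passed; this discards a sign that is already
  merged.\<close>

lemma merge_at_cong: "(\<And>p. p \<ge> k \<Longrightarrow> p \<in> T \<longleftrightarrow> p \<in> T') \<Longrightarrow> merge_at A T k xs = merge_at A T' k xs"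
  by (induction A T k xs rule: merge_at.induct) auto

text \<open>Mixable shuffles of index lists instead of permutations of \<open>{1..m+n}\<close>: a
  list can lose its first entry while the sign numbers go on, which is what an induction
  needs.\<close>

definition mixed_pairs :: "nat set \<Rightarrow> nat set \<Rightarrow> nat \<Rightarrow> nat list \<Rightarrow> nat list \<Rightarrow> (nat list \<times> nat set) set" where
  "mixed_pairs I J k is js = {(zs, T). zs \<in> shuffles is js \<and> T \<subseteq> merge_positions I J k zs}"

lemma finite_mixed_pairs [simp]: "finite (mixed_pairs I J k is js)"
proof -
  have "mixed_pairs I J k is js = (SIGMA zs:shuffles is js. Pow (merge_positions I J k zs))"
    by (auto simp: mixed_pairs_def)
  then show ?thesis by simp
qed

text \<open>A mixable shuffle begins with an unmerged left index, with a right index, or with a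
  merged pair. A merged sign after \<open>i\<close> is followed by a right index, and right indices
  occur in order, so the partner is \<open>j\<close>. The sign after \<open>j\<close> is never
  admissible, whence the offset \<open>k + 2\<close> in the third family.\<close>

lemma mixed_pairs_Cons_Cons:
  assumes "I \<inter> J = {}" "set (i # is) \<subseteq> I" "set (j # js) \<subseteq> J"
  shows "mixed_pairs I J k (i # is) (j # js) =
     (\<lambda>(zs, T). (i # zs, T)) ` mixed_pairs I J (k + 1) is (j # js) \<union>
     (\<lambda>(zs, T). (j # zs, T)) ` mixed_pairs I J (k + 1) (i # is) js \<union>
     (\<lambda>(zs, T). (i # j # zs, insert k T)) ` mixed_pairs I J (k + 2) is js"
    (is "?M = ?A \<union> ?B \<union> ?D")
proof
  have jI: "j \<notin> I" using assms by auto
  have ij: "i \<in> I" "j \<in> J" using assms by auto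
  show "?M \<subseteq> ?A \<union> ?B \<union> ?D"
  proof
    fix p assume p: "p \<in> ?M"
    then obtain zs T where p': "p = (zs, T)" "zs \<in> shuffles (i # is) (j # js)" "T \<subseteq> merge_positions I J k zs"
      by (auto simp: mixed_pairs_def)
    then consider zs' where "zs = i # zs'" "zs' \<in> shuffles is (j # js)" "k \<notin> T"
      | zs' where "zs = i # zs'" "zs' \<in> shuffles is (j # js)" "k \<in> T"
      | zs' where "zs = j # zs'" "zs' \<in> shuffles (i # is) js" by auto
    then show "p \<in> ?A \<union> ?B \<union> ?D"
    proof cases
      case 1
      have "T \<subseteq> merge_positions I J (k + 1) zs'"
        using p'(3) 1 by (cases zs') (auto simp: merge_positions_Cons_Cons split: if_splits)
      then show ?thesis using 1 p' by (auto simp: mixed_pairs_def)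
    next
      case 2
      then have "k \<in> merge_positions I J k (i # zs')" using p' by blast
      then obtain b zs'' where b: "zs' = b # zs''" "b \<in> J"
        using p'(3) by (cases zs') (auto simp: merge_positions_Cons_Cons split: if_splits dest: merge_positions_ge)
      then have "b = j" "zs'' \<in> shuffles is js"
        using 2 assms by (cases "is"; auto)+
      moreover have "T - {k} \<subseteq> merge_positions I J (k + 2) zs''"
        using p'(3) 2 b \<open>b = j\<close> jI
        by (auto simp: merge_positions_Cons_Cons merge_positions_Cons_notin split: if_splits)
      ultimately have "p = (\<lambda>(zs, T). (i # j # zs, insert k T)) (zs'', T - {k})"
          "(zs'', T - {k}) \<in> mixed_pairs I J (k + 2) is js"
        using 2 b p' by (auto simp: mixed_pairs_def)
      then show ?thesis by blast
    next
      case 3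
      then show ?thesis
        using p' jI by (auto simp: mixed_pairs_def merge_positions_Cons_notin)
    qed
  qed
  have "?A \<subseteq> ?M"
  proof clarify
    fix zs T assume "(zs, T) \<in> mixed_pairs I J (k + 1) is (j # js)"
    then show "(i # zs, T) \<in> ?M"
      by (cases zs) (auto simp: mixed_pairs_def merge_positions_Cons_Cons)
  qed
  moreover have "?B \<subseteq> ?M"
    using jI by (auto simp: mixed_pairs_def merge_positions_Cons_notin)
  moreover have "?D \<subseteq> ?M"
    using jI ij by (auto simp: mixed_pairs_def merge_positions_Cons_Cons merge_positions_Cons_notin
        intro: Cons_in_shuffles_rightI)
  ultimately show "?A \<union> ?B \<union> ?D \<subseteq> ?M" by blast
qed

section \<open>The quasi-shuffle recursion for words of letters\<close>

definition prefixed :: "('c, 'm) ring_scheme \<Rightarrow> 'a \<Rightarrow> ('a list \<Rightarrow> 'c) \<Rightarrow> 'a list \<Rightarrow> 'c" where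
  "prefixed C z f = (\<lambda>w. case w of [] \<Rightarrow> \<zero>\<^bsub>C\<^esub> | c # w' \<Rightarrow> if c = z then f w' else \<zero>\<^bsub>C\<^esub>)"

lemma prefixed_Nil [simp]: "prefixed C z f [] = \<zero>\<^bsub>C\<^esub>"
  and prefixed_Cons [simp]: "prefixed C z f (c # w) = (if c = z then f w else \<zero>\<^bsub>C\<^esub>)"
  by (auto simp: prefixed_def)

text \<open>The quasi-shuffle (stuffle) product, with the merging of letters weighted by
  \<open>lam\<close>. Its values are coefficient functions, because different shuffles can produce
  the same word.\<close>

fun quasi_shuffle ::
    "('c, 'm) ring_scheme \<Rightarrow> ('c, 'a, 'n) module_scheme \<Rightarrow> 'c \<Rightarrow> 'a list \<Rightarrow> 'a list \<Rightarrow> 'a list \<Rightarrow> 'c" where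
  "quasi_shuffle C A lam [] ys = word_gen C ys"
| "quasi_shuffle C A lam (x # xs) [] = word_gen C (x # xs)"
| "quasi_shuffle C A lam (x # xs) (y # ys) =
     (\<lambda>w. prefixed C x (quasi_shuffle C A lam xs (y # ys)) w
        \<oplus>\<^bsub>C\<^esub> prefixed C y (quasi_shuffle C A lam (x # xs) ys) w
        \<oplus>\<^bsub>C\<^esub> lam \<otimes>\<^bsub>C\<^esub> prefixed C (x \<otimes>\<^bsub>A\<^esub> y) (quasi_shuffle C A lam xs ys) w)"

lemma quasi_shuffle_Nil_right [simp]: "quasi_shuffle C A lam xs [] = word_gen C xs"
  by (cases xs) auto

lemma list_pair_induct [case_names Nil_left Nil_right Cons_Cons]:
  assumes "\<And>ys. P [] ys" and "\<And>x xs. P (x # xs) []"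
    and "\<And>x xs y ys. P xs (y # ys) \<Longrightarrow> P (x # xs) ys \<Longrightarrow> P xs ys \<Longrightarrow> P (x # xs) (y # ys)"
  shows "P xs ys"
proof (induction xs arbitrary: ys)
  case (Cons x xs)
  show ?case by (induction ys) (use assms Cons in auto)
qed (rule assms(1))

lemma (in cring) prefixed_closed: "(\<And>w. f w \<in> carrier R) \<Longrightarrow> prefixed R z f w \<in> carrier R"
  by (cases w) auto

lemma (in cring) quasi_shuffle_closed:
  "lam \<in> carrier R \<Longrightarrow> quasi_shuffle R A lam xs ys w \<in> carrier R"
proof (induction xs ys arbitrary: w rule: list_pair_induct)
  case (Cons_Cons x xs y ys)
  then show ?case by (simp add: prefixed_closed)
qed (auto simp: word_gen_def)

lemma (in cring) prefixed_quasi_shuffle_closed: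
  "lam \<in> carrier R \<Longrightarrow> prefixed R z (quasi_shuffle R A lam xs ys) w \<in> carrier R"
  by (intro prefixed_closed quasi_shuffle_closed)

text \<open>All words in question start with the same letter \<open>z\<close>, so only a
  \<open>w\<close> with that first letter receives a contribution. The factor \<open>c\<close>
  allows for the weight of a newly merged sign.\<close>

lemma (in cring) finsum_image_prefixed:
  assumes "finite M" "inj_on h M" "\<And>p. p \<in> M \<Longrightarrow> G p \<in> carrier R" "c \<in> carrier R"
    and F: "\<And>p. p \<in> M \<Longrightarrow> F (h p) = c \<otimes> G p"
    and word: "\<And>p. p \<in> M \<Longrightarrow> word (h p) = z # word' p"
  shows "(\<Oplus>q\<in>{q \<in> h ` M. word q = w}. F q) = c \<otimes> prefixed R z (\<lambda>w'. \<Oplus>p\<in>{p \<in> M. word' p = w'}. G p) w"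
proof (cases "\<exists>w'. w = z # w'")
  case True
  then obtain w' where w: "w = z # w'" by auto
  let ?M = "{p \<in> M. word' p = w'}"
  have "{q \<in> h ` M. word q = w} = h ` ?M" using word w by auto
  moreover have "(\<Oplus>q\<in>h ` ?M. F q) = (\<Oplus>p\<in>?M. F (h p))"
    by (rule finsum_reindex) (use assms in \<open>auto intro: inj_on_subset\<close>)
  moreover have "\<dots> = (\<Oplus>p\<in>?M. c \<otimes> G p)"
    by (rule finsum_cong') (use assms in auto)
  moreover have "\<dots> = c \<otimes> (\<Oplus>p\<in>?M. G p)"
    by (rule finsum_rdistr[symmetric]) (use assms in auto)
  ultimately show ?thesis by (simp add: w)
next
  case False
  then have "{q \<in> h ` M. word q = w} = {}" using word by auto
  moreover have "prefixed R z f w = \<zero>" for f using False by (cases w) auto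
  ultimately show ?thesis using assms(4) by (simp only: finsum_empty r_null)
qed

text \<open>The three families of \<open>mixed_pairs_Cons_Cons\<close> become the three terms of the
  recursion. Indices are kept apart from their letters, so the families stay disjoint even when
  \<open>f i\<close> and \<open>f j\<close> are equal.\<close>

lemma (in cring) sum_mixed_pairs_eq_quasi_shuffle:
  assumes IJ: "I \<inter> J = {}" and lam: "lam \<in> carrier R"
  shows "set is \<subseteq> I \<Longrightarrow> set js \<subseteq> J \<Longrightarrow>
    (\<Oplus>p\<in>{p \<in> mixed_pairs I J k is js. merge_at A (snd p) k (map f (fst p)) = w}. lam [^] card (snd p))
      = quasi_shuffle R A lam (map f is) (map f js) w"
proof (induction "is" js arbitrary: k w rule: list_pair_induct)
  case (Nil_left js)
  then have "merge_positions I J k js = {}"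
    using IJ by (intro merge_positions_disjoint) auto
  then have "{p \<in> mixed_pairs I J k [] js. merge_at A (snd p) k (map f (fst p)) = w} =
        (if w = map f js then {(js, {})} else {})"
    by (auto simp: mixed_pairs_def)
  then show ?case by (simp add: word_gen_def)
next
  case (Nil_right i is')
  define "is" where "is = i # is'"
  have "merge_positions I J k is = {}"
    using IJ Nil_right by (intro merge_positions_disjoint') (auto simp: is_def)
  then have "{p \<in> mixed_pairs I J k is []. merge_at A (snd p) k (map f (fst p)) = w} =
        (if w = map f is then {(is, {})} else {})"
    by (auto simp: mixed_pairs_def)
  then show ?case by (simp add: word_gen_def is_def)
next
  case (Cons_Cons i "is" j js)
  let ?MA = "mixed_pairs I J (k + 1) is (j # js)" and ?MB = "mixed_pairs I J (k + 1) (i # is) js"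
    and ?MD = "mixed_pairs I J (k + 2) is js"
  let ?hA = "\<lambda>(zs, T). (i # zs, T :: nat set)" and ?hB = "\<lambda>(zs, T). (j # zs, T :: nat set)"
    and ?hD = "\<lambda>(zs, T). (i # j # zs, insert k T)"
  let ?P = "\<lambda>p. merge_at A (snd p) k (map f (fst p)) = w"
  let ?F = "\<lambda>p :: nat list \<times> nat set. lam [^] card (snd p)"
  let ?Q = "\<lambda>k is js w. \<Oplus>p\<in>{p \<in> mixed_pairs I J k is js. merge_at A (snd p) k (map f (fst p)) = w}. ?F p"
  have ij: "i \<noteq> j" using Cons_Cons IJ by auto
  have F: "?F p \<in> carrier R" for p using lam by auto
  have ge: "T \<subseteq> {l..}" "k < l \<Longrightarrow> k \<notin> T" "finite T" if "(zs, T) \<in> mixed_pairs I J l is' js'" for zs T l is' js'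
    using that merge_positions_ge finite_subset[OF _ finite_merge_positions[of I J l zs]]
    by (fastforce simp: mixed_pairs_def)+
  have split: "{p \<in> mixed_pairs I J k (i # is) (j # js). ?P p} =
      {p \<in> ?hA ` ?MA. ?P p} \<union> {p \<in> ?hB ` ?MB. ?P p} \<union> {p \<in> ?hD ` ?MD. ?P p}"
    using mixed_pairs_Cons_Cons[OF IJ Cons_Cons(4,5)] by auto
  have "(\<Oplus>p\<in>{p \<in> mixed_pairs I J k (i # is) (j # js). ?P p}. ?F p) =
      (\<Oplus>p\<in>{p \<in> ?hA ` ?MA. ?P p}. ?F p) \<oplus> (\<Oplus>p\<in>{p \<in> ?hB ` ?MB. ?P p}. ?F p)
       \<oplus> (\<Oplus>p\<in>{p \<in> ?hD ` ?MD. ?P p}. ?F p)"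
    unfolding split
  \<comment> \<open>The second family starts with \<open>j\<close> instead of \<open>i\<close>; the
    other two both start with \<open>i\<close> and differ in whether sign \<open>k\<close> is
    merged.\<close>
  proof (subst finsum_Un_disjoint, goal_cases)
    case 3
    show ?case using ij ge(2)[of _ _ "k+1"] by fastforce
  next
    case 6
    show ?case by (subst finsum_Un_disjoint) (use F ij in auto)
  qed (use F in auto)
  also have "(\<Oplus>p\<in>{p \<in> ?hA ` ?MA. ?P p}. ?F p) = \<one> \<otimes> prefixed R (f i) (?Q (k + 1) is (j # js)) w"
    by (rule finsum_image_prefixed[OF finite_mixed_pairs])
      (use F ge(2)[of _ _ "k + 1"] in \<open>auto simp: inj_on_def merge_at_Cons_notin\<close>)
  also have "(\<Oplus>p\<in>{p \<in> ?hB ` ?MB. ?P p}. ?F p) = \<one> \<otimes> prefixed R (f j) (?Q (k + 1) (i # is) js) w"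
    by (rule finsum_image_prefixed[OF finite_mixed_pairs])
      (use F ge(2)[of _ _ "k + 1"] in \<open>auto simp: inj_on_def merge_at_Cons_notin\<close>)
  also have "(\<Oplus>p\<in>{p \<in> ?hD ` ?MD. ?P p}. ?F p) = lam \<otimes> prefixed R (f i \<otimes>\<^bsub>A\<^esub> f j) (?Q (k + 2) is js) w"
  proof (rule finsum_image_prefixed[OF finite_mixed_pairs])
    show "inj_on ?hD ?MD"
    proof (rule inj_onI)
      fix p q assume pq: "p \<in> ?MD" "q \<in> ?MD" "?hD p = ?hD q"
      have "k \<notin> snd p" "k \<notin> snd q"
        using pq(1,2) ge(2)[of "fst p" "snd p" "k+2"] ge(2)[of "fst q" "snd q" "k+2"] by auto
      then show "p = q" using pq(3) by (auto simp: case_prod_beta prod_eq_iff)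
    qed
    \<comment> \<open>\<open>k\<close> is new in \<open>T\<close>, so the cardinality grows by one
      and with it the power of \<open>lam\<close>.\<close>
    show "?F (?hD p) = lam \<otimes> ?F p" if "p \<in> ?MD" for p
      using that ge(2,3)[of "fst p" "snd p" "k + 2"] lam by (cases p) (auto simp: m_comm)
    show "merge_at A (snd (?hD p)) k (map f (fst (?hD p))) = (f i \<otimes>\<^bsub>A\<^esub> f j) # merge_at A (snd p) (k + 2) (map f (fst p))"
      if p: "p \<in> ?MD" for p
    proof -
      obtain zs T where p': "p = (zs, T)" "(zs, T) \<in> ?MD" using p by (cases p) auto
      \<comment> \<open>The sign after the merged pair stays, so the product of the two letters is
        complete and the numbering resumes at \<open>k + 2\<close>.\<close>
      have "k + 1 \<notin> insert k T" using ge(1)[OF p'(2)] by auto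
      then have "merge_at A (insert k T) k (map f (i # j # zs)) =
         (f i \<otimes>\<^bsub>A\<^esub> f j) # merge_at A (insert k T) (k + 1 + 1) (map f zs)"
        using merge_at_Cons_notin[of "k+1" "insert k T" A "f i \<otimes>\<^bsub>A\<^esub> f j" "map f zs"] by simp
      also have "merge_at A (insert k T) (k + 1 + 1) (map f zs) = merge_at A T (k + 1 + 1) (map f zs)"
        by (rule merge_at_cong) auto
      finally show ?thesis by (simp add: p'(1) add.assoc)
    qed
  qed (use F lam in auto)
  finally show ?case
    using Cons_Cons by (simp add: prefixed_quasi_shuffle_closed lam)
qed

text \<open>Passing from \<sigma> to its one-line notation keeps \<open>T\<close>, the power of
  \<open>lam\<close> and the merged word, so the defining sum is one over
  \<open>mixed_pairs\<close>. The heads take no part in the shuffle; their product is a common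
  prefix.\<close>

lemma (in cring) word_shuffle_eq_quasi_shuffle:
  assumes "lam \<in> carrier R"
  shows "word_shuffle R A lam u v =
         prefixed R (hd u \<otimes>\<^bsub>A\<^esub> hd v) (quasi_shuffle R A lam (tl u) (tl v))"
proof (rule ext)
  fix w
  let ?h = "hd u \<otimes>\<^bsub>A\<^esub> hd v" and ?xs = "tl u" and ?ys = "tl v"
  let ?m = "length ?xs" and ?n = "length ?ys"
  let ?is = "[1..<?m+1]" and ?js = "[?m+1..<?m+?n+1]" and ?I = "{1..?m}" and ?J = "{?m+1..?m+?n}"
  \<comment> \<open>Letters are numbered from 1 here, list positions from 0.\<close>
  define f where "f i = (?xs @ ?ys) ! (i - 1)" for i
  have fi: "map f ?is = ?xs"
    by (rule nth_equalityI) (auto simp: f_def nth_append simp del: upt_Suc)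
  have fj: "map f ?js = ?ys"
    by (rule nth_equalityI) (auto simp: f_def nth_append simp del: upt_Suc)
  have mw: "mixed_word A \<sigma> T ?xs ?ys = merge_at A T 1 (map f (shuffle_word ?m ?n \<sigma>))" for \<sigma> T
    by (simp add: mixed_word_def shuffle_word_def f_def comp_def del: upt_Suc)
  let ?S = "\<lambda>w'. {(\<sigma>, T). (\<sigma>, T) \<in> mixable_shuffles ?m ?n \<and> mixed_word A \<sigma> T ?xs ?ys = w'}"
  have sw: "shuffle_word ?m ?n ` shuffle_perms ?m ?n = shuffles ?is ?js" "inj_on (shuffle_word ?m ?n) (shuffle_perms ?m ?n)"
    using bij_betw_shuffle_word[of ?m ?n] by (auto simp: bij_betw_def)
  have "finite (shuffle_perms ?m ?n)"
    using sw finite_imageD by (metis finite_shuffles)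
  moreover have "mixable_shuffles ?m ?n = (SIGMA \<sigma>:shuffle_perms ?m ?n. Pow (admissible ?m ?n \<sigma>))"
    by (auto simp: mixable_shuffles_def)
  ultimately have fin: "finite (mixable_shuffles ?m ?n)"
    by (auto simp: admissible_def)
  have *: "(\<Oplus>p\<in>?S w'. lam [^] card (snd p)) = quasi_shuffle R A lam ?xs ?ys w'" for w'
  proof -
    let ?g = "\<lambda>(\<sigma>, T :: nat set). (shuffle_word ?m ?n \<sigma>, T)"
    let ?Z = "{p \<in> mixed_pairs ?I ?J 1 ?is ?js. merge_at A (snd p) 1 (map f (fst p)) = w'}"
    have adm: "admissible ?m ?n \<sigma> = merge_positions ?I ?J 1 (shuffle_word ?m ?n \<sigma>)" if "\<sigma> \<in> shuffle_perms ?m ?n" for \<sigma>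
      using that by (intro admissible_eq_merge_positions) (simp add: shuffle_perms_def)
    have img: "?g ` ?S w' = ?Z"
    proof
      show "?g ` ?S w' \<subseteq> ?Z"
        using sw(1) adm by (auto simp: mixable_shuffles_def mixed_pairs_def mw simp del: upt_Suc)
      show "?Z \<subseteq> ?g ` ?S w'"
      proof
        fix p assume "p \<in> ?Z"
        then obtain zs T where zs: "p = (zs, T)" "(zs, T) \<in> mixed_pairs ?I ?J 1 ?is ?js"
            "merge_at A T 1 (map f zs) = w'" by (cases p) auto
        then obtain \<sigma> where s: "\<sigma> \<in> shuffle_perms ?m ?n" "zs = shuffle_word ?m ?n \<sigma>"
          using sw(1) by (auto simp: mixed_pairs_def simp del: upt_Suc)
        have "(\<sigma>, T) \<in> ?S w'" using zs s adm by (auto simp: mixable_shuffles_def mixed_pairs_def mw)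
        then show "p \<in> ?g ` ?S w'" unfolding zs(1) s(2) by (rule rev_image_eqI) simp
      qed
    qed
    have inj: "inj_on ?g (?S w')"
      using sw(2) by (auto simp: inj_on_def mixable_shuffles_def)
    have "(\<Oplus>p\<in>?Z. lam [^] card (snd p)) = (\<Oplus>p\<in>?S w'. lam [^] card (snd (?g p)))"
      unfolding img[symmetric] by (rule finsum_reindex) (use inj assms in auto)
    also have "\<dots> = (\<Oplus>p\<in>?S w'. lam [^] card (snd p))"
      by (rule finsum_cong') (use assms in auto)
    finally have "(\<Oplus>p\<in>?S w'. lam [^] card (snd p)) = (\<Oplus>p\<in>?Z. lam [^] card (snd p))" ..
    also have "\<dots> = quasi_shuffle R A lam (map f ?is) (map f ?js) w'"
      by (rule sum_mixed_pairs_eq_quasi_shuffle) (use assms in auto)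
    finally show ?thesis unfolding fi fj .
  qed
  \<comment> \<open>The image under \<open>id\<close> and the factor 1 bring the sum into the form
    of \<open>finsum_image_prefixed\<close>.\<close>
  have "word_shuffle R A lam u v w =
      (\<Oplus>p\<in>{p \<in> id ` mixable_shuffles ?m ?n. ?h # mixed_word A (fst p) (snd p) ?xs ?ys = w}. lam [^] card (snd p))"
    by (simp add: word_shuffle_def case_prod_beta')
  also have "\<dots> = \<one> \<otimes> prefixed R ?h (\<lambda>w'. \<Oplus>p\<in>{p \<in> mixable_shuffles ?m ?n. mixed_word A (fst p) (snd p) ?xs ?ys = w'}. lam [^] card (snd p)) w"
    by (rule finsum_image_prefixed) (use assms fin in auto)
  also have "\<dots> = prefixed R ?h (quasi_shuffle R A lam ?xs ?ys) w"
    using * by (simp add: case_prod_beta' prefixed_quasi_shuffle_closed assms)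
  finally show "word_shuffle R A lam u v w = prefixed R ?h (quasi_shuffle R A lam ?xs ?ys) w" .
qed

section \<open>Finitely supported functions on words\<close>

locale word_module = algebra C A
  for C :: "('c, 'm) ring_scheme" (structure) and A :: "('c, 'a, 'n) module_scheme" (structure)
begin

text \<open>The module operations of \<open>free_tensors\<close> do not depend on the degree. With
  degree-free names, words of different lengths live in one module, as products of words
  require.\<close>

definition fadd :: "('a list \<Rightarrow> 'c) \<Rightarrow> ('a list \<Rightarrow> 'c) \<Rightarrow> 'a list \<Rightarrow> 'c" (infixl \<open>\<boxplus>\<close> 65)
  where "f \<boxplus> g = (\<lambda>w. f w \<oplus> g w)"

definition fscale :: "'c \<Rightarrow> ('a list \<Rightarrow> 'c) \<Rightarrow> 'a list \<Rightarrow> 'c" (infixr \<open>\<bullet>\<close> 70)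
  where "c \<bullet> f = (\<lambda>w. c \<otimes> f w)"

definition fzero :: "'a list \<Rightarrow> 'c"
  where "fzero = (\<lambda>w. \<zero>)"

lemma fadd_apply: "(f \<boxplus> g) w = f w \<oplus> g w"
  and fscale_apply: "(c \<bullet> f) w = c \<otimes> f w"
  and fzero_apply: "fzero w = \<zero>"
  by (auto simp: fadd_def fscale_def fzero_def)

lemmas fapply = fadd_apply fscale_apply fzero_apply

abbreviation gen :: "'a list \<Rightarrow> 'a list \<Rightarrow> 'c"
  where "gen \<equiv> word_gen C"

text \<open>One notion for several modules: the predicate can select the words of a fixed length,
  which gives the free module of a tensor power, the nonempty words, or all words. Degree bounds for
  products are predicates as well.\<close>

definition words_mod :: "('a list \<Rightarrow> bool) \<Rightarrow> ('a list \<Rightarrow> 'c) set" where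
  "words_mod P = {f. (\<forall>w. f w \<in> carrier C) \<and> finite (word_supp C f) \<and>
                     (\<forall>w\<in>word_supp C f. set w \<subseteq> carrier A \<and> P w)}"

lemma words_modI:
  assumes "\<And>w. f w \<in> carrier C" "finite (word_supp C f)"
    "\<And>w. f w \<noteq> \<zero> \<Longrightarrow> set w \<subseteq> carrier A" "\<And>w. f w \<noteq> \<zero> \<Longrightarrow> P w"
  shows "f \<in> words_mod P"
  using assms by (auto simp: words_mod_def word_supp_def)

lemma words_mod_closed: "f \<in> words_mod P \<Longrightarrow> f w \<in> carrier C"
  and words_mod_finite: "f \<in> words_mod P \<Longrightarrow> finite (word_supp C f)"
  and words_mod_set: "f \<in> words_mod P \<Longrightarrow> f w \<noteq> \<zero> \<Longrightarrow> set w \<subseteq> carrier A"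
  and words_mod_pred: "f \<in> words_mod P \<Longrightarrow> f w \<noteq> \<zero> \<Longrightarrow> P w"
  by (auto simp: words_mod_def word_supp_def)

lemma words_mod_mono: "f \<in> words_mod P \<Longrightarrow> (\<And>w. P w \<Longrightarrow> Q w) \<Longrightarrow> f \<in> words_mod Q"
  by (auto simp: words_mod_def)

lemma fzero_in_words_mod [simp, intro]: "fzero \<in> words_mod P"
  by (auto simp: words_mod_def word_supp_def fapply)

lemma word_gen_closed [simp]: "gen w v \<in> carrier C"
  by (simp add: word_gen_def)

lemma gen_in_words_mod [intro]: "set w \<subseteq> carrier A \<Longrightarrow> P w \<Longrightarrow> gen w \<in> words_mod P"
  by (rule words_modI) (auto simp: word_gen_def word_supp_def split: if_splits)

lemma fadd_in_words_mod [simp, intro]: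
  assumes "f \<in> words_mod P" "g \<in> words_mod P"
  shows "f \<boxplus> g \<in> words_mod P"
proof (rule words_modI)
  note [simp] = assms[THEN words_mod_closed]
  have nz: "f w \<noteq> \<zero> \<or> g w \<noteq> \<zero>" if "(f \<boxplus> g) w \<noteq> \<zero>" for w using that assms by (auto simp: fapply)
  show "finite (word_supp C (f \<boxplus> g))"
    by (rule finite_subset[of _ "word_supp C f \<union> word_supp C g"]) (use assms nz in \<open>auto simp: word_supp_def words_mod_def\<close>)
  show "set w \<subseteq> carrier A" "P w" if "(f \<boxplus> g) w \<noteq> \<zero>" for w
    using nz[OF that] assms words_mod_set words_mod_pred by metis+
qed (use assms[THEN words_mod_closed] in \<open>auto simp: fapply\<close>)

lemma fscale_in_words_mod [simp, intro]:
  assumes "f \<in> words_mod P" "c \<in> carrier C"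
  shows "c \<bullet> f \<in> words_mod P"
proof (rule words_modI)
  note [simp] = assms(1)[THEN words_mod_closed]
  have nz: "f w \<noteq> \<zero>" if "(c \<bullet> f) w \<noteq> \<zero>" for w using that assms by (auto simp: fapply)
  show "finite (word_supp C (c \<bullet> f))"
    by (rule finite_subset[of _ "word_supp C f"]) (use assms nz in \<open>auto simp: word_supp_def words_mod_def\<close>)
  show "set w \<subseteq> carrier A" "P w" if "(c \<bullet> f) w \<noteq> \<zero>" for w
    using nz[OF that] assms words_mod_set words_mod_pred by metis+
qed (use assms(2) words_mod_closed[OF assms(1)] in \<open>auto simp: fapply\<close>)

text \<open>Induction on the support: splitting off the term at one word removes that word from it.
  With this rule an identity that is linear in \<open>f\<close> reduces to generators.\<close>

lemma words_mod_induct [consumes 1, case_names zero gen add scale]: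
  assumes f: "f \<in> words_mod P"
    and zero: "Q fzero"
    and gen: "\<And>w. set w \<subseteq> carrier A \<Longrightarrow> P w \<Longrightarrow> Q (gen w)"
    and add: "\<And>f g. f \<in> words_mod P \<Longrightarrow> g \<in> words_mod P \<Longrightarrow> Q f \<Longrightarrow> Q g \<Longrightarrow> Q (f \<boxplus> g)"
    and scale: "\<And>c f. c \<in> carrier C \<Longrightarrow> f \<in> words_mod P \<Longrightarrow> Q f \<Longrightarrow> Q (c \<bullet> f)"
  shows "Q f"
proof -
  have "\<forall>f. f \<in> words_mod P \<longrightarrow> word_supp C f \<subseteq> S \<longrightarrow> Q f" if "finite S" for S
    using that
  proof induction
    case empty
    have "f = fzero" if "word_supp C f \<subseteq> {}" for f
      using that by (intro ext) (auto simp: word_supp_def fapply)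
    then show ?case using zero by blast
  next
    case (insert w S)
    show ?case
    proof (intro allI impI)
      fix f assume f: "f \<in> words_mod P" "word_supp C f \<subseteq> insert w S"
      show "Q f"
      proof (cases "f w = \<zero>")
        case True
        then have "word_supp C f \<subseteq> S" using f(2) by (auto simp: word_supp_def)
        then show ?thesis using insert f(1) by blast
      next
        case False
        let ?g = "f(w := \<zero>)"
        have sub: "word_supp C ?g \<subseteq> word_supp C f" by (auto simp: word_supp_def)
        have g: "?g \<in> words_mod P"
          using f(1) finite_subset[OF sub] by (auto simp: words_mod_def word_supp_def)
        have w: "set w \<subseteq> carrier A" "P w" using False f(1) words_mod_set words_mod_pred by blast+
        have "word_supp C ?g \<subseteq> S" using f(2) by (auto simp: word_supp_def)
        then have "Q ?g" using insert g by blast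
        moreover have "f = ?g \<boxplus> f w \<bullet> gen w"
          using words_mod_closed[OF f(1)] by (intro ext) (auto simp: word_gen_def fapply)
        ultimately show ?thesis
          using add[OF g, of "f w \<bullet> gen w"] scale[of "f w" "gen w"] gen[OF w] f(1) w gen_in_words_mod
          by (metis fscale_in_words_mod words_mod_closed)
      qed
    qed
  qed
  then show ?thesis using f words_mod_finite by blast
qed

abbreviation all_words :: "('a list \<Rightarrow> 'c) set"
  where "all_words \<equiv> words_mod (\<lambda>_. True)"

lemma words_mod_all: "f \<in> words_mod P \<Longrightarrow> f \<in> all_words"
  by (erule words_mod_mono) simp

lemma fscale_fadd:
  "f \<in> all_words \<Longrightarrow> g \<in> all_words \<Longrightarrow> c \<in> carrier C \<Longrightarrow> c \<bullet> (f \<boxplus> g) = c \<bullet> f \<boxplus> c \<bullet> g"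
  using words_mod_closed by (auto simp: fapply R.r_distr intro!: ext)

lemma fscale_left_commute:
  "f \<in> all_words \<Longrightarrow> c \<in> carrier C \<Longrightarrow> d \<in> carrier C \<Longrightarrow> c \<bullet> (d \<bullet> f) = d \<bullet> (c \<bullet> f)"
  using words_mod_closed by (auto simp: fapply R.m_lcomm intro!: ext)

lemma fscale_fzero [simp]: "c \<in> carrier C \<Longrightarrow> c \<bullet> fzero = fzero"
  by (auto simp: fapply intro!: ext)

lemma letter_in: "x \<in> carrier A \<Longrightarrow> gen [x] \<in> words_mod (\<lambda>w. length w = Suc 0)"
  by (intro gen_in_words_mod) auto

abbreviation nonempty_words :: "('a list \<Rightarrow> 'c) set"
  where "nonempty_words \<equiv> words_mod (\<lambda>w. w \<noteq> [])"

lemmas nonempty_all_words = words_mod_all[of _ "\<lambda>w. w \<noteq> []"]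

subsection \<open>Bilinear extensions\<close>

abbreviation "bilin \<equiv> bilinear_extension C"

text \<open>Enlarging the ranges of summation adds only zero terms. A common range makes the sums
  for different functions comparable.\<close>

lemma bilinear_extension_superset:
  assumes f: "f \<in> all_words" and g: "g \<in> all_words" and \<beta>: "\<And>u v w. \<beta> u v w \<in> carrier C"
    and S: "finite S" "word_supp C f \<subseteq> S" and T: "finite T" "word_supp C g \<subseteq> T"
  shows "bilin \<beta> f g w = (\<Oplus>u\<in>S. \<Oplus>v\<in>T. f u \<otimes> g v \<otimes> \<beta> u v w)"
proof -
  note [simp] = f[THEN words_mod_closed] g[THEN words_mod_closed] f[THEN words_mod_finite] g[THEN words_mod_finite] \<beta>
  have "(\<Oplus>u\<in>word_supp C f. \<Oplus>v\<in>word_supp C g. f u \<otimes> g v \<otimes> \<beta> u v w) =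
        (\<Oplus>u\<in>word_supp C f. \<Oplus>v\<in>T. f u \<otimes> g v \<otimes> \<beta> u v w)"
    by (rule R.finsum_cong', rule refl)
      (use f g \<beta> T in \<open>auto intro!: R.finsum_closed R.add.finprod_mono_neutral_cong_left simp: word_supp_def\<close>)
  also have "\<dots> = (\<Oplus>u\<in>S. \<Oplus>v\<in>T. f u \<otimes> g v \<otimes> \<beta> u v w)"
    by (rule R.add.finprod_mono_neutral_cong_left)
      (use f g \<beta> S in \<open>auto intro!: R.finsum_closed R.add.finprod_one_eqI simp: word_supp_def\<close>)
  finally show ?thesis by (simp add: bilinear_extension_def)
qed

lemma bilinear_extension_add_left:
  assumes f: "f \<in> all_words" "f' \<in> all_words" and g: "g \<in> all_words" and \<beta>: "\<And>u v w. \<beta> u v w \<in> carrier C"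
  shows "bilin \<beta> (f \<boxplus> f') g = bilin \<beta> f g \<boxplus> bilin \<beta> f' g"
proof (rule ext)
  note [simp] = f[THEN words_mod_closed] g[THEN words_mod_closed] f[THEN words_mod_finite] g[THEN words_mod_finite] \<beta>
  fix w
  let ?S = "word_supp C f \<union> word_supp C f'" and ?T = "word_supp C g"
  have "word_supp C (f \<boxplus> f') \<subseteq> ?S" using f by (auto simp: word_supp_def fapply)
  note sup = bilinear_extension_superset[where S = ?S and T = ?T and \<beta> = \<beta> and w = w, OF _ g \<beta>]
  have "bilin \<beta> (f \<boxplus> f') g w = (\<Oplus>u\<in>?S. \<Oplus>v\<in>?T. (f \<boxplus> f') u \<otimes> g v \<otimes> \<beta> u v w)"
    by (rule sup) (use f g \<open>word_supp C (f \<boxplus> f') \<subseteq> ?S\<close> in auto)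
  also have "\<dots> = (\<Oplus>u\<in>?S. (\<Oplus>v\<in>?T. f u \<otimes> g v \<otimes> \<beta> u v w) \<oplus> (\<Oplus>v\<in>?T. f' u \<otimes> g v \<otimes> \<beta> u v w))"
  proof (rule R.finsum_cong')
    fix u assume "u \<in> ?S"
    have "(\<Oplus>v\<in>?T. (f \<boxplus> f') u \<otimes> g v \<otimes> \<beta> u v w) = (\<Oplus>v\<in>?T. f u \<otimes> g v \<otimes> \<beta> u v w \<oplus> f' u \<otimes> g v \<otimes> \<beta> u v w)"
      by (rule R.finsum_cong') (use f g \<beta> in \<open>auto simp: fapply R.l_distr\<close>)
    also have "\<dots> = (\<Oplus>v\<in>?T. f u \<otimes> g v \<otimes> \<beta> u v w) \<oplus> (\<Oplus>v\<in>?T. f' u \<otimes> g v \<otimes> \<beta> u v w)"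
      by (rule R.finsum_addf) (use f g \<beta> in auto)
    finally show "(\<Oplus>v\<in>?T. (f \<boxplus> f') u \<otimes> g v \<otimes> \<beta> u v w) = \<dots>" .
  qed (use f g \<beta> in \<open>auto simp: fapply intro!: R.finsum_closed\<close>)
  also have "\<dots> = (\<Oplus>u\<in>?S. \<Oplus>v\<in>?T. f u \<otimes> g v \<otimes> \<beta> u v w) \<oplus> (\<Oplus>u\<in>?S. \<Oplus>v\<in>?T. f' u \<otimes> g v \<otimes> \<beta> u v w)"
    by (rule R.finsum_addf) (use f g \<beta> in \<open>auto simp: fapply intro!: R.finsum_closed\<close>)
  also have "(\<Oplus>u\<in>?S. \<Oplus>v\<in>?T. f u \<otimes> g v \<otimes> \<beta> u v w) = bilin \<beta> f g w"
    by (rule sup[symmetric]) (use f g in auto)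
  also have "(\<Oplus>u\<in>?S. \<Oplus>v\<in>?T. f' u \<otimes> g v \<otimes> \<beta> u v w) = bilin \<beta> f' g w"
    by (rule sup[symmetric]) (use f g in auto)
  finally show "bilin \<beta> (f \<boxplus> f') g w = (bilin \<beta> f g \<boxplus> bilin \<beta> f' g) w"
    by (simp only: fadd_def)
qed

lemma bilinear_extension_scale_left:
  assumes f: "f \<in> all_words" and g: "g \<in> all_words" and c: "c \<in> carrier C" and \<beta>: "\<And>u v w. \<beta> u v w \<in> carrier C"
  shows "bilin \<beta> (c \<bullet> f) g = c \<bullet> bilin \<beta> f g"
proof (rule ext)
  note [simp] = f[THEN words_mod_closed] g[THEN words_mod_closed] f[THEN words_mod_finite] g[THEN words_mod_finite] \<beta>
  fix w
  let ?S = "word_supp C f" and ?T = "word_supp C g"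
  have "word_supp C (c \<bullet> f) \<subseteq> ?S" using c by (auto simp: word_supp_def fapply)
  then have "bilin \<beta> (c \<bullet> f) g w = (\<Oplus>u\<in>?S. \<Oplus>v\<in>?T. (c \<bullet> f) u \<otimes> g v \<otimes> \<beta> u v w)"
    by (intro bilinear_extension_superset) (use f g c \<beta> in auto)
  also have "\<dots> = (\<Oplus>u\<in>?S. c \<otimes> (\<Oplus>v\<in>?T. f u \<otimes> g v \<otimes> \<beta> u v w))"
  proof (rule R.finsum_cong')
    fix u assume "u \<in> ?S"
    have "(\<Oplus>v\<in>?T. (c \<bullet> f) u \<otimes> g v \<otimes> \<beta> u v w) = (\<Oplus>v\<in>?T. c \<otimes> (f u \<otimes> g v \<otimes> \<beta> u v w))"
      by (rule R.finsum_cong') (use f g c \<beta> in \<open>auto simp: fapply R.m_assoc\<close>)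
    also have "\<dots> = c \<otimes> (\<Oplus>v\<in>?T. f u \<otimes> g v \<otimes> \<beta> u v w)"
      by (rule R.finsum_rdistr[symmetric]) (use f g c \<beta> in auto)
    finally show "(\<Oplus>v\<in>?T. (c \<bullet> f) u \<otimes> g v \<otimes> \<beta> u v w) = \<dots>" .
  qed (use f g c \<beta> in \<open>auto simp: fapply intro!: R.finsum_closed\<close>)
  also have "\<dots> = c \<otimes> (\<Oplus>u\<in>?S. \<Oplus>v\<in>?T. f u \<otimes> g v \<otimes> \<beta> u v w)"
    by (rule R.finsum_rdistr[symmetric]) (use f g c \<beta> in \<open>auto simp: fapply intro!: R.finsum_closed\<close>)
  finally show "bilin \<beta> (c \<bullet> f) g w = (c \<bullet> bilin \<beta> f g) w"
    by (simp add: bilinear_extension_def fapply)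
qed

text \<open>The two finite sums are exchanged; linearity on the right then follows from linearity on
  the left.\<close>

lemma bilinear_extension_swap:
  assumes f: "f \<in> all_words" and g: "g \<in> all_words" and \<beta>: "\<And>u v w. \<beta> u v w \<in> carrier C"
  shows "bilin \<beta> f g = bilin (\<lambda>u v. \<beta> v u) g f"
proof (rule ext)
  fix w
  note [simp] = f[THEN words_mod_closed] g[THEN words_mod_closed] \<beta>
  have swap: "(\<Oplus>u\<in>S. \<Oplus>v\<in>T. h u v) = (\<Oplus>v\<in>T. \<Oplus>u\<in>S. h u v)"
    if "finite S" "finite T" "\<And>u v. h u v \<in> carrier C" for S T and h :: "'a list \<Rightarrow> 'a list \<Rightarrow> 'c"
    using that(1)
  proof induction
    case (insert u S)
    have "(\<Oplus>v\<in>T. \<Oplus>u'\<in>insert u S. h u' v) = (\<Oplus>v\<in>T. h u v \<oplus> (\<Oplus>u'\<in>S. h u' v))"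
      by (rule R.finsum_cong') (use insert that(3) in \<open>auto intro!: R.finsum_closed\<close>)
    then show ?case using insert that(2,3) by (simp add: R.finsum_addf Pi_def)
  qed simp
  have "bilin \<beta> f g w = (\<Oplus>v\<in>word_supp C g. \<Oplus>u\<in>word_supp C f. f u \<otimes> g v \<otimes> \<beta> u v w)"
    unfolding bilinear_extension_def by (rule swap) (use f g words_mod_finite in auto)
  also have "\<dots> = bilin (\<lambda>u v. \<beta> v u) g f w"
    unfolding bilinear_extension_def
    by (intro R.finsum_cong' refl) (auto intro!: R.finsum_closed R.finsum_cong' simp: R.m_comm)
  finally show "bilin \<beta> f g w = bilin (\<lambda>u v. \<beta> v u) g f w" .
qed

lemma bilinear_extension_add_right:
  assumes "f \<in> all_words" "g \<in> all_words" "g' \<in> all_words" and \<beta>: "\<And>u v w. \<beta> u v w \<in> carrier C"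
  shows "bilin \<beta> f (g \<boxplus> g') = bilin \<beta> f g \<boxplus> bilin \<beta> f g'"
  using assms by (simp add: bilinear_extension_swap[where \<beta> = \<beta> and f = f] bilinear_extension_add_left)

lemma bilinear_extension_scale_right:
  assumes "f \<in> all_words" "g \<in> all_words" "c \<in> carrier C" and \<beta>: "\<And>u v w. \<beta> u v w \<in> carrier C"
  shows "bilin \<beta> f (c \<bullet> g) = c \<bullet> bilin \<beta> f g"
  using assms by (simp add: bilinear_extension_swap[where \<beta> = \<beta> and f = f] bilinear_extension_scale_left)

lemma bilinear_extension_zero_left [simp]: "bilin \<beta> fzero g = fzero"
  by (rule ext) (simp add: bilinear_extension_def word_supp_def fapply)

lemma bilinear_extension_zero_right [simp]: "bilin \<beta> f fzero = fzero"
  by (rule ext) (simp add: bilinear_extension_def word_supp_def fapply)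

lemma bilinear_extension_gen:
  assumes \<beta>: "\<And>u v w. \<beta> u v w \<in> carrier C" and "set u \<subseteq> carrier A" "set v \<subseteq> carrier A"
  shows "bilin \<beta> (gen u) (gen v) = \<beta> u v"
proof (rule ext)
  fix w
  have "bilin \<beta> (gen u) (gen v) w = (\<Oplus>u'\<in>{u}. \<Oplus>v'\<in>{v}. gen u u' \<otimes> gen v v' \<otimes> \<beta> u' v' w)"
    by (rule bilinear_extension_superset)
      (use assms in \<open>auto intro!: gen_in_words_mod simp: word_supp_def word_gen_def[THEN fun_cong]\<close>)
  then show "bilin \<beta> (gen u) (gen v) w = \<beta> u v w"
    using \<beta> by (simp add: word_gen_def)
qed

lemma bilinear_extension_in_words_mod:
  assumes f: "f \<in> words_mod P" and g: "g \<in> words_mod Q" and \<beta>: "\<And>u v w. \<beta> u v w \<in> carrier C"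
    and gens: "\<And>u v. \<lbrakk>set u \<subseteq> carrier A; P u; set v \<subseteq> carrier A; Q v\<rbrakk> \<Longrightarrow> \<beta> u v \<in> words_mod S"
  shows "bilin \<beta> f g \<in> words_mod S"
  using f
proof (induction rule: words_mod_induct)
  case (gen u)
  show ?case using g
  proof (induction rule: words_mod_induct)
    case (gen v)
    then show ?case using gens \<open>set u \<subseteq> carrier A\<close> \<open>P u\<close> by (simp add: bilinear_extension_gen \<beta>)
  qed (use gen in \<open>simp_all add: bilinear_extension_add_right bilinear_extension_scale_right \<beta> words_mod_all gen_in_words_mod\<close>)
qed (use words_mod_all[OF g] in \<open>simp_all add: bilinear_extension_add_left bilinear_extension_scale_left \<beta> words_mod_all\<close>)

section \<open>Multilinearity relations\<close>

abbreviation Free :: "nat \<Rightarrow> ('c, 'a list \<Rightarrow> 'c) module" where "Free k \<equiv> free_tensors C A k"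
abbreviation Rel :: "nat \<Rightarrow> ('a list \<Rightarrow> 'c) set" where "Rel k \<equiv> tensor_relations C A k"
abbreviation length_words :: "nat \<Rightarrow> ('a list \<Rightarrow> 'c) set"
  where "length_words k \<equiv> words_mod (\<lambda>w. length w = k)"

lemma carrier_free: "carrier (Free k) = length_words k"
  by (auto simp: free_tensors_def words_mod_def)

lemma free_ops: "\<zero>\<^bsub>Free k\<^esub> = fzero" "f \<oplus>\<^bsub>Free k\<^esub> g = f \<boxplus> g" "c \<odot>\<^bsub>Free k\<^esub> f = c \<bullet> f"
  by (simp_all add: free_tensors_def fadd_def fscale_def fzero_def)

lemma free_module: "module C (Free k)"
proof (rule moduleI)
  show "abelian_group (Free k)"
  proof (rule abelian_groupI, goal_cases)
    case (3 x y z)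
    then show ?case
      using words_mod_closed by (auto simp: free_ops carrier_free fapply R.a_assoc intro!: ext)
  next
    case (4 x y)
    then show ?case
      using words_mod_closed by (auto simp: free_ops carrier_free fapply R.a_comm intro!: ext)
  next
    case (5 x)
    then show ?case
      using words_mod_closed by (auto simp: free_ops carrier_free fapply intro!: ext)
  next
    case (6 x)
    then have "(\<ominus> \<one>) \<bullet> x \<boxplus> x = fzero"
      using words_mod_closed by (auto simp: carrier_free fapply R.l_minus R.l_neg intro!: ext)
    then show ?case using 6 by (auto simp: free_ops carrier_free intro!: bexI[of _ "(\<ominus> \<one>) \<bullet> x"])
  qed (auto simp: free_ops carrier_free)
qed (auto simp: free_ops carrier_free fapply R.l_distr R.r_distr R.m_assoc R.is_cring words_mod_closed intro!: ext)

lemma free_a_inv: "f \<in> length_words k \<Longrightarrow> \<ominus>\<^bsub>Free k\<^esub> f = (\<ominus> \<one>) \<bullet> f"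
proof -
  assume f: "f \<in> length_words k"
  interpret F: module C "Free k" by (rule free_module)
  have "(\<ominus> \<one>) \<bullet> f \<boxplus> f = fzero"
    using words_mod_closed[OF f] by (auto simp: fapply R.l_minus R.l_neg intro!: ext)
  then show ?thesis
    using f F.minus_equality[of "(\<ominus> \<one>) \<bullet> f" f] by (simp add: free_ops carrier_free)
qed

text \<open>
  Both kinds of relators are of this form, and the vanishing of the combination in the middle
  letter is preserved by multiplication in \<open>A\<close>.
\<close>

definition comb :: "'c \<Rightarrow> 'c \<Rightarrow> 'c \<Rightarrow> ('a list \<Rightarrow> 'c) \<Rightarrow> ('a list \<Rightarrow> 'c) \<Rightarrow> ('a list \<Rightarrow> 'c) \<Rightarrow> 'a list \<Rightarrow> 'c"
  where "comb c1 c2 c3 f1 f2 f3 = c1 \<bullet> f1 \<boxplus> c2 \<bullet> f2 \<boxplus> c3 \<bullet> f3"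

definition null_comb :: "'c \<Rightarrow> 'c \<Rightarrow> 'c \<Rightarrow> 'a \<Rightarrow> 'a \<Rightarrow> 'a \<Rightarrow> bool" where
  "null_comb c1 c2 c3 a1 a2 a3 \<longleftrightarrow> {c1, c2, c3} \<subseteq> carrier C \<and> {a1, a2, a3} \<subseteq> carrier A \<and>
     c1 \<odot>\<^bsub>A\<^esub> a1 \<oplus>\<^bsub>A\<^esub> c2 \<odot>\<^bsub>A\<^esub> a2 \<oplus>\<^bsub>A\<^esub> c3 \<odot>\<^bsub>A\<^esub> a3 = \<zero>\<^bsub>A\<^esub>"

lemma null_comb_carrier:
  assumes "null_comb c1 c2 c3 a1 a2 a3"
  shows "c1 \<in> carrier C" "c2 \<in> carrier C" "c3 \<in> carrier C" "a1 \<in> carrier A" "a2 \<in> carrier A" "a3 \<in> carrier A"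
  using assms by (auto simp: null_comb_def)

lemma null_comb_mult:
  assumes "null_comb c1 c2 c3 a1 a2 a3" "y \<in> carrier A"
  shows "null_comb c1 c2 c3 (a1 \<otimes>\<^bsub>A\<^esub> y) (a2 \<otimes>\<^bsub>A\<^esub> y) (a3 \<otimes>\<^bsub>A\<^esub> y)"
proof -
  note [simp] = null_comb_carrier[OF assms(1)] assms(2)
  have "c1 \<odot>\<^bsub>A\<^esub> (a1 \<otimes>\<^bsub>A\<^esub> y) \<oplus>\<^bsub>A\<^esub> c2 \<odot>\<^bsub>A\<^esub> (a2 \<otimes>\<^bsub>A\<^esub> y) \<oplus>\<^bsub>A\<^esub> c3 \<odot>\<^bsub>A\<^esub> (a3 \<otimes>\<^bsub>A\<^esub> y)
     = (c1 \<odot>\<^bsub>A\<^esub> a1 \<oplus>\<^bsub>A\<^esub> c2 \<odot>\<^bsub>A\<^esub> a2 \<oplus>\<^bsub>A\<^esub> c3 \<odot>\<^bsub>A\<^esub> a3) \<otimes>\<^bsub>A\<^esub> y"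
    by (simp add: smult_assoc2 l_distr)
  then show ?thesis using assms by (simp add: null_comb_def)
qed

lemma comb_fadd:
  assumes "f1 \<in> all_words" "f2 \<in> all_words" "f3 \<in> all_words" "g1 \<in> all_words" "g2 \<in> all_words" "g3 \<in> all_words"
    and "c1 \<in> carrier C" "c2 \<in> carrier C" "c3 \<in> carrier C"
  shows "comb c1 c2 c3 (f1 \<boxplus> g1) (f2 \<boxplus> g2) (f3 \<boxplus> g3) = comb c1 c2 c3 f1 f2 f3 \<boxplus> comb c1 c2 c3 g1 g2 g3"
  using assms(7-9) assms(1-6)[THEN words_mod_closed]
  by (auto simp: comb_def fapply R.r_distr R.a_ac intro!: ext)

lemma comb_fscale:
  assumes "f1 \<in> all_words" "f2 \<in> all_words" "f3 \<in> all_words"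
    and "c1 \<in> carrier C" "c2 \<in> carrier C" "c3 \<in> carrier C" "d \<in> carrier C"
  shows "comb c1 c2 c3 (d \<bullet> f1) (d \<bullet> f2) (d \<bullet> f3) = d \<bullet> comb c1 c2 c3 f1 f2 f3"
  using assms(4-7) assms(1-3)[THEN words_mod_closed]
  by (auto simp: comb_def fapply R.r_distr R.m_ac intro!: ext)

lemma comb_in_words_mod:
  assumes "f1 \<in> words_mod P" "f2 \<in> words_mod P" "f3 \<in> words_mod P"
    and "c1 \<in> carrier C" "c2 \<in> carrier C" "c3 \<in> carrier C"
  shows "comb c1 c2 c3 f1 f2 f3 \<in> words_mod P"
  using assms by (auto simp: comb_def)

definition letter_gen :: "'a list \<Rightarrow> 'a list \<Rightarrow> 'a \<Rightarrow> 'a list \<Rightarrow> 'c"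
  where "letter_gen us vs a = gen (us @ [a] @ vs)"

lemma letter_gen_in [intro]:
  assumes "set us \<subseteq> carrier A" "set vs \<subseteq> carrier A" "a \<in> carrier A" "P (us @ [a] @ vs)"
  shows "letter_gen us vs a \<in> words_mod P"
  using assms unfolding letter_gen_def by (intro gen_in_words_mod) auto

lemma multilinear_relators_cases:
  assumes "r \<in> multilinear_relators C A k"
  obtains us vs a b where "r = letter_gen us vs (a \<oplus>\<^bsub>A\<^esub> b) \<ominus>\<^bsub>Free k\<^esub> (letter_gen us vs a \<oplus>\<^bsub>Free k\<^esub> letter_gen us vs b)"
      "length us + 1 + length vs = k" "set us \<union> set vs \<union> {a, b} \<subseteq> carrier A"
    | us vs a c where "r = letter_gen us vs (c \<odot>\<^bsub>A\<^esub> a) \<ominus>\<^bsub>Free k\<^esub> (c \<odot>\<^bsub>Free k\<^esub> letter_gen us vs a)"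
      "length us + 1 + length vs = k" "set us \<union> set vs \<union> {a} \<subseteq> carrier A" "c \<in> carrier C"
  using assms unfolding multilinear_relators_def letter_gen_def
  apply (elim UnE CollectE exE conjE)
   apply (rule that(1)[unfolded letter_gen_def]; assumption)
  apply (rule that(2)[unfolded letter_gen_def]; assumption)
  done

lemma submodule_relations: "submodule (Rel k) C (Free k)"
  and relators_in_relations: "multilinear_relators C A k \<subseteq> Rel k"
proof -
  interpret F: module C "Free k" by (rule free_module)
  let ?X = "{H. submodule H C (Free k) \<and> multilinear_relators C A k \<subseteq> H}"
  have rel: "multilinear_relators C A k \<subseteq> carrier (Free k)"
  proof
    fix r assume "r \<in> multilinear_relators C A k"
    then show "r \<in> carrier (Free k)"
    proof (cases rule: multilinear_relators_cases)
      case (1 us vs a b)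
      have "letter_gen us vs x \<in> carrier (Free k)" if "x \<in> carrier A" for x
        using 1 that by (auto simp: carrier_free)
      then show ?thesis using 1 by (auto intro!: F.minus_closed F.M.add.m_closed)
    next
      case (2 us vs a c)
      have "letter_gen us vs x \<in> carrier (Free k)" if "x \<in> carrier A" for x
        using 2 that by (auto simp: carrier_free)
      then show ?thesis using 2 by (auto intro!: F.minus_closed F.M.add.m_closed)
    qed
  qed
  have carr: "carrier (Free k) \<in> ?X" using rel F.carrier_is_submodule by blast
  show "submodule (Rel k) C (Free k)"
    unfolding tensor_relations_def
  proof (rule F.submoduleI)
    show "\<Inter> ?X \<subseteq> carrier (Free k)" using carr by blast
    show "\<zero>\<^bsub>Free k\<^esub> \<in> \<Inter> ?X"
      by (rule InterI) (auto dest!: submodule.axioms(1) dest: subgroup.one_closed)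
    show "\<ominus>\<^bsub>Free k\<^esub> a \<in> \<Inter> ?X" if "a \<in> \<Inter> ?X" for a
      using that F.submoduleE(3) by (intro InterI) blast
    show "a \<oplus>\<^bsub>Free k\<^esub> b \<in> \<Inter> ?X" if "a \<in> \<Inter> ?X" "b \<in> \<Inter> ?X" for a b
      using that F.submoduleE(5) by (intro InterI) blast
    show "c \<odot>\<^bsub>Free k\<^esub> a \<in> \<Inter> ?X" if "c \<in> carrier C" "a \<in> \<Inter> ?X" for c a
      using that F.submoduleE(4) by (intro InterI) blast
  qed
  show "multilinear_relators C A k \<subseteq> Rel k" unfolding tensor_relations_def by blast
qed

lemma fzero_in_relations [simp, intro]: "fzero \<in> Rel k"
  using submodule.axioms(1)[OF submodule_relations, THEN subgroup.one_closed] by (simp add: free_ops)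

lemma fadd_in_relations [simp, intro]: "f \<in> Rel k \<Longrightarrow> g \<in> Rel k \<Longrightarrow> f \<boxplus> g \<in> Rel k"
  using module.submoduleE(5)[OF free_module submodule_relations] by (simp add: free_ops)

lemma fscale_in_relations [simp, intro]: "f \<in> Rel k \<Longrightarrow> c \<in> carrier C \<Longrightarrow> c \<bullet> f \<in> Rel k"
  using module.submoduleE(4)[OF free_module submodule_relations] by (simp add: free_ops)

text \<open>The elements satisfying \<open>Q\<close> form a submodule containing all relators
  (negation is scaling by -1), and \<open>Rel k\<close> is the smallest such submodule. Both kinds
  of relators are presented as one three-term combination, so later inductions have a single base
  case.\<close>

lemma relations_induct [consumes 1, case_names comb zero add scale]:
  assumes f: "f \<in> Rel k"
    and comb: "\<And>us vs c1 c2 c3 a1 a2 a3. \<lbrakk>length us + 1 + length vs = k; set us \<subseteq> carrier A; set vs \<subseteq> carrier A;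
        null_comb c1 c2 c3 a1 a2 a3\<rbrakk> \<Longrightarrow>
        Q (comb c1 c2 c3 (letter_gen us vs a1) (letter_gen us vs a2) (letter_gen us vs a3))"
    and zero: "Q fzero"
    and add: "\<And>f g. f \<in> length_words k \<Longrightarrow> g \<in> length_words k \<Longrightarrow> Q f \<Longrightarrow> Q g \<Longrightarrow> Q (f \<boxplus> g)"
    and scale: "\<And>c f. c \<in> carrier C \<Longrightarrow> f \<in> length_words k \<Longrightarrow> Q f \<Longrightarrow> Q (c \<bullet> f)"
  shows "Q f"
proof -
  interpret F: module C "Free k" by (rule free_module)
  let ?H = "{f \<in> length_words k. Q f}"
  have "submodule ?H C (Free k)"
    by (rule F.submoduleI) (auto simp: carrier_free free_ops free_a_inv zero add scale)
  moreover have "multilinear_relators C A k \<subseteq> ?H"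
  proof
    fix r assume "r \<in> multilinear_relators C A k"
    then show "r \<in> ?H"
    proof (cases rule: multilinear_relators_cases)
      case (1 us vs a b)
      have gen: "letter_gen us vs x \<in> length_words k" if "x \<in> carrier A" for x
        using 1 that by auto
      have r: "r = comb \<one> (\<ominus> \<one>) (\<ominus> \<one>) (letter_gen us vs (a \<oplus>\<^bsub>A\<^esub> b)) (letter_gen us vs a) (letter_gen us vs b)"
        using 1 gen[THEN words_mod_closed]
        by (auto simp: 1 a_minus_def free_a_inv gen free_ops comb_def fapply R.r_distr R.a_assoc intro!: ext)
      have "null_comb \<one> (\<ominus> \<one>) (\<ominus> \<one>) (a \<oplus>\<^bsub>A\<^esub> b) a b"
        using 1 M.r_neg[of "a \<oplus>\<^bsub>A\<^esub> b"] by (auto simp: null_comb_def smult_l_minus M.minus_add M.a_assoc)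
      then show ?thesis unfolding r using 1 gen comb
        by (auto intro!: comb_in_words_mod)
    next
      case (2 us vs a c)
      have gen: "letter_gen us vs x \<in> length_words k" if "x \<in> carrier A" for x
        using 2 that by auto
      \<comment> \<open>A scalar relator has two terms; the third place is filled with coefficient
        0, and its letter \<open>a\<close> is arbitrary.\<close>
      have r: "r = comb \<one> (\<ominus> c) \<zero> (letter_gen us vs (c \<odot>\<^bsub>A\<^esub> a)) (letter_gen us vs a) (letter_gen us vs a)"
        using 2 gen[THEN words_mod_closed]
        by (auto simp: 2 a_minus_def free_a_inv gen free_ops comb_def fapply R.l_minus intro!: ext)
      have "null_comb \<one> (\<ominus> c) \<zero> (c \<odot>\<^bsub>A\<^esub> a) a a"
        using 2 by (auto simp: null_comb_def smult_l_minus M.r_neg)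
      then show ?thesis unfolding r using 2 gen comb
        by (auto intro!: comb_in_words_mod)
    qed
  qed
  ultimately have "Rel k \<subseteq> ?H" unfolding tensor_relations_def by blast
  then show ?thesis using f by blast
qed

lemma gen_add_relation:
  assumes "set us \<subseteq> carrier A" "set vs \<subseteq> carrier A" "a \<in> carrier A" "b \<in> carrier A"
    and k: "length us + 1 + length vs = k"
  shows "comb \<one> (\<ominus> \<one>) (\<ominus> \<one>) (letter_gen us vs (a \<oplus>\<^bsub>A\<^esub> b)) (letter_gen us vs a) (letter_gen us vs b)
           \<in> Rel k" (is "?r \<in> _")
proof -
  have gen: "letter_gen us vs x \<in> length_words k" if "x \<in> carrier A" for x
    using assms(1,2) k that by auto
  have "?r = letter_gen us vs (a \<oplus>\<^bsub>A\<^esub> b) \<ominus>\<^bsub>Free k\<^esub> (letter_gen us vs a \<oplus>\<^bsub>Free k\<^esub> letter_gen us vs b)"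
    using assms(1-4) gen[THEN words_mod_closed]
    by (auto simp: a_minus_def free_a_inv gen free_ops comb_def fapply R.r_distr R.a_assoc intro!: ext)
  also have "\<dots> \<in> multilinear_relators C A k"
    using assms unfolding multilinear_relators_def letter_gen_def by blast
  finally show ?thesis using relators_in_relations by blast
qed

lemma gen_scale_relation:
  assumes "set us \<subseteq> carrier A" "set vs \<subseteq> carrier A" "a \<in> carrier A" "c \<in> carrier C"
    and k: "length us + 1 + length vs = k"
  shows "letter_gen us vs (c \<odot>\<^bsub>A\<^esub> a) \<boxplus> (\<ominus> c) \<bullet> letter_gen us vs a \<in> Rel k"
    (is "?r \<in> _")
proof -
  have gen: "letter_gen us vs x \<in> length_words k" if "x \<in> carrier A" for x
    using assms(1,2) k that by auto
  have "?r = letter_gen us vs (c \<odot>\<^bsub>A\<^esub> a) \<ominus>\<^bsub>Free k\<^esub> (c \<odot>\<^bsub>Free k\<^esub> letter_gen us vs a)"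
    using assms(1-4) gen[THEN words_mod_closed]
    by (auto simp: a_minus_def free_a_inv gen free_ops fapply R.l_minus intro!: ext)
  also have "\<dots> \<in> multilinear_relators C A k"
    using assms unfolding multilinear_relators_def letter_gen_def by blast
  finally show ?thesis using relators_in_relations by blast
qed

text \<open>The converse reading: homogeneity and additivity move the combination inside the letter,
  where it becomes 0, and a word with a letter 0 is itself a relation.\<close>

lemma null_comb_in_relations:
  assumes "set us \<subseteq> carrier A" "set vs \<subseteq> carrier A" and nc: "null_comb c1 c2 c3 a1 a2 a3"
    and k: "length us + 1 + length vs = k"
  shows "comb c1 c2 c3 (letter_gen us vs a1) (letter_gen us vs a2) (letter_gen us vs a3)
           \<in> Rel k"
proof -
  let ?g = "letter_gen us vs"
  note nc' [simp] = null_comb_carrier[OF nc]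
  have gen: "?g x \<in> length_words k" if "x \<in> carrier A" for x
    using assms(1,2) k that by auto
  note cl [simp] = gen[THEN words_mod_closed]
  note sc = gen_scale_relation[OF assms(1,2) _ _ k] and ad = gen_add_relation[OF assms(1,2) _ _ k]
  let ?b1 = "c1 \<odot>\<^bsub>A\<^esub> a1" and ?b2 = "c2 \<odot>\<^bsub>A\<^esub> a2" and ?b3 = "c3 \<odot>\<^bsub>A\<^esub> a3"
  let ?s = "\<lambda>c a. ?g (c \<odot>\<^bsub>A\<^esub> a) \<boxplus> (\<ominus> c) \<bullet> ?g a"
  let ?t = "\<lambda>a b. comb \<one> (\<ominus> \<one>) (\<ominus> \<one>) (?g (a \<oplus>\<^bsub>A\<^esub> b)) (?g a) (?g b)"
  \<comment> \<open>Homogeneity for the scalar 0 and the letter 0, where the scaled term drops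
    out.\<close>
  have z: "?g \<zero>\<^bsub>A\<^esub> \<in> Rel k"
    using sc[of "\<zero>\<^bsub>A\<^esub>" \<zero>] by (simp add: fadd_def fscale_def)
  then have z': "?g (?b1 \<oplus>\<^bsub>A\<^esub> ?b2 \<oplus>\<^bsub>A\<^esub> ?b3) \<in> Rel k" using nc by (simp add: null_comb_def)
  \<comment> \<open>The three scaled letters are introduced by homogeneity and joined by additivity
    in two steps; all intermediate generators cancel.\<close>
  have eq: "comb c1 c2 c3 (?g a1) (?g a2) (?g a3) =
      ?g (?b1 \<oplus>\<^bsub>A\<^esub> ?b2 \<oplus>\<^bsub>A\<^esub> ?b3) \<boxplus> (\<ominus> \<one>) \<bullet> (?t (?b1 \<oplus>\<^bsub>A\<^esub> ?b2) ?b3 \<boxplus> ?t ?b1 ?b2 \<boxplus> ?s c1 a1 \<boxplus> ?s c2 a2 \<boxplus> ?s c3 a3)"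
  proof (rule ext)
    fix w
    define p q r s t u v w' where "p = ?g (?b1 \<oplus>\<^bsub>A\<^esub> ?b2 \<oplus>\<^bsub>A\<^esub> ?b3) w" "q = ?g (?b1 \<oplus>\<^bsub>A\<^esub> ?b2) w"
      "r = ?g ?b1 w" "s = ?g ?b2 w" "t = ?g ?b3 w" "u = c1 \<otimes> ?g a1 w" "v = c2 \<otimes> ?g a2 w" "w' = c3 \<otimes> ?g a3 w"
    note pq = this
    have c: "p \<in> carrier C" "q \<in> carrier C" "r \<in> carrier C" "s \<in> carrier C" "t \<in> carrier C"
       "u \<in> carrier C" "v \<in> carrier C" "w' \<in> carrier C"
      by (simp_all add: pq)
    have "u \<oplus> v \<oplus> w' = p \<oplus> \<ominus> (p \<oplus> \<ominus> q \<oplus> \<ominus> t \<oplus> (q \<oplus> \<ominus> r \<oplus> \<ominus> s) \<oplus> (r \<oplus> \<ominus> u) \<oplus> (s \<oplus> \<ominus> v) \<oplus> (t \<oplus> \<ominus> w'))"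
      using c by algebra
    then show "comb c1 c2 c3 (?g a1) (?g a2) (?g a3) w =
      (?g (?b1 \<oplus>\<^bsub>A\<^esub> ?b2 \<oplus>\<^bsub>A\<^esub> ?b3) \<boxplus> (\<ominus> \<one>) \<bullet> (?t (?b1 \<oplus>\<^bsub>A\<^esub> ?b2) ?b3 \<boxplus> ?t ?b1 ?b2 \<boxplus> ?s c1 a1 \<boxplus> ?s c2 a2 \<boxplus> ?s c3 a3)) w"
      using c by (simp add: comb_def fapply R.l_minus pq)
  qed
  show ?thesis
    unfolding eq
    by (rule fadd_in_relations[OF z' fscale_in_relations[OF fadd_in_relations[OF fadd_in_relations[OF
            fadd_in_relations[OF fadd_in_relations[OF ad ad] sc] sc] sc]]])
      (simp_all only: nc' M.a_closed smult_closed R.a_inv_closed R.one_closed)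
qed

subsection \<open>Homogeneous components\<close>

definition homog :: "nat \<Rightarrow> ('a list \<Rightarrow> 'c) \<Rightarrow> 'a list \<Rightarrow> 'c"
  where "homog n f = (\<lambda>w. if length w = n then f w else \<zero>)"

lemma homog_in_words_mod:
  assumes "f \<in> words_mod P" "\<And>w. P w \<Longrightarrow> length w = n \<Longrightarrow> Q w"
  shows "homog n f \<in> words_mod Q"
proof (rule words_modI)
  show "finite (word_supp C (homog n f))"
    by (rule finite_subset[OF _ words_mod_finite[OF assms(1)]]) (auto simp: word_supp_def homog_def)
  show "set w \<subseteq> carrier A" "Q w" if "homog n f w \<noteq> \<zero>" for w
    using that assms words_mod_set[OF assms(1)] words_mod_pred[OF assms(1)]
    by (auto simp: homog_def split: if_splits)
qed (use words_mod_closed[OF assms(1)] in \<open>auto simp: homog_def\<close>)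

lemma homog_in_length_words [simp, intro]: "f \<in> words_mod P \<Longrightarrow> homog n f \<in> length_words n"
  by (erule homog_in_words_mod)

lemma homog_fadd: "homog n (f \<boxplus> g) = homog n f \<boxplus> homog n g" if "f \<in> words_mod P" "g \<in> words_mod Q"
  using that[THEN words_mod_closed] by (auto simp: homog_def fapply intro!: ext)

lemmas homog_fadd_nonempty = homog_fadd[where P = "\<lambda>w. w \<noteq> []" and Q = "\<lambda>w. w \<noteq> []"]

lemma homog_fscale: "c \<in> carrier C \<Longrightarrow> homog n (c \<bullet> f) = c \<bullet> homog n f"
  by (auto simp: homog_def fapply intro!: ext)

lemma homog_fzero [simp]: "homog n fzero = fzero"
  by (auto simp: homog_def fapply intro!: ext)

lemma homog_eq_fzero:
  assumes "f \<in> words_mod P" "\<And>w. P w \<Longrightarrow> length w \<noteq> n"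
  shows "homog n f = fzero"
proof (rule ext)
  show "homog n f w = fzero w" for w
    using assms(2)[of w] words_mod_pred[OF assms(1), of w] by (cases "f w = \<zero>") (auto simp: homog_def fapply)
qed

lemma homog_length_words: "f \<in> length_words k \<Longrightarrow> homog n f = (if n = k then f else fzero)"
proof (rule ext)
  show "homog n f w = (if n = k then f else fzero) w" if "f \<in> length_words k" for w
    using words_mod_pred[OF that, of w] by (cases "f w = \<zero>") (auto simp: homog_def fapply)
qed

text \<open>Each relation lives in one degree, but a product of two words spreads over several, so
  the condition is imposed on every homogeneous component.\<close>

definition graded_relations :: "('a list \<Rightarrow> 'c) set" where
  "graded_relations = {f \<in> all_words. \<forall>n. homog n f \<in> Rel n}"

lemma graded_relationsI:
  "f \<in> words_mod P \<Longrightarrow> (\<And>n. homog n f \<in> Rel n) \<Longrightarrow> f \<in> graded_relations"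
  by (auto simp: graded_relations_def words_mod_all)

lemma graded_relationsD: "f \<in> graded_relations \<Longrightarrow> f \<in> all_words" "f \<in> graded_relations \<Longrightarrow> homog n f \<in> Rel n"
  by (auto simp: graded_relations_def)

lemma graded_relations_fzero [simp, intro]: "fzero \<in> graded_relations"
  by (rule graded_relationsI) auto

lemma graded_relations_fadd [simp, intro]:
  "f \<in> graded_relations \<Longrightarrow> g \<in> graded_relations \<Longrightarrow> f \<boxplus> g \<in> graded_relations"
  by (auto simp: graded_relations_def homog_fadd)

lemma graded_relations_fscale [simp, intro]:
  "f \<in> graded_relations \<Longrightarrow> c \<in> carrier C \<Longrightarrow> c \<bullet> f \<in> graded_relations"
  by (auto simp: graded_relations_def homog_fscale)

lemma relations_in_length_words: "f \<in> Rel k \<Longrightarrow> f \<in> length_words k"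
  using module.submoduleE(1)[OF free_module submodule_relations] by (auto simp: carrier_free)

lemma relations_graded: "f \<in> Rel k \<Longrightarrow> f \<in> graded_relations"
  using relations_in_length_words[of f k]
  by (auto intro!: graded_relationsI simp: homog_length_words)

section \<open>Prefixing a letter and the multilinearity relations\<close>

lemma prefixed_fadd: "prefixed C z (f \<boxplus> g) = prefixed C z f \<boxplus> prefixed C z g"
  by (rule ext) (auto simp: fapply prefixed_def split: list.split)

lemma prefixed_fscale: "c \<in> carrier C \<Longrightarrow> prefixed C z (c \<bullet> f) = c \<bullet> prefixed C z f"
  by (rule ext) (auto simp: fapply prefixed_def split: list.split)

lemma prefixed_fzero [simp]: "prefixed C z fzero = fzero"
  by (rule ext) (auto simp: fapply prefixed_def split: list.split)

lemma prefixed_gen: "prefixed C z (gen w) = gen (z # w)"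
  by (rule ext) (auto simp: word_gen_def prefixed_def split: list.split)

lemma prefixed_comb:
  assumes "c1 \<in> carrier C" "c2 \<in> carrier C" "c3 \<in> carrier C"
  shows "prefixed C z (comb c1 c2 c3 f1 f2 f3) = comb c1 c2 c3 (prefixed C z f1) (prefixed C z f2) (prefixed C z f3)"
  using assms by (simp add: comb_def prefixed_fadd prefixed_fscale)

lemma prefixed_in_words_mod:
  assumes "f \<in> words_mod P" "z \<in> carrier A" "\<And>w. P w \<Longrightarrow> Q (z # w)"
  shows "prefixed C z f \<in> words_mod Q"
  using assms(1)
proof (induction rule: words_mod_induct)
  case (gen w)
  then show ?case using assms unfolding prefixed_gen by (intro gen_in_words_mod) auto
next
  case (add f g)
  then show ?case by (simp only: prefixed_fadd) (rule fadd_in_words_mod)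
next
  case (scale c f)
  then show ?case by (simp only: prefixed_fscale) (rule fscale_in_words_mod)
qed (simp only: prefixed_fzero fzero_in_words_mod)

lemma prefixed_all_words: "f \<in> all_words \<Longrightarrow> z \<in> carrier A \<Longrightarrow> prefixed C z f \<in> all_words"
  by (erule prefixed_in_words_mod) auto

lemma homog_prefixed: "homog 0 (prefixed C z f) = fzero" "homog (Suc n) (prefixed C z f) = prefixed C z (homog n f)"
  by (rule ext, auto simp: homog_def fapply prefixed_def split: list.split)+

text \<open>A further letter in front only lengthens the left context of a relator.\<close>

lemma prefixed_relations:
  assumes "f \<in> Rel k" "z \<in> carrier A"
  shows "prefixed C z f \<in> Rel (Suc k)"
  using assms(1)
proof (induction rule: relations_induct)
  case (comb us vs c1 c2 c3 a1 a2 a3)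
  have "prefixed C z (letter_gen us vs a) = letter_gen (z # us) vs a" for a
    by (simp add: letter_gen_def prefixed_gen)
  then show ?case
    using comb assms(2) null_comb_carrier[OF comb(4)] null_comb_in_relations[of "z # us" vs c1 c2 c3 a1 a2 a3 "Suc k"]
    by (simp add: prefixed_comb)
next
  case (add f g)
  then show ?case by (simp only: prefixed_fadd) (rule fadd_in_relations)
next
  case (scale c f)
  then show ?case by (simp only: prefixed_fscale) (rule fscale_in_relations)
qed (simp only: prefixed_fzero fzero_in_relations)

lemma prefixed_graded_relations:
  assumes "f \<in> graded_relations" "z \<in> carrier A"
  shows "prefixed C z f \<in> graded_relations"
proof (rule graded_relationsI)
  show "prefixed C z f \<in> all_words"
    using assms graded_relationsD(1) by (auto intro: prefixed_in_words_mod)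
  show "homog n (prefixed C z f) \<in> Rel n" for n
    using assms graded_relationsD(2) by (cases n) (auto simp: homog_prefixed intro: prefixed_relations)
qed

text \<open>Here the relation sits at the prefixed letter itself, with empty left context; linearity
  in \<open>f\<close> reduces to a single word behind it.\<close>

lemma comb_prefixed_graded_relations:
  assumes "f \<in> all_words" and nc: "null_comb c1 c2 c3 a1 a2 a3"
  shows "comb c1 c2 c3 (prefixed C a1 f) (prefixed C a2 f) (prefixed C a3 f) \<in> graded_relations"
  using assms(1)
proof (induction rule: words_mod_induct)
  note [simp] = null_comb_carrier[OF nc]
  case zero
  have "comb c1 c2 c3 fzero fzero fzero = fzero" by (rule ext) (simp add: comb_def fapply)
  then show ?case by (simp only: prefixed_fzero graded_relations_fzero)
next
  case (gen w)
  have "prefixed C a (gen w) = letter_gen [] w a" for a by (simp add: letter_gen_def prefixed_gen)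
  then show ?case using null_comb_in_relations[OF _ _ nc, of "[]" w] gen
    by (auto intro: relations_graded)
next
  case (add f g)
  have "prefixed C a h \<in> all_words" if "a \<in> carrier A" "h \<in> all_words" for a h
    using that by (auto intro: prefixed_in_words_mod)
  then show ?case using add null_comb_carrier[OF nc]
    by (simp only: prefixed_fadd comb_fadd graded_relations_fadd)
next
  case (scale c f)
  have "prefixed C a h \<in> all_words" if "a \<in> carrier A" "h \<in> all_words" for a h
    using that by (auto intro: prefixed_in_words_mod)
  then show ?case using scale null_comb_carrier[OF nc]
    by (simp only: prefixed_fscale comb_fscale graded_relations_fscale)
qed

end

section \<open>The shuffle product on words\<close>

locale shuffle_module = word_module C A
  for C :: "('c, 'm) ring_scheme" (structure) and A :: "('c, 'a, 'n) module_scheme" (structure) +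
  fixes lam :: 'c
  assumes lam_closed [simp]: "lam \<in> carrier C"
begin

section \<open>Degrees, symmetry and multilinearity of the quasi-shuffle product\<close>

abbreviation qsh :: "'a list \<Rightarrow> 'a list \<Rightarrow> 'a list \<Rightarrow> 'c"
  where "qsh \<equiv> quasi_shuffle C A lam"

lemma qsh_Cons_Cons: "qsh (x # xs) (y # ys) =
    prefixed C x (qsh xs (y # ys)) \<boxplus> prefixed C y (qsh (x # xs) ys) \<boxplus> lam \<bullet> prefixed C (x \<otimes>\<^bsub>A\<^esub> y) (qsh xs ys)"
  by (rule ext) (simp add: fapply)

declare quasi_shuffle.simps(3) [simp del]

text \<open>Each step of the recursion writes one letter and uses up one letter of one word or of
  both. The lower bounds later isolate lowest components; the upper bound is the length of a shuffle
  without merging.\<close>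

lemma qsh_in_words_mod:
  assumes "set xs \<subseteq> carrier A" "set ys \<subseteq> carrier A"
  shows "qsh xs ys \<in> words_mod (\<lambda>w. length xs \<le> length w \<and> length ys \<le> length w \<and> length w \<le> length xs + length ys)"
  using assms
proof (induction xs ys rule: list_pair_induct)
  case (Cons_Cons x xs y ys)
  let ?P = "\<lambda>w. length (x # xs) \<le> length w \<and> length (y # ys) \<le> length w \<and> length w \<le> length (x # xs) + length (y # ys)"
  have "prefixed C x (qsh xs (y # ys)) \<in> words_mod ?P" "prefixed C y (qsh (x # xs) ys) \<in> words_mod ?P"
       "prefixed C (x \<otimes>\<^bsub>A\<^esub> y) (qsh xs ys) \<in> words_mod ?P"
    by (rule prefixed_in_words_mod, use Cons_Cons in \<open>force\<close>, use Cons_Cons in auto)+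
  then show ?case unfolding qsh_Cons_Cons by auto
qed (auto intro!: gen_in_words_mod)

lemma qsh_all_words: "set xs \<subseteq> carrier A \<Longrightarrow> set ys \<subseteq> carrier A \<Longrightarrow> qsh xs ys \<in> all_words"
  using qsh_in_words_mod words_mod_all by blast

text \<open>Admissible pairs are asymmetric, a left letter followed by a right one, so symmetry is
  not apparent in the defining sum. In the recursion, exchanging the words only swaps the first two
  terms.\<close>

lemma qsh_comm:
  assumes "set xs \<subseteq> carrier A" "set ys \<subseteq> carrier A"
  shows "qsh xs ys = qsh ys xs"
  using assms
proof (induction xs ys rule: list_pair_induct)
  case (Cons_Cons x xs y ys)
  have eq: "qsh xs (y # ys) = qsh (y # ys) xs" "qsh (x # xs) ys = qsh ys (x # xs)" "qsh xs ys = qsh ys xs"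
    "x \<otimes>\<^bsub>A\<^esub> y = y \<otimes>\<^bsub>A\<^esub> x"
    using Cons_Cons by (auto simp: m_comm)
  have comm: "f \<boxplus> g \<boxplus> h = g \<boxplus> f \<boxplus> h" if "f \<in> all_words" "g \<in> all_words" "h \<in> all_words" for f g h
    using that[THEN words_mod_closed] by (auto simp: fapply R.a_ac intro!: ext)
  show ?case unfolding qsh_Cons_Cons eq
    by (rule comm) (use Cons_Cons(4,5) in \<open>auto intro!: prefixed_all_words qsh_all_words\<close>)
qed auto

lemma comb_three_graded_relations:
  assumes "f1 \<in> all_words" "f2 \<in> all_words" "f3 \<in> all_words" "g1 \<in> all_words" "g2 \<in> all_words" "g3 \<in> all_words"
      "h1 \<in> all_words" "h2 \<in> all_words" "h3 \<in> all_words"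
    and "comb c1 c2 c3 f1 f2 f3 \<in> graded_relations" "comb c1 c2 c3 g1 g2 g3 \<in> graded_relations"
      "comb c1 c2 c3 h1 h2 h3 \<in> graded_relations"
    and "c1 \<in> carrier C" "c2 \<in> carrier C" "c3 \<in> carrier C"
  shows "comb c1 c2 c3 (f1 \<boxplus> g1 \<boxplus> lam \<bullet> h1) (f2 \<boxplus> g2 \<boxplus> lam \<bullet> h2) (f3 \<boxplus> g3 \<boxplus> lam \<bullet> h3) \<in> graded_relations"
  using assms
  by (simp only: comb_fadd comb_fscale fadd_in_words_mod fscale_in_words_mod lam_closed
      graded_relations_fadd graded_relations_fscale)

text \<open>Induction along the recursion. If the varied letter is not the head of its word, the
  induction hypotheses cover all three terms. If it is the head, it is written first, comes after
  \<open>y\<close>, or is multiplied by \<open>y\<close>; these cases are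
  \<open>comb_prefixed_graded_relations\<close>, the induction hypothesis, and the former combined
  with \<open>null_comb_mult\<close>.\<close>

lemma qsh_null_comb:
  assumes nc: "null_comb c1 c2 c3 a1 a2 a3"
    and "set us \<subseteq> carrier A" "set vs \<subseteq> carrier A" "set ys \<subseteq> carrier A"
  shows "comb c1 c2 c3 (qsh (us @ [a1] @ vs) ys) (qsh (us @ [a2] @ vs) ys) (qsh (us @ [a3] @ vs) ys) \<in> graded_relations"
  using assms(2-)
proof (induction us ys rule: list_pair_induct)
  note nc' = null_comb_carrier[OF nc]
  case (Nil_left ys)
  then show ?case
  \<comment> \<open>While the varied letter is the head, it remains in the tail only in the term
    that removes \<open>y\<close>, so the induction runs over \<open>ys\<close> alone.\<close>
  proof (induction ys)
    case Nil
    then show ?case using null_comb_in_relations[OF _ _ nc, of "[]" vs]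
      by (auto simp: letter_gen_def intro: relations_graded)
  next
    case (Cons y ys)
    show ?case unfolding append_Nil append_Cons qsh_Cons_Cons
    proof (rule comb_three_graded_relations)
      show "comb c1 c2 c3 (prefixed C y (qsh (a1 # vs) ys)) (prefixed C y (qsh (a2 # vs) ys)) (prefixed C y (qsh (a3 # vs) ys)) \<in> graded_relations"
        using Cons by (simp add: prefixed_comb[symmetric] nc' prefixed_graded_relations)
    qed (use Cons.prems nc' comb_prefixed_graded_relations[OF qsh_all_words nc, of vs "y # ys"]
        comb_prefixed_graded_relations[OF qsh_all_words null_comb_mult[OF nc], of vs ys y]
        in \<open>auto intro!: prefixed_all_words qsh_all_words\<close>)
  qed
next
  case (Nil_right x us)
  then show ?case using null_comb_in_relations[OF _ _ nc, of "x # us" vs]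
    by (auto simp: letter_gen_def intro: relations_graded)
next
  note nc' = null_comb_carrier[OF nc]
  case (Cons_Cons x us y ys)
  show ?case unfolding append_Cons qsh_Cons_Cons
    by (rule comb_three_graded_relations)
      (use Cons_Cons nc' in \<open>auto simp: prefixed_comb[symmetric] intro!: prefixed_all_words qsh_all_words prefixed_graded_relations\<close>)
qed

section \<open>The product of words with heads, extended bilinearly\<close>

abbreviation wsh :: "'a list \<Rightarrow> 'a list \<Rightarrow> 'a list \<Rightarrow> 'c"
  where "wsh \<equiv> word_shuffle C A lam"

lemma wsh_eq: "wsh u v = prefixed C (hd u \<otimes>\<^bsub>A\<^esub> hd v) (qsh (tl u) (tl v))"
  by (rule R.word_shuffle_eq_quasi_shuffle) simp

lemma wsh_Cons: "wsh (x # xs) (y # ys) = prefixed C (x \<otimes>\<^bsub>A\<^esub> y) (qsh xs ys)"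
  by (simp add: wsh_eq)

lemma wsh_closed [simp]: "wsh u v w \<in> carrier C"
  unfolding wsh_eq by (cases w) (auto intro: R.quasi_shuffle_closed)

text \<open>The upper bound is strict because the two heads are multiplied into one letter.\<close>

lemma wsh_in_words_mod:
  assumes "set u \<subseteq> carrier A" "set v \<subseteq> carrier A" "u \<noteq> []" "v \<noteq> []"
  shows "wsh u v \<in> words_mod (\<lambda>w. length u \<le> length w \<and> length v \<le> length w \<and> length w < length u + length v)"
proof -
  obtain x xs y ys where uv: "u = x # xs" "v = y # ys" using assms by (metis list.exhaust)
  show ?thesis unfolding uv wsh_Cons
    by (rule prefixed_in_words_mod[OF qsh_in_words_mod]) (use assms uv in auto)
qed

lemma wsh_comm:
  assumes "set u \<subseteq> carrier A" "set v \<subseteq> carrier A" "u \<noteq> []" "v \<noteq> []"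
  shows "wsh u v = wsh v u"
proof -
  obtain x xs y ys where uv: "u = x # xs" "v = y # ys" using assms by (metis list.exhaust)
  show ?thesis using assms unfolding uv wsh_Cons by (simp add: qsh_comm[of xs ys] m_comm)
qed

lemma wsh_null_comb:
  assumes nc: "null_comb c1 c2 c3 a1 a2 a3"
    and "set us \<subseteq> carrier A" "set vs \<subseteq> carrier A" "set v \<subseteq> carrier A" "v \<noteq> []"
  shows "comb c1 c2 c3 (wsh (us @ [a1] @ vs) v) (wsh (us @ [a2] @ vs) v) (wsh (us @ [a3] @ vs) v) \<in> graded_relations"
proof -
  obtain y ys where v: "v = y # ys" using assms by (metis list.exhaust)
  show ?thesis
  proof (cases us)
    case Nil
    then show ?thesis
      using comb_prefixed_graded_relations[OF qsh_all_words null_comb_mult[OF nc], of vs ys y] assms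
      by (simp add: v wsh_Cons)
  next
    case (Cons x us')
    have "comb c1 c2 c3 (qsh (us' @ [a1] @ vs) ys) (qsh (us' @ [a2] @ vs) ys) (qsh (us' @ [a3] @ vs) ys) \<in> graded_relations"
      using assms by (intro qsh_null_comb) (auto simp: v Cons)
    then have "prefixed C (x \<otimes>\<^bsub>A\<^esub> y) (comb c1 c2 c3 (qsh (us' @ [a1] @ vs) ys) (qsh (us' @ [a2] @ vs) ys) (qsh (us' @ [a3] @ vs) ys)) \<in> graded_relations"
      using assms by (intro prefixed_graded_relations) (auto simp: v Cons)
    then show ?thesis using null_comb_carrier[OF nc] by (simp add: v Cons wsh_Cons prefixed_comb)
  qed
qed

text \<open>The product of the shuffle algebra in all degrees at once, before the relations are
  divided out. It uses \<open>hd\<close> and \<open>tl\<close>, so its properties beyond bilinearity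
  concern nonempty words.\<close>

definition star :: "('a list \<Rightarrow> 'c) \<Rightarrow> ('a list \<Rightarrow> 'c) \<Rightarrow> 'a list \<Rightarrow> 'c" (infixl \<open>\<star>\<close> 70)
  where "f \<star> g = bilin wsh f g"

lemma star_fadd_left: "f \<in> all_words \<Longrightarrow> f' \<in> all_words \<Longrightarrow> g \<in> all_words \<Longrightarrow> (f \<boxplus> f') \<star> g = f \<star> g \<boxplus> f' \<star> g"
  and star_fadd_right: "f \<in> all_words \<Longrightarrow> g \<in> all_words \<Longrightarrow> g' \<in> all_words \<Longrightarrow> f \<star> (g \<boxplus> g') = f \<star> g \<boxplus> f \<star> g'"
  and star_fscale_left: "f \<in> all_words \<Longrightarrow> g \<in> all_words \<Longrightarrow> c \<in> carrier C \<Longrightarrow> (c \<bullet> f) \<star> g = c \<bullet> (f \<star> g)"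
  and star_fscale_right: "f \<in> all_words \<Longrightarrow> g \<in> all_words \<Longrightarrow> c \<in> carrier C \<Longrightarrow> f \<star> (c \<bullet> g) = c \<bullet> (f \<star> g)"
  and star_fzero_left [simp]: "fzero \<star> g = fzero"
  and star_fzero_right [simp]: "f \<star> fzero = fzero"
  and star_gen: "set u \<subseteq> carrier A \<Longrightarrow> set v \<subseteq> carrier A \<Longrightarrow> gen u \<star> gen v = wsh u v"
  unfolding star_def
  by (simp_all only: bilinear_extension_add_left bilinear_extension_add_right bilinear_extension_scale_left
      bilinear_extension_scale_right bilinear_extension_zero_left bilinear_extension_zero_right bilinear_extension_gen wsh_closed)

lemma star_in_words_mod:
  assumes "f \<in> words_mod P" "g \<in> words_mod Q"
    "\<And>u v. P u \<Longrightarrow> Q v \<Longrightarrow> u \<noteq> [] \<and> v \<noteq> []"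
    "\<And>u v w. P u \<Longrightarrow> Q v \<Longrightarrow> length u \<le> length w \<Longrightarrow> length v \<le> length w \<Longrightarrow> length w < length u + length v \<Longrightarrow> S w"
  shows "f \<star> g \<in> words_mod S"
  unfolding star_def using assms(1,2) wsh_closed
proof (rule bilinear_extension_in_words_mod)
  fix u v assume "set u \<subseteq> carrier A" "P u" "set v \<subseteq> carrier A" "Q v"
  then show "wsh u v \<in> words_mod S"
    using assms(3,4) by (intro words_mod_mono[OF wsh_in_words_mod]) blast+
qed

lemma star_nonempty: "f \<in> nonempty_words \<Longrightarrow> g \<in> nonempty_words \<Longrightarrow> f \<star> g \<in> nonempty_words"
  by (rule star_in_words_mod[where P = "\<lambda>w. w \<noteq> []" and Q = "\<lambda>w. w \<noteq> []"]) auto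

lemma star_comm:
  assumes f: "f \<in> nonempty_words" and g: "g \<in> nonempty_words"
  shows "f \<star> g = g \<star> f"
  using f
proof (induction rule: words_mod_induct)
  case (gen u)
  show ?case using g
  proof (induction rule: words_mod_induct)
    case (gen v)
    then show ?case using wsh_comm \<open>set u \<subseteq> carrier A\<close> \<open>u \<noteq> []\<close> by (simp add: star_gen)
  next
    case zero
    then show ?case by (simp only: star_fzero_left star_fzero_right)
  qed (use gen in \<open>simp_all only: star_fadd_left star_fadd_right star_fscale_left star_fscale_right words_mod_all gen_in_words_mod\<close>)
next
  case zero
  then show ?case by (simp only: star_fzero_left star_fzero_right)
qed (use words_mod_all[OF g] in \<open>simp_all only: star_fadd_left star_fadd_right star_fscale_left star_fscale_right words_mod_all\<close>)

text \<open>By linearity \<open>g\<close> may be taken to be a single word, and then this is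
  \<open>wsh_null_comb\<close>. With commutativity, it makes the product well defined on classes in
  both arguments.\<close>

lemma star_relations_left:
  assumes f: "f \<in> Rel k" and g: "g \<in> nonempty_words"
  shows "f \<star> g \<in> graded_relations"
  using f
proof (induction rule: relations_induct)
  case (comb us vs c1 c2 c3 a1 a2 a3)
  let ?l = "letter_gen us vs"
  note nc = null_comb_carrier[OF comb(4)]
  have l: "?l a \<in> all_words" if "a \<in> carrier A" for a using comb that by auto
  have eq: "comb c1 c2 c3 (?l a1) (?l a2) (?l a3) \<star> h = comb c1 c2 c3 (?l a1 \<star> h) (?l a2 \<star> h) (?l a3 \<star> h)"
    if "h \<in> all_words" for h
    unfolding comb_def using that nc l by (simp only: star_fadd_left star_fscale_left fadd_in_words_mod fscale_in_words_mod)
  have comb_in: "comb c1 c2 c3 (?l a1) (?l a2) (?l a3) \<in> all_words" using l nc by (intro comb_in_words_mod)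
  show ?case using g
  proof (induction rule: words_mod_induct)
    case (gen v)
    have "?l a \<star> gen v = wsh (us @ [a] @ vs) v" if "a \<in> carrier A" for a
      unfolding letter_gen_def by (rule star_gen) (use that gen comb in auto)
    moreover have "gen v \<in> all_words" using gen by auto
    ultimately show ?case
      using wsh_null_comb[OF comb(4,2,3) gen(1,2)] nc by (simp only: eq)
  next
    case zero
    then show ?case by (simp only: star_fzero_right graded_relations_fzero)
  next
    case (add f g)
    then show ?case by (simp only: star_fadd_right comb_in words_mod_all graded_relations_fadd)
  next
    case (scale c f)
    then show ?case by (simp only: star_fscale_right comb_in words_mod_all graded_relations_fscale)
  qed
next
  case zero
  then show ?case by (simp only: star_fzero_left graded_relations_fzero)
next
  case (add f f')
  then show ?case using words_mod_all[OF g] by (simp only: star_fadd_left words_mod_all graded_relations_fadd)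
next
  case (scale c f)
  then show ?case using words_mod_all[OF g] by (simp only: star_fscale_left words_mod_all graded_relations_fscale)
qed

lemma star_relations_right:
  assumes "f \<in> Rel k" "0 < k" and g: "g \<in> nonempty_words"
  shows "g \<star> f \<in> graded_relations"
proof -
  have "f \<in> nonempty_words"
    by (rule words_mod_mono[OF relations_in_length_words[OF assms(1)]]) (use assms(2) in auto)
  then show ?thesis using star_relations_left[OF assms(1) g] star_comm[OF g] by simp
qed

end

section \<open>Tensor powers\<close>

context word_module
begin

abbreviation TP :: "nat \<Rightarrow> ('c, ('a list \<Rightarrow> 'c) set) module" where "TP k \<equiv> tensor_power C A k"

definition cls :: "nat \<Rightarrow> ('a list \<Rightarrow> 'c) \<Rightarrow> ('a list \<Rightarrow> 'c) set"
  where "cls k f = Rel k +>\<^bsub>Free k\<^esub> f"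

lemma abelian_subgroup_relations: "abelian_subgroup (Rel k) (Free k)"
  by (rule abelian_subgroupI3[OF additive_subgroupI])
    (use submodule.axioms(1)[OF submodule_relations] module.axioms(2)[OF free_module] in auto)

lemma mem_cls: "g \<in> cls k f \<longleftrightarrow> (\<exists>r\<in>Rel k. g = r \<boxplus> f)"
  by (auto simp: cls_def a_r_coset_def' free_ops)

lemma cls_self: "f \<in> length_words k \<Longrightarrow> f \<in> cls k f"
  using abelian_subgroup.a_rcos_self[OF abelian_subgroup_relations] by (simp add: cls_def carrier_free)

lemma cls_relation_add:
  assumes "r \<in> Rel k" "f \<in> length_words k"
  shows "cls k (r \<boxplus> f) = cls k f"
proof -
  have "r \<boxplus> f \<in> Rel k +>\<^bsub>Free k\<^esub> f" using assms mem_cls by (auto simp: cls_def)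
  from abelian_group.a_repr_independence[OF module.axioms(2)[OF free_module] this _ submodule.axioms(1)[OF submodule_relations]]
  show ?thesis using assms by (simp add: cls_def carrier_free)
qed

lemma cls_eq_zero_iff:
  assumes "f \<in> length_words k"
  shows "cls k f = Rel k \<longleftrightarrow> f \<in> Rel k"
  using assms abelian_group.a_coset_join1[OF module.axioms(2)[OF free_module] _ _ submodule.axioms(1)[OF submodule_relations]]
    abelian_group.a_coset_join2[OF module.axioms(2)[OF free_module] _ submodule.axioms(1)[OF submodule_relations]]
  by (auto simp: cls_def carrier_free)

lemma cls_fzero [simp]: "cls k fzero = Rel k"
  by (simp add: cls_eq_zero_iff)

lemma cls_eqI:
  assumes f: "f \<in> length_words k" and g: "g \<in> length_words k" and "f \<boxplus> (\<ominus> \<one>) \<bullet> g \<in> Rel k"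
  shows "cls k f = cls k g"
proof -
  have "f = (f \<boxplus> (\<ominus> \<one>) \<bullet> g) \<boxplus> g"
    using f[THEN words_mod_closed] g[THEN words_mod_closed]
    by (auto simp: fapply R.l_minus R.a_assoc R.l_neg intro!: ext)
  then show ?thesis using cls_relation_add[OF assms(3) g] by simp
qed

lemma carrier_TP: "carrier (TP k) = cls k ` length_words k"
  by (auto simp: tensor_power_def A_RCOSETS_def' cls_def carrier_free)

lemma cls_in_TP [simp, intro]: "f \<in> length_words k \<Longrightarrow> cls k f \<in> carrier (TP k)"
  by (simp add: carrier_TP)

lemma TP_zero: "\<zero>\<^bsub>TP k\<^esub> = Rel k"
  by (simp add: tensor_power_def)

lemma TP_add: "f \<in> length_words k \<Longrightarrow> g \<in> length_words k \<Longrightarrow> cls k f \<oplus>\<^bsub>TP k\<^esub> cls k g = cls k (f \<boxplus> g)"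
  using abelian_subgroup.a_rcos_sum[OF abelian_subgroup_relations, of f k g]
  by (simp add: tensor_power_def cls_def carrier_free free_ops)

lemma TP_smult: "c \<in> carrier C \<Longrightarrow> f \<in> length_words k \<Longrightarrow> c \<odot>\<^bsub>TP k\<^esub> cls k f = cls k (c \<bullet> f)"
proof -
  assume c: "c \<in> carrier C" and f: "f \<in> length_words k"
  have "cls k (c \<bullet> g) = cls k (c \<bullet> f)" if g: "g \<in> cls k f" for g
  proof -
    obtain r where r: "r \<in> Rel k" "g = r \<boxplus> f" using g by (auto simp: mem_cls)
    have "c \<bullet> g = c \<bullet> r \<boxplus> c \<bullet> f"
      using words_mod_closed[OF relations_in_length_words[OF r(1)]] words_mod_closed[OF f] c
      by (auto simp: fapply r(2) R.r_distr intro!: ext)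
    then show ?thesis using r c f by (simp add: cls_relation_add)
  qed
  then have "(\<Union>g\<in>cls k f. cls k (c \<bullet> g)) = cls k (c \<bullet> f)"
    using cls_self[OF f] by blast
  then show ?thesis by (simp add: tensor_power_def cls_def free_ops)
qed

lemma TP_abelian_group: "abelian_group (TP k)"
proof (rule abelian_groupI)
  fix x y z assume "x \<in> carrier (TP k)" "y \<in> carrier (TP k)" "z \<in> carrier (TP k)"
  then obtain f g h where *: "x = cls k f" "y = cls k g" "z = cls k h"
      and fgh: "f \<in> length_words k" "g \<in> length_words k" "h \<in> length_words k"
    by (auto simp: carrier_TP)
  have "f \<boxplus> g \<boxplus> h = f \<boxplus> (g \<boxplus> h)"
    using fgh[THEN words_mod_closed] by (auto simp: fapply R.a_assoc intro!: ext)
  then show "x \<oplus>\<^bsub>TP k\<^esub> y \<oplus>\<^bsub>TP k\<^esub> z = x \<oplus>\<^bsub>TP k\<^esub> (y \<oplus>\<^bsub>TP k\<^esub> z)"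
    using fgh by (simp add: * TP_add)
next
  fix x y assume "x \<in> carrier (TP k)" "y \<in> carrier (TP k)"
  then obtain f g where *: "x = cls k f" "y = cls k g"
      and fg: "f \<in> length_words k" "g \<in> length_words k"
    by (auto simp: carrier_TP)
  have "f \<boxplus> g = g \<boxplus> f"
    using fg[THEN words_mod_closed] by (auto simp: fapply R.a_comm intro!: ext)
  then show "x \<oplus>\<^bsub>TP k\<^esub> y = y \<oplus>\<^bsub>TP k\<^esub> x"
    using fg by (simp add: * TP_add)
  show "x \<oplus>\<^bsub>TP k\<^esub> y \<in> carrier (TP k)" using fg by (simp add: * TP_add)
next
  show "\<zero>\<^bsub>TP k\<^esub> \<in> carrier (TP k)"
    using cls_in_TP[of fzero k] by (simp add: TP_zero)
next
  fix x assume "x \<in> carrier (TP k)"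
  then obtain f where *: "x = cls k f" and f: "f \<in> length_words k" by (auto simp: carrier_TP)
  have "fzero \<boxplus> f = f" "(\<ominus> \<one>) \<bullet> f \<boxplus> f = fzero"
    using words_mod_closed[OF f] by (auto simp: fapply R.l_minus R.l_neg intro!: ext)
  then show "\<zero>\<^bsub>TP k\<^esub> \<oplus>\<^bsub>TP k\<^esub> x = x" "\<exists>y\<in>carrier (TP k). y \<oplus>\<^bsub>TP k\<^esub> x = \<zero>\<^bsub>TP k\<^esub>"
    using f TP_add[of fzero k f] by (auto simp: * TP_zero TP_add intro!: bexI[of _ "cls k ((\<ominus> \<one>) \<bullet> f)"])
qed

text \<open>Represents a finite sum of classes by one function on words, so that sums of products
  can be rearranged before passing to the quotient.\<close>

definition fsum :: "('i \<Rightarrow> 'a list \<Rightarrow> 'c) \<Rightarrow> 'i set \<Rightarrow> 'a list \<Rightarrow> 'c"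
  where "fsum h I = (\<lambda>w. \<Oplus>i\<in>I. h i w)"

lemma fsum_empty [simp]: "fsum h {} = fzero"
  by (simp add: fsum_def fzero_def)

lemma fsum_insert:
  assumes "finite I" "i \<notin> I" "\<And>j. j \<in> insert i I \<Longrightarrow> h j \<in> words_mod P"
  shows "fsum h (insert i I) = h i \<boxplus> fsum h I"
  using assms words_mod_closed[OF assms(3)] by (auto simp: fsum_def fapply intro!: ext)

lemma fsum_in_words_mod [simp]:
  assumes "finite I" "\<And>j. j \<in> I \<Longrightarrow> h j \<in> words_mod P"
  shows "fsum h I \<in> words_mod P"
  using assms
proof (induction)
  case (insert i I)
  then show ?case using fsum_insert[OF insert(1,2), of h P] by auto
qed auto

lemma TP_finsum:
  assumes "finite I" "\<And>i. i \<in> I \<Longrightarrow> h i \<in> length_words k"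
  shows "(\<Oplus>\<^bsub>TP k\<^esub>i\<in>I. cls k (h i)) = cls k (fsum h I)"
proof -
  interpret T: abelian_group "TP k" by (rule TP_abelian_group)
  show ?thesis using assms
  proof (induction)
    case empty
    then show ?case by (simp add: TP_zero)
  next
    case (insert i I)
    then have "fsum h (insert i I) = h i \<boxplus> fsum h I" by (intro fsum_insert) auto
    then show ?case using insert by (simp add: TP_add Pi_def)
  qed
qed

lemma TP_finsum_single:
  assumes "finite I" "i \<in> I" "X i \<in> carrier (TP k)" "\<And>j. j \<in> I \<Longrightarrow> j \<noteq> i \<Longrightarrow> X j = \<zero>\<^bsub>TP k\<^esub>"
  shows "(\<Oplus>\<^bsub>TP k\<^esub>j\<in>I. X j) = X i"
proof -
  interpret T: abelian_group "TP k" by (rule TP_abelian_group)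
  have "(\<Oplus>\<^bsub>TP k\<^esub>j\<in>{i}. X j) = (\<Oplus>\<^bsub>TP k\<^esub>j\<in>I. X j)"
  proof (rule T.add.finprod_mono_neutral_cong_left)
    have "X x \<in> carrier (TP k)" if "x \<in> I" for x using assms that by (cases "x = i") auto
    then show "X \<in> I \<rightarrow> carrier (TP k)" by blast
  qed (use assms in auto)
  then show ?thesis using assms(3) by (simp add: Pi_def)
qed

lemma TP_finsum_zero:
  assumes "\<And>j. j \<in> I \<Longrightarrow> X j = \<zero>\<^bsub>TP k\<^esub>"
  shows "(\<Oplus>\<^bsub>TP k\<^esub>j\<in>I. X j) = \<zero>\<^bsub>TP k\<^esub>"
proof -
  interpret T: abelian_group "TP k" by (rule TP_abelian_group)
  show ?thesis by (rule T.add.finprod_one_eqI) (use assms in auto)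
qed

section \<open>Factorwise multiplication on representatives\<close>

abbreviation pointwise :: "('a list \<Rightarrow> 'c) \<Rightarrow> ('a list \<Rightarrow> 'c) \<Rightarrow> 'a list \<Rightarrow> 'c"
  where "pointwise \<equiv> bilin (\<lambda>u v. gen (map2 (\<lambda>x y. x \<otimes>\<^bsub>A\<^esub> y) u v))"

lemma set_map2_mult: "set u \<subseteq> carrier A \<Longrightarrow> set v \<subseteq> carrier A \<Longrightarrow> set (map2 (\<lambda>x y. x \<otimes>\<^bsub>A\<^esub> y) u v) \<subseteq> carrier A"
  by (auto dest: set_zip_leftD set_zip_rightD intro!: m_closed)

lemma pointwise_in [simp, intro]:
  assumes "f \<in> length_words k" "g \<in> length_words k"
  shows "pointwise f g \<in> length_words k"
  using assms
proof (rule bilinear_extension_in_words_mod)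
  fix u v assume "set u \<subseteq> carrier A" "length u = k" "set v \<subseteq> carrier A" "length v = k"
  then show "gen (map2 (\<lambda>x y. x \<otimes>\<^bsub>A\<^esub> y) u v) \<in> length_words k"
    by (intro gen_in_words_mod set_map2_mult) auto
qed simp

text \<open>Serves two unit laws: the word of ones for the factorwise product and the one-letter
  word \<open>[\<one>]\<close> for the shuffle product.\<close>

lemma bilinear_extension_unit:
  assumes g: "g \<in> words_mod P" and \<beta>: "\<And>u v w. \<beta> u v w \<in> carrier C" and e: "set e \<subseteq> carrier A"
    and unit: "\<And>v. set v \<subseteq> carrier A \<Longrightarrow> P v \<Longrightarrow> \<beta> e v = gen v"
  shows "bilin \<beta> (gen e) g = g"
  using g
proof (induction rule: words_mod_induct)
  case (gen w)
  then show ?case using bilinear_extension_gen[OF \<beta> e, of w] unit by simp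
next
  case zero
  then show ?case by (simp only: bilinear_extension_zero_right)
qed (use e in \<open>simp_all only: bilinear_extension_add_right bilinear_extension_scale_right \<beta> words_mod_all gen_in_words_mod\<close>)

lemma Union_const:
  assumes "x \<in> X" "y \<in> Y" "\<And>x' y'. x' \<in> X \<Longrightarrow> y' \<in> Y \<Longrightarrow> F x' y' = F x y"
  shows "(\<Union>x'\<in>X. \<Union>y'\<in>Y. F x' y') = F x y"
  using assms by blast

end

context shuffle_module
begin

lemma homog_qsh_diagonal:
  assumes "length xs = length ys" "set xs \<subseteq> carrier A" "set ys \<subseteq> carrier A"
  shows "homog (length xs) (qsh xs ys) = (lam [^] length xs) \<bullet> gen (map2 (\<lambda>x y. x \<otimes>\<^bsub>A\<^esub> y) xs ys)"
  using assms
proof (induction xs ys rule: list_induct2)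
  case Nil
  show ?case by (rule ext) (simp add: homog_def fapply word_gen_def)
next
  case (Cons x xs y ys)
  \<comment> \<open>One argument keeps its full length, so every word of this product is longer than
    \<open>length xs\<close>. In the lowest degree only the merging term is left.\<close>
  have z1: "homog (length xs) (qsh xs (y # ys)) = fzero"
    by (rule homog_eq_fzero[OF qsh_in_words_mod]) (use Cons in auto)
  have z2: "homog (length xs) (qsh (x # xs) ys) = fzero"
    by (rule homog_eq_fzero[OF qsh_in_words_mod]) (use Cons in auto)
  have in_all: "prefixed C x (qsh xs (y # ys)) \<in> all_words" "prefixed C y (qsh (x # xs) ys) \<in> all_words"
      "prefixed C (x \<otimes>\<^bsub>A\<^esub> y) (qsh xs ys) \<in> all_words"
    using Cons.prems by (auto intro!: prefixed_all_words qsh_all_words)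
  have "homog (length (x # xs)) (qsh (x # xs) (y # ys)) =
      fzero \<boxplus> fzero \<boxplus> lam \<bullet> prefixed C (x \<otimes>\<^bsub>A\<^esub> y) (homog (length xs) (qsh xs ys))"
    unfolding qsh_Cons_Cons length_Cons
    by (subst homog_fadd[of _ "\<lambda>_. True" _ "\<lambda>_. True"], (simp add: in_all)+)
      (simp only: homog_fadd[OF in_all(1,2)] homog_fscale lam_closed homog_prefixed z1 z2 prefixed_fzero)
  also have "\<dots> = (lam [^] length (x # xs)) \<bullet> gen (map2 (\<lambda>x y. x \<otimes>\<^bsub>A\<^esub> y) (x # xs) (y # ys))"
    using Cons by (simp only: Cons.IH set_simps insert_subset prefixed_fscale prefixed_gen R.nat_pow_closed lam_closed)
      (auto simp: fapply R.m_assoc[symmetric] R.m_comm intro!: ext)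
  finally show ?case .
qed

lemma homog_wsh_diagonal:
  assumes "length u = Suc n" "length v = Suc n" "set u \<subseteq> carrier A" "set v \<subseteq> carrier A"
  shows "homog (Suc n) (wsh u v) = (lam [^] n) \<bullet> gen (map2 (\<lambda>x y. x \<otimes>\<^bsub>A\<^esub> y) u v)"
proof -
  obtain x xs y ys where uv: "u = x # xs" "v = y # ys" using assms by (metis Suc_length_conv)
  have "homog (Suc n) (wsh u v) = prefixed C (x \<otimes>\<^bsub>A\<^esub> y) (homog n (qsh xs ys))"
    by (simp only: uv wsh_Cons homog_prefixed)
  also have "homog n (qsh xs ys) = (lam [^] n) \<bullet> gen (map2 (\<lambda>x y. x \<otimes>\<^bsub>A\<^esub> y) xs ys)"
    using homog_qsh_diagonal[of xs ys] assms uv by auto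
  finally show ?thesis by (simp add: prefixed_fscale prefixed_gen uv)
qed

lemma homog_star_diagonal:
  assumes f: "f \<in> length_words (Suc n)" and g: "g \<in> length_words (Suc n)"
  shows "homog (Suc n) (f \<star> g) = (lam [^] n) \<bullet> pointwise f g"
proof -
  have star: "f \<star> g \<in> all_words" if "f \<in> length_words (Suc n)" "g \<in> length_words (Suc n)" for f g
    using that by (auto intro!: star_in_words_mod)
  have pw: "pointwise f g \<in> all_words" if "f \<in> length_words (Suc n)" "g \<in> length_words (Suc n)" for f g
    using words_mod_all[OF pointwise_in[OF that]] .
  note lin = words_mod_all star_fadd_left star_fadd_right star_fscale_left star_fscale_right star_fzero_left star_fzero_right
    bilinear_extension_add_left bilinear_extension_add_right bilinear_extension_scale_left bilinear_extension_scale_right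
    bilinear_extension_zero_left bilinear_extension_zero_right homog_fadd[OF star star] homog_fscale homog_fzero
    fscale_fadd fscale_left_commute fscale_fzero pw word_gen_closed R.nat_pow_closed lam_closed
  show ?thesis using f
  proof (induction rule: words_mod_induct)
    case (gen u)
    then have u: "gen u \<in> length_words (Suc n)" by auto
    show ?case using g
    proof (induction rule: words_mod_induct)
      case (gen v)
      then show ?case using homog_wsh_diagonal[of u n v] \<open>length u = Suc n\<close> \<open>set u \<subseteq> carrier A\<close>
        by (simp add: star_gen bilinear_extension_gen)
    qed (use u in \<open>simp_all only: lin\<close>)
  qed (use g in \<open>simp_all only: lin\<close>)
qed

lemma length_words_nonempty: "f \<in> length_words (Suc i) \<Longrightarrow> f \<in> nonempty_words"
  by (erule words_mod_mono) auto

text \<open>One representative is replaced at a time: \<open>f' \<star> g'\<close> is the sum of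
  \<open>r \<star> g'\<close>, \<open>f \<star> s\<close> and \<open>f \<star> g\<close>, and the
  first two are relations in every degree.\<close>

lemma cls_homog_star_cong:
  assumes f: "f \<in> length_words (Suc i)" and g: "g \<in> length_words (Suc j)"
    and f': "f' \<in> cls (Suc i) f" and g': "g' \<in> cls (Suc j) g"
  shows "cls n (homog n (f' \<star> g')) = cls n (homog n (f \<star> g))"
proof -
  obtain r s where r: "r \<in> Rel (Suc i)" "f' = r \<boxplus> f" and s: "s \<in> Rel (Suc j)" "g' = s \<boxplus> g"
    using f' g' by (auto simp: mem_cls)
  note ne [simp] = f[THEN length_words_nonempty] g[THEN length_words_nonempty]
    r(1)[THEN relations_in_length_words, THEN length_words_nonempty] s(1)[THEN relations_in_length_words, THEN length_words_nonempty]
  have g'n: "g' \<in> nonempty_words" unfolding s by simp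
  have "f' \<star> g' = r \<star> g' \<boxplus> (f \<star> s \<boxplus> f \<star> g)"
    unfolding r(2) by (simp add: star_fadd_left words_mod_all[OF g'n] words_mod_all[OF ne(1)] words_mod_all[OF ne(2)] words_mod_all[OF ne(3)])
      (simp add: s(2) star_fadd_right words_mod_all[OF ne(1)] words_mod_all[OF ne(2)] words_mod_all[OF ne(4)])
  moreover have "r \<star> g' \<in> nonempty_words" "f \<star> s \<in> nonempty_words" "f \<star> g \<in> nonempty_words"
    using g'n by (auto intro: star_nonempty)
  ultimately have "homog n (f' \<star> g') = homog n (r \<star> g') \<boxplus> (homog n (f \<star> s) \<boxplus> homog n (f \<star> g))"
    by (simp add: homog_fadd_nonempty)
  moreover have "homog n (r \<star> g') \<in> Rel n" "homog n (f \<star> s) \<in> Rel n"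
    using star_relations_left[OF r(1) g'n] star_relations_right[OF s(1) _ ne(1)] by (auto dest: graded_relationsD(2))
  moreover have "homog n (f \<star> g) \<in> length_words n" using star_nonempty[OF ne(1,2)] by blast
  ultimately show ?thesis by (simp add: cls_relation_add relations_in_length_words)
qed

text \<open>Component indices count the letters behind the head, so component \<open>n\<close>
  consists of words of length \<open>Suc n\<close>.\<close>

lemma shuffle_component_cls:
  assumes f: "f \<in> length_words (Suc i)" and g: "g \<in> length_words (Suc j)"
  shows "shuffle_component C A lam n (cls (Suc i) f) (cls (Suc j) g) = cls (Suc n) (homog (Suc n) (f \<star> g))"
proof -
  have "shuffle_component C A lam n (cls (Suc i) f) (cls (Suc j) g) =
      (\<Union>f'\<in>cls (Suc i) f. \<Union>g'\<in>cls (Suc j) g. cls (Suc n) (homog (Suc n) (f' \<star> g')))"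
    by (simp add: shuffle_component_def cls_def homog_def star_def)
  also have "\<dots> = cls (Suc n) (homog (Suc n) (f \<star> g))"
    by (rule Union_const[OF cls_self[OF f] cls_self[OF g]]) (rule cls_homog_star_cong[OF f g])
  finally show ?thesis .
qed

end

text \<open>The factorwise product is the lowest component of the shuffle product of weight \<open>1\<close>.\<close>

lemma (in word_module) TP_mult:
  assumes f: "f \<in> length_words (Suc n)" and g: "g \<in> length_words (Suc n)"
  shows "cls (Suc n) f \<otimes>\<^bsub>TP (Suc n)\<^esub> cls (Suc n) g = cls (Suc n) (pointwise f g)"
proof -
  \<comment> \<open>With weight 1 the factor in \<open>homog_star_diagonal\<close> is 1, so
    independence of representatives is an instance of \<open>cls_homog_star_cong\<close>.\<close>
  interpret S: shuffle_module C A \<one> by unfold_locales simp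
  have one: "\<one> [^] n \<bullet> h = h" if "h \<in> all_words" for h
    using words_mod_closed[OF that] by (auto simp: fapply intro!: ext)
  have eq: "pointwise f' g' = homog (Suc n) (S.star f' g')"
    if "f' \<in> length_words (Suc n)" "g' \<in> length_words (Suc n)" for f' g'
    using S.homog_star_diagonal[OF that] one[OF words_mod_all[OF pointwise_in[OF that]]] by simp
  have sub: "h' \<in> length_words (Suc n)" if "h \<in> length_words (Suc n)" "h' \<in> cls (Suc n) h" for h h'
    using that by (auto simp: mem_cls relations_in_length_words)
  have "cls (Suc n) f \<otimes>\<^bsub>TP (Suc n)\<^esub> cls (Suc n) g =
      (\<Union>f'\<in>cls (Suc n) f. \<Union>g'\<in>cls (Suc n) g. cls (Suc n) (pointwise f' g'))"
    by (simp add: tensor_power_def rcoset_mult_def cls_def) (simp add: free_tensors_def)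
  also have "\<dots> = cls (Suc n) (pointwise f g)"
  proof (rule Union_const[OF cls_self[OF f] cls_self[OF g]])
    fix f' g' assume f'g': "f' \<in> cls (Suc n) f" "g' \<in> cls (Suc n) g"
    show "cls (Suc n) (pointwise f' g') = cls (Suc n) (pointwise f g)"
      using S.cls_homog_star_cong[OF f g f'g', of "Suc n"] f'g'[THEN sub[rotated]] f g by (simp add: eq)
  qed
  finally show ?thesis .
qed

lemma (in shuffle_module) shuffle_component_diagonal:
  assumes "X \<in> carrier (TP (Suc n))" "Y \<in> carrier (TP (Suc n))"
  shows "shuffle_component C A lam n X Y = (lam [^] n) \<odot>\<^bsub>TP (Suc n)\<^esub> (X \<otimes>\<^bsub>TP (Suc n)\<^esub> Y)"
proof -
  obtain f g where *: "X = cls (Suc n) f" "Y = cls (Suc n) g" and fg: "f \<in> length_words (Suc n)" "g \<in> length_words (Suc n)"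
    using assms by (auto simp: carrier_TP)
  show ?thesis
    using fg by (simp add: * shuffle_component_cls homog_star_diagonal TP_mult TP_smult)
qed

context word_module
begin

subsection \<open>The multiplication map of a tensor power\<close>

definition prod_word :: "'a list \<Rightarrow> 'a" where
  "prod_word w = foldr (\<lambda>x y. x \<otimes>\<^bsub>A\<^esub> y) w \<one>\<^bsub>A\<^esub>"

lemma prod_word_Nil [simp]: "prod_word [] = \<one>\<^bsub>A\<^esub>"
  and prod_word_Cons [simp]: "prod_word (x # w) = x \<otimes>\<^bsub>A\<^esub> prod_word w"
  by (simp_all add: prod_word_def)

lemma prod_word_closed [simp]: "set w \<subseteq> carrier A \<Longrightarrow> prod_word w \<in> carrier A"
  by (induction w) auto

lemma prod_word_append:
  "set u \<subseteq> carrier A \<Longrightarrow> set v \<subseteq> carrier A \<Longrightarrow> prod_word (u @ v) = prod_word u \<otimes>\<^bsub>A\<^esub> prod_word v"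
  by (induction u) (auto simp: m_assoc)

text \<open>The multiplication map from tensor powers to A, on representatives. It is the tool for
  proving tensors nonzero without a basis of the tensor power.\<close>

definition mult_map :: "('a list \<Rightarrow> 'c) \<Rightarrow> 'a" where
  "mult_map f = (\<Oplus>\<^bsub>A\<^esub>w\<in>word_supp C f. f w \<odot>\<^bsub>A\<^esub> prod_word w)"

lemma mult_map_superset:
  assumes f: "f \<in> all_words" and S: "finite S" "word_supp C f \<subseteq> S" "\<And>w. w \<in> S \<Longrightarrow> set w \<subseteq> carrier A"
  shows "mult_map f = (\<Oplus>\<^bsub>A\<^esub>w\<in>S. f w \<odot>\<^bsub>A\<^esub> prod_word w)"
  unfolding mult_map_def
  by (rule M.add.finprod_mono_neutral_cong_left)
    (use S words_mod_closed[OF f] in \<open>auto simp: word_supp_def\<close>)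

lemma word_supp_set: "f \<in> all_words \<Longrightarrow> w \<in> word_supp C f \<Longrightarrow> set w \<subseteq> carrier A"
  using words_mod_set by (auto simp: word_supp_def)

lemma mult_map_fadd:
  assumes f: "f \<in> all_words" and g: "g \<in> all_words"
  shows "mult_map (f \<boxplus> g) = mult_map f \<oplus>\<^bsub>A\<^esub> mult_map g"
proof -
  let ?S = "word_supp C f \<union> word_supp C g"
  have S: "set w \<subseteq> carrier A" if "w \<in> ?S" for w using that word_supp_set f g by blast
  have fin: "finite ?S" using f g words_mod_finite by blast
  note cl = words_mod_closed[OF f] words_mod_closed[OF g]
  have "mult_map (f \<boxplus> g) = (\<Oplus>\<^bsub>A\<^esub>w\<in>?S. (f \<boxplus> g) w \<odot>\<^bsub>A\<^esub> prod_word w)"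
    by (rule mult_map_superset) (use f g fin S in \<open>auto simp: word_supp_def fapply\<close>)
  also have "\<dots> = (\<Oplus>\<^bsub>A\<^esub>w\<in>?S. f w \<odot>\<^bsub>A\<^esub> prod_word w \<oplus>\<^bsub>A\<^esub> g w \<odot>\<^bsub>A\<^esub> prod_word w)"
    by (rule M.finsum_cong') (use S cl in \<open>auto simp: fapply smult_l_distr\<close>)
  also have "\<dots> = (\<Oplus>\<^bsub>A\<^esub>w\<in>?S. f w \<odot>\<^bsub>A\<^esub> prod_word w) \<oplus>\<^bsub>A\<^esub> (\<Oplus>\<^bsub>A\<^esub>w\<in>?S. g w \<odot>\<^bsub>A\<^esub> prod_word w)"
    by (rule M.finsum_addf) (use S cl in auto)
  also have "(\<Oplus>\<^bsub>A\<^esub>w\<in>?S. f w \<odot>\<^bsub>A\<^esub> prod_word w) = mult_map f"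
    by (rule mult_map_superset[symmetric]) (use f fin S in auto)
  also have "(\<Oplus>\<^bsub>A\<^esub>w\<in>?S. g w \<odot>\<^bsub>A\<^esub> prod_word w) = mult_map g"
    by (rule mult_map_superset[symmetric]) (use g fin S in auto)
  finally show ?thesis .
qed

lemma mult_map_fscale:
  assumes f: "f \<in> all_words" and c: "c \<in> carrier C"
  shows "mult_map (c \<bullet> f) = c \<odot>\<^bsub>A\<^esub> mult_map f"
proof -
  let ?S = "word_supp C f"
  have S: "set w \<subseteq> carrier A" if "w \<in> ?S" for w using that word_supp_set f by blast
  have fin: "finite ?S" using f words_mod_finite by blast
  note cl = words_mod_closed[OF f]
  have "mult_map (c \<bullet> f) = (\<Oplus>\<^bsub>A\<^esub>w\<in>?S. (c \<bullet> f) w \<odot>\<^bsub>A\<^esub> prod_word w)"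
    by (rule mult_map_superset) (use f c fin S in \<open>auto simp: word_supp_def fapply\<close>)
  also have "\<dots> = (\<Oplus>\<^bsub>A\<^esub>w\<in>?S. c \<odot>\<^bsub>A\<^esub> (f w \<odot>\<^bsub>A\<^esub> prod_word w))"
    by (rule M.finsum_cong') (use S cl c in \<open>auto simp: fapply smult_assoc1\<close>)
  also have "\<dots> = c \<odot>\<^bsub>A\<^esub> mult_map f"
    unfolding mult_map_def by (rule finsum_smult_ldistr[symmetric]) (use S cl c fin in auto)
  finally show ?thesis .
qed

lemma mult_map_gen [simp]:
  assumes w: "set w \<subseteq> carrier A"
  shows "mult_map (gen w) = prod_word w"
proof -
  have "word_supp C (gen w) \<subseteq> {w}" by (auto simp: word_supp_def word_gen_def)
  then have "mult_map (gen w) = (\<Oplus>\<^bsub>A\<^esub>v\<in>{w}. gen w v \<odot>\<^bsub>A\<^esub> prod_word v)"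
    by (intro mult_map_superset) (use w gen_in_words_mod in auto)
  also have "\<dots> = prod_word w" using w by (simp add: word_gen_def[THEN fun_cong])
  finally show ?thesis .
qed

lemma mult_map_fzero [simp]: "mult_map fzero = \<zero>\<^bsub>A\<^esub>"
  by (simp add: mult_map_def word_supp_def fapply)

text \<open>By commutativity of A the varied letter can be pulled out of the product, and
  multiplying by the remaining factor keeps the combination of letters zero.\<close>

lemma mult_map_relations: "f \<in> Rel k \<Longrightarrow> mult_map f = \<zero>\<^bsub>A\<^esub>"
proof (induction rule: relations_induct)
  case (comb us vs c1 c2 c3 a1 a2 a3)
  note nc = null_comb_carrier[OF comb(4)]
  let ?u = "prod_word us" and ?v = "prod_word vs"
  have uv: "?u \<in> carrier A" "?v \<in> carrier A" using comb by auto
  have l: "letter_gen us vs a \<in> all_words" "mult_map (letter_gen us vs a) = a \<otimes>\<^bsub>A\<^esub> (?u \<otimes>\<^bsub>A\<^esub> ?v)" if "a \<in> carrier A" for a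
  proof -
    show "letter_gen us vs a \<in> all_words" using comb that by auto
    show "mult_map (letter_gen us vs a) = a \<otimes>\<^bsub>A\<^esub> (?u \<otimes>\<^bsub>A\<^esub> ?v)"
      unfolding letter_gen_def using comb that uv
      by (simp add: prod_word_append m_lcomm)
  qed
  have "null_comb c1 c2 c3 (a1 \<otimes>\<^bsub>A\<^esub> (?u \<otimes>\<^bsub>A\<^esub> ?v)) (a2 \<otimes>\<^bsub>A\<^esub> (?u \<otimes>\<^bsub>A\<^esub> ?v)) (a3 \<otimes>\<^bsub>A\<^esub> (?u \<otimes>\<^bsub>A\<^esub> ?v))"
    by (rule null_comb_mult[OF comb(4)]) (use uv in simp)
  then show ?case
    using l nc by (simp add: comb_def mult_map_fadd mult_map_fscale null_comb_def)
next
  case (add f g)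
  then show ?case using words_mod_all by (simp add: mult_map_fadd)
next
  case (scale c f)
  then show ?case using words_mod_all by (simp add: mult_map_fscale)
qed simp

lemma pure_tensor_eq_cls: "pure_tensor C A w = cls (length w) (gen w)"
  by (simp add: pure_tensor_def cls_def)

lemma cls_gen_neq_zero:
  assumes "set w \<subseteq> carrier A" "length w = k" "prod_word w \<noteq> \<zero>\<^bsub>A\<^esub>"
  shows "cls k (gen w) \<noteq> Rel k"
  using assms mult_map_relations[of "gen w" k] cls_eq_zero_iff[of "gen w" k] gen_in_words_mod[of w] by auto

lemma gen_zero_in_relations: "gen [\<zero>\<^bsub>A\<^esub>] \<in> Rel (Suc 0)"
proof -
  have "letter_gen [] [] \<zero>\<^bsub>A\<^esub> \<boxplus> (\<ominus> \<zero>) \<bullet> letter_gen [] [] \<zero>\<^bsub>A\<^esub> \<in> Rel (Suc 0)"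
    using gen_scale_relation[of "[]" "[]" "\<zero>\<^bsub>A\<^esub>" \<zero>] by simp
  then show ?thesis by (simp add: letter_gen_def fadd_def fscale_def)
qed

lemma cls_letter_eq_zero_iff:
  assumes "a \<in> carrier A"
  shows "cls (Suc 0) (gen [a]) = Rel (Suc 0) \<longleftrightarrow> a = \<zero>\<^bsub>A\<^esub>"
  using assms cls_gen_neq_zero[of "[a]" "Suc 0"] gen_zero_in_relations cls_eq_zero_iff[of "gen [a]" "Suc 0"]
    gen_in_words_mod[of "[a]"] by auto

text \<open>The first tensor power is A. With empty contexts on both sides, the relations contract
  sums and multiples of one-letter words to one letter; a letter with class zero is zero by
  \<open>cls_letter_eq_zero_iff\<close>.\<close>

lemma length_one_cls:
  assumes "f \<in> length_words (Suc 0)"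
  shows "\<exists>a\<in>carrier A. cls (Suc 0) f = cls (Suc 0) (gen [a])"
  using assms
proof (induction rule: words_mod_induct)
  case zero
  then show ?case using cls_letter_eq_zero_iff[of "\<zero>\<^bsub>A\<^esub>"] cls_fzero by (metis M.zero_closed)
next
  case (gen w)
  then obtain a where "w = [a]" by (auto simp: length_Suc_conv)
  then show ?case using gen by auto
next
  case (add f g)
  then obtain a b where ab: "a \<in> carrier A" "b \<in> carrier A" "cls (Suc 0) f = cls (Suc 0) (gen [a])" "cls (Suc 0) g = cls (Suc 0) (gen [b])"
    by auto
  have "comb \<one> (\<ominus> \<one>) (\<ominus> \<one>) (letter_gen [] [] (a \<oplus>\<^bsub>A\<^esub> b)) (letter_gen [] [] a) (letter_gen [] [] b) \<in> Rel (Suc 0)"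
    by (rule gen_add_relation) (use ab in auto)
  also have "comb \<one> (\<ominus> \<one>) (\<ominus> \<one>) (letter_gen [] [] (a \<oplus>\<^bsub>A\<^esub> b)) (letter_gen [] [] a) (letter_gen [] [] b)
     = gen [a \<oplus>\<^bsub>A\<^esub> b] \<boxplus> (\<ominus> \<one>) \<bullet> (gen [a] \<boxplus> gen [b])"
    using ab by (auto simp: comb_def letter_gen_def fapply R.r_distr R.a_assoc intro!: ext)
  finally have "cls (Suc 0) (gen [a \<oplus>\<^bsub>A\<^esub> b]) = cls (Suc 0) (gen [a] \<boxplus> gen [b])"
    by (intro cls_eqI) (use ab letter_in in auto)
  also have "\<dots> = cls (Suc 0) (f \<boxplus> g)"
    using ab letter_in add by (simp flip: TP_add)
  finally show ?case using ab by (metis M.a_closed)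
next
  case (scale c f)
  then obtain a where a: "a \<in> carrier A" "cls (Suc 0) f = cls (Suc 0) (gen [a])"
    by auto
  have "letter_gen [] [] (c \<odot>\<^bsub>A\<^esub> a) \<boxplus> (\<ominus> c) \<bullet> letter_gen [] [] a \<in> Rel (Suc 0)"
    by (rule gen_scale_relation) (use a scale in auto)
  also have "letter_gen [] [] (c \<odot>\<^bsub>A\<^esub> a) \<boxplus> (\<ominus> c) \<bullet> letter_gen [] [] a
     = gen [c \<odot>\<^bsub>A\<^esub> a] \<boxplus> (\<ominus> \<one>) \<bullet> (c \<bullet> gen [a])"
    using a scale by (auto simp: letter_gen_def fapply R.l_minus intro!: ext)
  finally have "cls (Suc 0) (gen [c \<odot>\<^bsub>A\<^esub> a]) = cls (Suc 0) (c \<bullet> gen [a])"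
    by (intro cls_eqI) (use a letter_in scale in auto)
  also have "\<dots> = cls (Suc 0) (c \<bullet> f)"
    using a letter_in scale by (simp flip: TP_smult)
  finally show ?case using a scale by (metis smult_closed)
qed

lemma TP_one_elements:
  assumes "X \<in> carrier (TP (Suc 0))"
  obtains a where "a \<in> carrier A" "X = cls (Suc 0) (gen [a])"
  using assms length_one_cls by (auto simp: carrier_TP)

lemma TP_one: "\<one>\<^bsub>TP k\<^esub> = cls k (gen (replicate k \<one>\<^bsub>A\<^esub>))"
  by (simp add: tensor_power_def cls_def free_tensors_def)

lemma map2_replicate_one:
  "set v \<subseteq> carrier A \<Longrightarrow> map2 (\<lambda>x y. x \<otimes>\<^bsub>A\<^esub> y) (replicate (length v) \<one>\<^bsub>A\<^esub>) v = v"
  by (induction v) auto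

lemma TP_one_mult:
  assumes "X \<in> carrier (TP (Suc n))"
  shows "\<one>\<^bsub>TP (Suc n)\<^esub> \<otimes>\<^bsub>TP (Suc n)\<^esub> X = X"
proof -
  obtain f where X: "X = cls (Suc n) f" and f: "f \<in> length_words (Suc n)" using assms by (auto simp: carrier_TP)
  let ?e = "replicate (Suc n) \<one>\<^bsub>A\<^esub>"
  have e: "set ?e \<subseteq> carrier A" by auto
  have "pointwise (gen ?e) f = f"
    by (rule bilinear_extension_unit[OF f _ e]) (use map2_replicate_one in force)+
  moreover have "gen ?e \<in> length_words (Suc n)" by (intro gen_in_words_mod) auto
  ultimately show ?thesis unfolding X TP_one using f by (simp only: TP_mult)
qed

lemma TP_mult_closed:
  assumes "X \<in> carrier (TP (Suc n))" "Y \<in> carrier (TP (Suc n))"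
  shows "X \<otimes>\<^bsub>TP (Suc n)\<^esub> Y \<in> carrier (TP (Suc n))"
  using assms by (auto simp: carrier_TP TP_mult)

lemma TP_smult_closed: "X \<in> carrier (TP k) \<Longrightarrow> c \<in> carrier C \<Longrightarrow> c \<odot>\<^bsub>TP k\<^esub> X \<in> carrier (TP k)"
  by (auto simp: carrier_TP TP_smult)

lemma TP_smult_one: "X \<in> carrier (TP k) \<Longrightarrow> \<one> \<odot>\<^bsub>TP k\<^esub> X = X"
proof -
  assume "X \<in> carrier (TP k)"
  then obtain f where X: "X = cls k f" and f: "f \<in> length_words k" by (auto simp: carrier_TP)
  have "\<one> \<bullet> f = f" using words_mod_closed[OF f] by (auto simp: fapply intro!: ext)
  then show ?thesis using f by (simp add: X TP_smult)
qed

lemma TP_smult_assoc: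
  "X \<in> carrier (TP k) \<Longrightarrow> c \<in> carrier C \<Longrightarrow> d \<in> carrier C \<Longrightarrow> c \<odot>\<^bsub>TP k\<^esub> (d \<odot>\<^bsub>TP k\<^esub> X) = (c \<otimes> d) \<odot>\<^bsub>TP k\<^esub> X"
proof -
  assume "X \<in> carrier (TP k)" and cd: "c \<in> carrier C" "d \<in> carrier C"
  then obtain f where X: "X = cls k f" and f: "f \<in> length_words k" by (auto simp: carrier_TP)
  have "c \<bullet> (d \<bullet> f) = (c \<otimes> d) \<bullet> f" using words_mod_closed[OF f] cd by (auto simp: fapply R.m_assoc intro!: ext)
  then show ?thesis using f cd by (simp add: X TP_smult)
qed

lemma TP_smult_mult:
  assumes "X \<in> carrier (TP (Suc n))" "Y \<in> carrier (TP (Suc n))" and c: "c \<in> carrier C"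
  shows "(c \<odot>\<^bsub>TP (Suc n)\<^esub> X) \<otimes>\<^bsub>TP (Suc n)\<^esub> Y = c \<odot>\<^bsub>TP (Suc n)\<^esub> (X \<otimes>\<^bsub>TP (Suc n)\<^esub> Y)"
proof -
  obtain f g where *: "X = cls (Suc n) f" "Y = cls (Suc n) g" and fg: "f \<in> length_words (Suc n)" "g \<in> length_words (Suc n)"
    using assms by (auto simp: carrier_TP)
  have "pointwise (c \<bullet> f) g = c \<bullet> pointwise f g"
    by (rule bilinear_extension_scale_left) (use fg c words_mod_all in auto)
  then show ?thesis using fg c by (simp add: * TP_smult TP_mult)
qed

text \<open>The identification with A is multiplicative, so nilpotency in the first tensor power is
  nilpotency in A.\<close>

lemma cls_letter_pow:
  assumes "a \<in> carrier A"
  shows "cls (Suc 0) (gen [a]) [^]\<^bsub>TP (Suc 0)\<^esub> (n::nat) = cls (Suc 0) (gen [a [^]\<^bsub>A\<^esub> n])"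
proof (induction n)
  case 0
  then show ?case by (simp add: TP_one)
next
  case (Suc n)
  show ?case using Suc assms
    by (simp add: TP_mult letter_in) (subst bilinear_extension_gen; simp)
qed

end

section \<open>The shuffle algebras\<close>

context shuffle_module
begin

abbreviation "CSh \<equiv> complete_shuffle_algebra C A lam"
abbreviation "Sh \<equiv> shuffle_algebra C A lam"

lemma CSh_simps:
  "F \<in> carrier CSh \<longleftrightarrow> (\<forall>k. F k \<in> carrier (TP (Suc k)))"
  "\<zero>\<^bsub>CSh\<^esub> = (\<lambda>k. Rel (Suc k))"
  "\<one>\<^bsub>CSh\<^esub> = (\<lambda>k. if k = 0 then cls (Suc 0) (gen [\<one>\<^bsub>A\<^esub>]) else Rel (Suc k))"
  "(F \<otimes>\<^bsub>CSh\<^esub> G) n = (\<Oplus>\<^bsub>TP (Suc n)\<^esub>i\<in>{..n}. \<Oplus>\<^bsub>TP (Suc n)\<^esub>j\<in>{..n}. shuffle_component C A lam n (F i) (G j))"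
  by (simp_all add: complete_shuffle_algebra_def TP_zero pure_tensor_eq_cls if_distrib fun_eq_iff)

lemma Sh_simps:
  "carrier Sh = {F \<in> carrier CSh. finite {k. F k \<noteq> Rel (Suc k)}}"
  "\<zero>\<^bsub>Sh\<^esub> = \<zero>\<^bsub>CSh\<^esub>" "\<one>\<^bsub>Sh\<^esub> = \<one>\<^bsub>CSh\<^esub>" "F \<otimes>\<^bsub>Sh\<^esub> G = F \<otimes>\<^bsub>CSh\<^esub> G"
  by (simp_all add: shuffle_algebra_def TP_zero)

lemma Sh_pow: "F [^]\<^bsub>Sh\<^esub> (n::nat) = F [^]\<^bsub>CSh\<^esub> n"
  by (induction n) (simp_all add: Sh_simps)

text \<open>The direct sum has the operations of the complete algebra on a smaller carrier, so
  nilpotency of an element is the same condition in both.\<close>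

lemma nilradical_Sh: "nilradical Sh = nilradical CSh \<inter> carrier Sh"
  by (auto simp: nilradical_def Sh_pow Sh_simps)

lemma CSh_component: "F \<in> carrier CSh \<Longrightarrow> F k \<in> carrier (TP (Suc k))"
  by (simp add: CSh_simps)

lemma Rel_in_TP [simp]: "Rel k \<in> carrier (TP k)"
  using cls_in_TP[of fzero k] by simp

lemma shuffle_component_closed:
  "X \<in> carrier (TP (Suc i)) \<Longrightarrow> Y \<in> carrier (TP (Suc j)) \<Longrightarrow> shuffle_component C A lam n X Y \<in> carrier (TP (Suc n))"
  by (auto simp: carrier_TP shuffle_component_cls intro!: imageI homog_in_length_words star_nonempty length_words_nonempty)

lemma shuffle_component_zero_left:
  "Y \<in> carrier (TP (Suc j)) \<Longrightarrow> shuffle_component C A lam n (Rel (Suc i)) Y = Rel (Suc n)"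
  using shuffle_component_cls[of fzero i _ j n] by (auto simp: carrier_TP)

lemma shuffle_component_zero_right:
  "X \<in> carrier (TP (Suc i)) \<Longrightarrow> shuffle_component C A lam n X (Rel (Suc j)) = Rel (Suc n)"
  using shuffle_component_cls[of _ i fzero j n] by (auto simp: carrier_TP)

lemma wsh_unit:
  assumes "set v \<subseteq> carrier A" "v \<noteq> []"
  shows "wsh [\<one>\<^bsub>A\<^esub>] v = gen v"
proof -
  obtain y ys where v: "v = y # ys" using assms by (metis list.exhaust)
  show ?thesis using assms by (simp add: v wsh_Cons prefixed_gen)
qed

lemma one_star: "f \<in> nonempty_words \<Longrightarrow> gen [\<one>\<^bsub>A\<^esub>] \<star> f = f"
  unfolding star_def by (rule bilinear_extension_unit[where P = "\<lambda>w. w \<noteq> []"]) (auto intro: wsh_unit)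

lemma shuffle_component_one:
  assumes "X \<in> carrier (TP (Suc j))"
  shows "shuffle_component C A lam n (cls (Suc 0) (gen [\<one>\<^bsub>A\<^esub>])) X = (if n = j then X else Rel (Suc n))"
proof -
  obtain f where X: "X = cls (Suc j) f" and f: "f \<in> length_words (Suc j)" using assms by (auto simp: carrier_TP)
  have "gen [\<one>\<^bsub>A\<^esub>] \<in> length_words (Suc 0)" by (simp add: letter_in)
  then show ?thesis
    using f by (simp add: X shuffle_component_cls one_star length_words_nonempty homog_length_words)
qed

section \<open>Closure, unit and lowest components in the complete algebra\<close>

lemma CSh_mult_closed:
  assumes "F \<in> carrier CSh" "G \<in> carrier CSh"
  shows "F \<otimes>\<^bsub>CSh\<^esub> G \<in> carrier CSh"
proof -
  have "(F \<otimes>\<^bsub>CSh\<^esub> G) n \<in> carrier (TP (Suc n))" for n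
  proof -
    interpret T: abelian_group "TP (Suc n)" by (rule TP_abelian_group)
    show ?thesis unfolding CSh_simps
      by (intro T.finsum_closed) (use assms in \<open>auto intro!: T.finsum_closed intro: shuffle_component_closed CSh_component\<close>)
  qed
  then show ?thesis by (simp only: CSh_simps(1) simp_thms)
qed

lemma CSh_one_closed: "\<one>\<^bsub>CSh\<^esub> \<in> carrier CSh"
  unfolding CSh_simps by (auto intro!: cls_in_TP gen_in_words_mod)

lemma CSh_one_neq_zero:
  assumes "\<one>\<^bsub>A\<^esub> \<noteq> \<zero>\<^bsub>A\<^esub>"
  shows "\<one>\<^bsub>CSh\<^esub> \<noteq> \<zero>\<^bsub>CSh\<^esub>"
proof
  assume "\<one>\<^bsub>CSh\<^esub> = \<zero>\<^bsub>CSh\<^esub>"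
  then have "\<one>\<^bsub>CSh\<^esub> 0 = \<zero>\<^bsub>CSh\<^esub> 0" by simp
  then show False using assms cls_letter_eq_zero_iff[of "\<one>\<^bsub>A\<^esub>"] by (simp add: CSh_simps)
qed

lemma CSh_zero_closed: "\<zero>\<^bsub>CSh\<^esub> \<in> carrier CSh"
  unfolding CSh_simps by auto

text \<open>Powers start from the unit and multiply on the right, so a first power is the unit times
  \<open>F\<close>; this law evaluates it.\<close>

lemma CSh_one_mult:
  assumes F: "F \<in> carrier CSh"
  shows "\<one>\<^bsub>CSh\<^esub> \<otimes>\<^bsub>CSh\<^esub> F = F"
proof (rule ext)
  fix n
  let ?s = "\<lambda>i j. shuffle_component C A lam n (\<one>\<^bsub>CSh\<^esub> i) (F j)"
  \<comment> \<open>The unit lives in degree 0 and multiplication by it keeps degrees, so only the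
    pair \<open>(0, n)\<close> contributes.\<close>
  have s: "?s i j = (if i = 0 \<and> j = n then F n else Rel (Suc n))" for i j
    by (simp add: CSh_simps(3) shuffle_component_one[OF CSh_component[OF F]] shuffle_component_zero_left[OF CSh_component[OF F]])
  have "(\<Oplus>\<^bsub>TP (Suc n)\<^esub>j\<in>{..n}. ?s i j) = (if i = 0 then F n else Rel (Suc n))" for i
  proof (cases "i = 0")
    case True
    then show ?thesis
      using TP_finsum_single[of "{..n}" n "?s i" "Suc n"] CSh_component[OF F] by (simp add: s TP_zero)
  next
    case False
    then show ?thesis
      using TP_finsum_zero[of "{..n}" "?s i" "Suc n"] by (simp add: s TP_zero)
  qed
  then show "(\<one>\<^bsub>CSh\<^esub> \<otimes>\<^bsub>CSh\<^esub> F) n = F n"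
    using TP_finsum_single[of "{..n}" 0 "\<lambda>i. if i = 0 then F n else Rel (Suc n)" "Suc n"] CSh_component[OF F]
    by (simp add: CSh_simps(4) TP_zero)
qed

text \<open>The product formula for degree \<open>n\<close> involves indices up to \<open>n\<close>,
  and those below \<open>n\<close> carry zero components. What remains is the pair
  \<open>(n, n)\<close>.\<close>

lemma CSh_mult_lowest:
  assumes F: "F \<in> carrier CSh" and G: "G \<in> carrier CSh"
    and low: "\<And>i. i < n \<Longrightarrow> F i = Rel (Suc i)" "\<And>i. i < n \<Longrightarrow> G i = Rel (Suc i)"
  shows "i < n \<Longrightarrow> (F \<otimes>\<^bsub>CSh\<^esub> G) i = Rel (Suc i)"
    and "(F \<otimes>\<^bsub>CSh\<^esub> G) n = (lam [^] n) \<odot>\<^bsub>TP (Suc n)\<^esub> (F n \<otimes>\<^bsub>TP (Suc n)\<^esub> G n)"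
proof -
  let ?s = "\<lambda>m i j. shuffle_component C A lam m (F i) (G j)"
  have s: "?s m i j = Rel (Suc m)" if "i < n \<or> j < n" for m i j
    using that
  proof
    assume "i < n"
    show ?thesis unfolding low(1)[OF \<open>i < n\<close>] by (rule shuffle_component_zero_left[OF CSh_component[OF G]])
  next
    assume "j < n"
    show ?thesis unfolding low(2)[OF \<open>j < n\<close>] by (rule shuffle_component_zero_right[OF CSh_component[OF F]])
  qed
  show "(F \<otimes>\<^bsub>CSh\<^esub> G) i = Rel (Suc i)" if "i < n" for i
    unfolding CSh_simps TP_zero[symmetric] using that
    by (intro TP_finsum_zero) (auto simp: s TP_zero)
  let ?v = "?s n n n"
  have v: "?v \<in> carrier (TP (Suc n))"
    using CSh_component[OF F] CSh_component[OF G] shuffle_component_closed by blast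
  have "(\<Oplus>\<^bsub>TP (Suc n)\<^esub>j\<in>{..n}. ?s n i j) = (if i = n then ?v else Rel (Suc n))" if "i \<le> n" for i
  proof (cases "i = n")
    case True
    then show ?thesis
      using TP_finsum_single[of "{..n}" n "?s n i" "Suc n"] v by (simp add: s TP_zero)
  next
    case False
    then show ?thesis
      using TP_finsum_zero[of "{..n}" "?s n i" "Suc n"] that by (simp add: s TP_zero)
  qed
  moreover have "(\<Oplus>\<^bsub>TP (Suc n)\<^esub>i\<in>{..n}. \<Oplus>\<^bsub>TP (Suc n)\<^esub>j\<in>{..n}. ?s n i j) = (\<Oplus>\<^bsub>TP (Suc n)\<^esub>j\<in>{..n}. ?s n n j)"
    by (rule TP_finsum_single) (use calculation v in \<open>auto simp: TP_zero\<close>)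
  ultimately have "(F \<otimes>\<^bsub>CSh\<^esub> G) n = ?v" by (simp add: CSh_simps(4))
  then show "(F \<otimes>\<^bsub>CSh\<^esub> G) n = (lam [^] n) \<odot>\<^bsub>TP (Suc n)\<^esub> (F n \<otimes>\<^bsub>TP (Suc n)\<^esub> G n)"
    using CSh_component[OF F] CSh_component[OF G] by (simp add: shuffle_component_diagonal)
qed

lemma CSh_pow_closed: "F \<in> carrier CSh \<Longrightarrow> F [^]\<^bsub>CSh\<^esub> (k::nat) \<in> carrier CSh"
  by (induction k) (auto simp: CSh_one_closed CSh_mult_closed)

lemma TP_pow_closed: "X \<in> carrier (TP (Suc n)) \<Longrightarrow> X [^]\<^bsub>TP (Suc n)\<^esub> (k::nat) \<in> carrier (TP (Suc n))"
  by (induction k) (auto simp: TP_one TP_mult_closed intro!: cls_in_TP gen_in_words_mod)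

text \<open>Stated for \<open>Suc k\<close> because the unit, as the power 0, need not vanish below
  degree \<open>n\<close>. Each of the \<open>k\<close> multiplications after the first power
  contributes \<open>lam [^] n\<close>, one factor for each letter behind the head.\<close>

lemma CSh_pow_lowest:
  assumes F: "F \<in> carrier CSh" and low: "\<And>i. i < n \<Longrightarrow> F i = Rel (Suc i)"
  shows "(\<forall>i<n. (F [^]\<^bsub>CSh\<^esub> Suc k) i = Rel (Suc i)) \<and>
    (F [^]\<^bsub>CSh\<^esub> Suc k) n = (lam [^] (n * k)) \<odot>\<^bsub>TP (Suc n)\<^esub> (F n [^]\<^bsub>TP (Suc n)\<^esub> Suc k)"
proof (induction k)
  case 0
  then show ?case using F low CSh_component[OF F, of n] by (simp add: CSh_one_mult TP_one_mult TP_smult_one)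
next
  case (Suc k)
  let ?G = "F [^]\<^bsub>CSh\<^esub> Suc k" and ?X = "F n" and ?T = "TP (Suc n)"
  have G: "?G \<in> carrier CSh" by (rule CSh_pow_closed[OF F])
  have X: "?X \<in> carrier ?T" by (rule CSh_component[OF F])
  have P: "?X [^]\<^bsub>?T\<^esub> Suc k \<in> carrier ?T" by (rule TP_pow_closed[OF X])
  have low': "i < n \<Longrightarrow> ?G i = Rel (Suc i)" for i using Suc by blast
  have step: "F [^]\<^bsub>CSh\<^esub> Suc (Suc k) = ?G \<otimes>\<^bsub>CSh\<^esub> F" by simp
  have "(?G \<otimes>\<^bsub>CSh\<^esub> F) n = (lam [^] n) \<odot>\<^bsub>?T\<^esub> (?G n \<otimes>\<^bsub>?T\<^esub> ?X)"
    by (rule CSh_mult_lowest(2)[OF G F low' low])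
  also have "?G n = (lam [^] (n * k)) \<odot>\<^bsub>?T\<^esub> (?X [^]\<^bsub>?T\<^esub> Suc k)" using Suc by blast
  also have "(lam [^] n) \<odot>\<^bsub>?T\<^esub> (((lam [^] (n * k)) \<odot>\<^bsub>?T\<^esub> (?X [^]\<^bsub>?T\<^esub> Suc k)) \<otimes>\<^bsub>?T\<^esub> ?X) =
      (lam [^] n \<otimes> lam [^] (n * k)) \<odot>\<^bsub>?T\<^esub> (?X [^]\<^bsub>?T\<^esub> Suc k \<otimes>\<^bsub>?T\<^esub> ?X)"
    using P X by (subst TP_smult_mult) (simp_all only: R.nat_pow_closed lam_closed TP_smult_assoc TP_mult_closed)
  also have "lam [^] n \<otimes> lam [^] (n * k) = lam [^] (n * Suc k)"
    by (simp add: R.nat_pow_mult)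
  finally show ?case
    unfolding step using CSh_mult_lowest(1)[OF G F low' low] by simp
qed

text \<open>In degree 0 the weight factor of \<open>CSh_pow_lowest\<close> is 1, so in every weight
  the degree-zero component of a power is the power of that component.\<close>

lemma nilradical_CSh_degree_zero:
  assumes one: "\<one>\<^bsub>A\<^esub> \<noteq> \<zero>\<^bsub>A\<^esub>" and F: "F \<in> nilradical CSh"
  shows "F 0 \<in> (\<lambda>a. pure_tensor C A [a]) ` nilradical A"
proof -
  have Fc: "F \<in> carrier CSh" using F by (simp add: nilradical_def)
  obtain m :: nat where m: "F [^]\<^bsub>CSh\<^esub> m = \<zero>\<^bsub>CSh\<^esub>" using F by (auto simp: nilradical_def)
  obtain a where a: "a \<in> carrier A" "F 0 = cls (Suc 0) (gen [a])"
    using TP_one_elements[OF CSh_component[OF Fc]] by blast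
  \<comment> \<open>Exponent 0 would make the unit zero.\<close>
  have "m \<noteq> 0"
    using m CSh_one_neq_zero[OF one] by (intro notI) simp
  then obtain k where k: "m = Suc k" by (cases m) auto
  have "Rel (Suc 0) = F 0 [^]\<^bsub>TP (Suc 0)\<^esub> Suc k"
    using CSh_pow_lowest[OF Fc, of 0 k] TP_smult_one[OF TP_pow_closed[OF CSh_component[OF Fc, of 0], of "Suc k"]] m
    by (simp only: k CSh_simps mult_0 R.nat_pow_0)
  also have "\<dots> = cls (Suc 0) (gen [a [^]\<^bsub>A\<^esub> Suc k])"
    unfolding a(2) by (rule cls_letter_pow[OF a(1)])
  finally have "a [^]\<^bsub>A\<^esub> Suc k = \<zero>\<^bsub>A\<^esub>"
    using cls_letter_eq_zero_iff[of "a [^]\<^bsub>A\<^esub> Suc k"] a(1) nat_pow_closed[OF a(1), of "Suc k"] by blast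
  then have "a \<in> nilradical A" using a(1) by (auto simp: nilradical_def intro: exI[of _ "Suc k"])
  then show ?thesis using a(2) by (auto simp: pure_tensor_eq_cls)
qed

lemma zero_in_nilradical_CSh: "\<zero>\<^bsub>CSh\<^esub> \<in> nilradical CSh"
  using CSh_one_mult[OF CSh_zero_closed] CSh_zero_closed
  by (auto simp: nilradical_def intro!: exI[of _ "Suc 0"])

lemma zero_in_Sh: "\<zero>\<^bsub>CSh\<^esub> \<in> carrier Sh"
  using CSh_zero_closed by (simp add: Sh_simps CSh_simps(2))

lemma reduced_shuffle_algebras:
  assumes one: "\<one>\<^bsub>A\<^esub> \<noteq> \<zero>\<^bsub>A\<^esub>"
    and hyp: "\<forall>k\<ge>1. trivial_annihilator_in lam (TP k) \<and> reduced (TP k)"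
  shows "reduced CSh" "reduced Sh"
proof -
  have "F = \<zero>\<^bsub>CSh\<^esub>" if F: "F \<in> nilradical CSh" for F
  proof (rule ccontr)
    assume "F \<noteq> \<zero>\<^bsub>CSh\<^esub>"
    then have ex: "\<exists>n. F n \<noteq> Rel (Suc n)" by (auto simp: CSh_simps)
    define n where "n = (LEAST n. F n \<noteq> Rel (Suc n))"
    have n: "F n \<noteq> Rel (Suc n)" unfolding n_def using LeastI_ex[OF ex] .
    have low: "F i = Rel (Suc i)" if "i < n" for i using not_less_Least that unfolding n_def by blast
    let ?T = "TP (Suc n)"
    have Fc: "F \<in> carrier CSh" using F by (simp add: nilradical_def)
    have X: "F n \<in> carrier ?T" by (rule CSh_component[OF Fc])
    obtain m :: nat where m: "F [^]\<^bsub>CSh\<^esub> m = \<zero>\<^bsub>CSh\<^esub>" using F by (auto simp: nilradical_def)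
    have "m \<noteq> 0"
      using m CSh_one_neq_zero[OF one] by (intro notI) simp
    then obtain k where k: "m = Suc k" by (cases m) auto
    \<comment> \<open>The hypothesis cancels a single \<open>lam\<close>, hence the induction on the
      exponent.\<close>
    have ann: "Y = Rel (Suc n)" if "Y \<in> carrier ?T" "(lam [^] (j::nat)) \<odot>\<^bsub>?T\<^esub> Y = Rel (Suc n)" for j Y
      using that
    proof (induction j arbitrary: Y)
      case 0
      then show ?case by (simp add: TP_smult_one)
    next
      case (Suc j)
      have "(lam [^] j) \<odot>\<^bsub>?T\<^esub> (lam \<odot>\<^bsub>?T\<^esub> Y) = Rel (Suc n)"
        using Suc by (simp add: TP_smult_assoc)
      then have "lam \<odot>\<^bsub>?T\<^esub> Y = Rel (Suc n)" using Suc by (simp add: TP_smult_closed)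
      then show ?case using hyp Suc by (auto simp: trivial_annihilator_in_def TP_zero)
    qed
    have "(lam [^] (n * k)) \<odot>\<^bsub>?T\<^esub> (F n [^]\<^bsub>?T\<^esub> Suc k) = \<zero>\<^bsub>CSh\<^esub> n"
      using CSh_pow_lowest[OF Fc low, of n k] by (simp only: m[unfolded k])
    then have "F n [^]\<^bsub>?T\<^esub> Suc k = Rel (Suc n)"
      unfolding CSh_simps(2) by (rule ann[OF TP_pow_closed[OF X]])
    then have "\<exists>j::nat. F n [^]\<^bsub>?T\<^esub> j = \<zero>\<^bsub>?T\<^esub>"
      unfolding TP_zero by (rule exI)
    then have "F n \<in> nilradical ?T" unfolding nilradical_def using X by blast
    moreover have "reduced ?T" using hyp by simp
    ultimately show False using n by (simp add: reduced_def TP_zero)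
  qed
  then have nil: "nilradical CSh = {\<zero>\<^bsub>CSh\<^esub>}" using zero_in_nilradical_CSh by blast
  then show "reduced CSh" unfolding reduced_def .
  show "reduced Sh" unfolding reduced_def nilradical_Sh nil Sh_simps(2) using zero_in_Sh by blast
qed

section \<open>Representatives on words\<close>

definition low :: "nat \<Rightarrow> ('a list \<Rightarrow> 'c) \<Rightarrow> 'a list \<Rightarrow> 'c"
  where "low n f = (\<lambda>w. if length w \<le> n then f w else \<zero>)"

lemma words_mod_restrict:
  assumes "f \<in> words_mod P" "\<And>w. h w = f w \<or> h w = \<zero>" "\<And>w. h w \<noteq> \<zero> \<Longrightarrow> P w \<Longrightarrow> Q w"
  shows "h \<in> words_mod Q"
proof (rule words_modI)
  have nz: "f w \<noteq> \<zero>" "h w = f w" if "h w \<noteq> \<zero>" for w using assms(2)[of w] that by auto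
  show "finite (word_supp C h)"
    by (rule finite_subset[OF _ words_mod_finite[OF assms(1)]]) (use nz in \<open>auto simp: word_supp_def\<close>)
  show "h w \<in> carrier C" for w
    using assms(2)[of w] words_mod_closed[OF assms(1), of w] by auto
  show "set w \<subseteq> carrier A" "Q w" if "h w \<noteq> \<zero>" for w
    using nz[OF that] that assms(3)[OF that] words_mod_set[OF assms(1)] words_mod_pred[OF assms(1)] by auto
qed

lemma low_in_words_mod: "f \<in> words_mod P \<Longrightarrow> low n f \<in> words_mod P"
  by (erule words_mod_restrict) (auto simp: low_def)

text \<open>A product word is at least as long as each factor, so words longer than \<open>n\<close>
  cannot contribute. This matches the cut-off of the indices in the product formula of the complete
  algebra.\<close>

lemma homog_star_low:
  assumes f: "f \<in> nonempty_words" and g: "g \<in> nonempty_words"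
  shows "homog n (f \<star> g) = homog n (low n f \<star> low n g)"
proof -
  let ?t = "\<lambda>f w. if length w \<le> n then \<zero> else f w"
  let ?P = "\<lambda>w. w \<noteq> [] \<and> n < length w"
  have split: "f = low n f \<boxplus> ?t f" if "f \<in> nonempty_words" for f
    using words_mod_closed[OF that] by (auto simp: low_def fapply intro!: ext)
  have t: "?t f \<in> words_mod ?P" if "f \<in> nonempty_words" for f
    by (rule words_mod_restrict[OF that]) (auto split: if_splits)
  have tn: "?t f \<in> nonempty_words" if "f \<in> nonempty_words" for f
    by (rule words_mod_mono[OF t[OF that]]) auto
  have ln: "low n f \<in> nonempty_words" if "f \<in> nonempty_words" for f
    by (rule low_in_words_mod[OF that])
  have z1: "homog n (?t f \<star> h) = fzero" if "h \<in> nonempty_words" for h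
    by (rule homog_eq_fzero[OF star_in_words_mod[OF t[OF f] that]]) auto
  have z2: "homog n (h \<star> ?t g) = fzero" if "h \<in> nonempty_words" for h
    by (rule homog_eq_fzero[OF star_in_words_mod[OF that t[OF g]]]) auto
  have "f \<star> g = (low n f \<boxplus> ?t f) \<star> g" using split[OF f] by simp
  also have "\<dots> = low n f \<star> g \<boxplus> ?t f \<star> g"
    using ln[OF f] tn[OF f] g by (intro star_fadd_left words_mod_all)
  also have "low n f \<star> g = low n f \<star> (low n g \<boxplus> ?t g)" using split[OF g] by simp
  also have "\<dots> = low n f \<star> low n g \<boxplus> low n f \<star> ?t g"
    using ln[OF f] ln[OF g] tn[OF g] by (intro star_fadd_right words_mod_all)
  finally have "homog n (f \<star> g) = homog n (low n f \<star> low n g) \<boxplus> fzero \<boxplus> fzero"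
    using z1[OF g] z2[OF ln[OF f]] star_nonempty[OF ln[OF f] ln[OF g]] star_nonempty[OF ln[OF f] tn[OF g]] star_nonempty[OF tn[OF f] g]
    by (simp add: homog_fadd_nonempty)
  also have "\<dots> = homog n (low n f \<star> low n g)"
    using words_mod_closed[OF homog_in_length_words[OF star_nonempty[OF ln[OF f] ln[OF g]]]]
    by (auto simp: fapply intro!: ext)
  finally show ?thesis .
qed

text \<open>Component \<open>i\<close> consists of words of length \<open>i + 1\<close>, so indices
  up to \<open>n\<close> cover the lengths 1 to \<open>n + 1\<close>; length 0 does not occur in
  \<open>f\<close>.\<close>

lemma fsum_homog:
  assumes f: "f \<in> nonempty_words"
  shows "fsum (\<lambda>i. homog (Suc i) f) {..n} = low (Suc n) f"
proof (rule ext)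
  fix w
  note [simp] = words_mod_closed[OF f]
  show "fsum (\<lambda>i. homog (Suc i) f) {..n} w = low (Suc n) f w"
  proof (cases w)
    case Nil
    then have "f w = \<zero>" using words_mod_pred[OF f, of w] by auto
    then show ?thesis using Nil by (simp add: fsum_def homog_def low_def)
  next
    case (Cons x v)
    have "fsum (\<lambda>i. homog (Suc i) f) {..n} w = (\<Oplus>i\<in>{..n}. if length v = i then f (x # v) else \<zero>)"
      by (simp add: fsum_def homog_def Cons)
    also have "\<dots> = low (Suc n) f w"
    proof (cases "length v \<le> n")
      case True
      then show ?thesis using R.finsum_singleton[of "length v" "{..n}" "\<lambda>_. f (x # v)"] by (simp add: low_def Cons)
    next
      case False
      have "(\<Oplus>i\<in>{..n}. if length v = i then f (x # v) else \<zero>) = (\<Oplus>i\<in>{..n}. \<zero>)"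
        by (rule R.finsum_cong') (use False in auto)
      then show ?thesis using False by (simp add: low_def Cons)
    qed
    finally show ?thesis .
  qed
qed

lemma star_fsum_right:
  assumes "finite J" and f: "f \<in> nonempty_words" and h: "\<And>j. h j \<in> nonempty_words"
  shows "fsum (\<lambda>j. f \<star> h j) J = f \<star> fsum h J"
  using assms(1)
proof induction
  case (insert j J)
  have "fsum (\<lambda>j. f \<star> h j) (insert j J) = f \<star> h j \<boxplus> fsum (\<lambda>j. f \<star> h j) J"
    by (rule fsum_insert[OF insert(1,2)]) (rule star_nonempty[OF f h])
  also have "\<dots> = f \<star> (h j \<boxplus> fsum h J)"
    unfolding insert.IH using f h fsum_in_words_mod[OF insert(1), of h "\<lambda>w. w \<noteq> []"]
    by (intro star_fadd_right[symmetric]) (auto intro: words_mod_all)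
  also have "h j \<boxplus> fsum h J = fsum h (insert j J)"
    by (rule fsum_insert[OF insert(1,2), symmetric]) (rule h)
  finally show ?case .
qed simp

lemma star_fsum_left:
  assumes "finite I" and g: "g \<in> nonempty_words" and h: "\<And>i. h i \<in> nonempty_words"
  shows "fsum (\<lambda>i. h i \<star> g) I = fsum h I \<star> g"
  using star_fsum_right[OF assms] star_comm[OF h g] star_comm[OF g fsum_in_words_mod[OF assms(1) h]] by simp

lemma homog_fsum:
  assumes "finite I" "\<And>i. h i \<in> nonempty_words"
  shows "fsum (\<lambda>i. homog n (h i)) I = homog n (fsum h I)"
  using assms(1)
proof induction
  case (insert i I)
  have "fsum (\<lambda>i. homog n (h i)) (insert i I) = homog n (h i) \<boxplus> fsum (\<lambda>i. homog n (h i)) I"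
    by (rule fsum_insert[OF insert(1,2)]) (rule homog_in_length_words[OF assms(2)])
  also have "\<dots> = homog n (h i \<boxplus> fsum h I)"
    unfolding insert.IH using assms(2) insert(1) by (intro homog_fadd_nonempty[symmetric]) auto
  also have "h i \<boxplus> fsum h I = fsum h (insert i I)"
    by (rule fsum_insert[OF insert(1,2), symmetric]) (rule assms(2))
  finally show ?case .
qed simp

text \<open>The passage from functions on words to the shuffle algebra. It is multiplicative and
  onto \<open>Sh\<close>, so identities between functions become identities between elements of
  \<open>Sh\<close>.\<close>

definition shuffle_class :: "('a list \<Rightarrow> 'c) \<Rightarrow> nat \<Rightarrow> ('a list \<Rightarrow> 'c) set"
  where "shuffle_class f = (\<lambda>k. cls (Suc k) (homog (Suc k) f))"

lemma shuffle_class_closed: "f \<in> nonempty_words \<Longrightarrow> shuffle_class f \<in> carrier Sh"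
proof -
  assume f: "f \<in> nonempty_words"
  have "{k. shuffle_class f k \<noteq> Rel (Suc k)} \<subseteq> (\<lambda>w. length w - 1) ` word_supp C f"
  proof
    fix k assume "k \<in> {k. shuffle_class f k \<noteq> Rel (Suc k)}"
    then have "homog (Suc k) f \<noteq> fzero" by (auto simp: shuffle_class_def)
    then obtain w where "homog (Suc k) f w \<noteq> \<zero>" by (auto simp: fzero_def fun_eq_iff)
    then have "f w \<noteq> \<zero>" "length w = Suc k" by (auto simp: homog_def split: if_splits)
    then show "k \<in> (\<lambda>w. length w - 1) ` word_supp C f" by (intro image_eqI[of _ _ w]) (auto simp: word_supp_def)
  qed
  then have "finite {k. shuffle_class f k \<noteq> Rel (Suc k)}"
    using finite_subset words_mod_finite[OF f] by blast
  moreover have "shuffle_class f \<in> carrier CSh"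
    unfolding CSh_simps shuffle_class_def using f by auto
  ultimately show ?thesis by (simp add: Sh_simps)
qed

lemma shuffle_class_CSh: "f \<in> nonempty_words \<Longrightarrow> shuffle_class f \<in> carrier CSh"
  using shuffle_class_closed by (simp add: Sh_simps)

text \<open>By bilinearity the double sum over components is the product of the truncated functions,
  and by \<open>homog_star_low\<close> the truncation does not affect the component.\<close>

lemma shuffle_class_mult:
  assumes f: "f \<in> nonempty_words" and g: "g \<in> nonempty_words"
  shows "shuffle_class (f \<star> g) = shuffle_class f \<otimes>\<^bsub>CSh\<^esub> shuffle_class g"
proof (rule ext)
  fix n
  let ?f = "\<lambda>i. homog (Suc i) f" and ?g = "\<lambda>i. homog (Suc i) g"
  have fl: "?f i \<in> length_words (Suc i)" and gl: "?g i \<in> length_words (Suc i)" for i using f g by auto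
  have fn: "?f i \<in> nonempty_words" and gn: "?g i \<in> nonempty_words" for i
    using fl gl length_words_nonempty by blast+
  have inner: "(\<Oplus>\<^bsub>TP (Suc n)\<^esub>j\<in>{..n}. shuffle_component C A lam n (shuffle_class f i) (shuffle_class g j))
      = cls (Suc n) (homog (Suc n) (?f i \<star> low (Suc n) g))" for i
  proof -
    have "(\<Oplus>\<^bsub>TP (Suc n)\<^esub>j\<in>{..n}. shuffle_component C A lam n (shuffle_class f i) (shuffle_class g j))
       = (\<Oplus>\<^bsub>TP (Suc n)\<^esub>j\<in>{..n}. cls (Suc n) (homog (Suc n) (?f i \<star> ?g j)))"
      by (simp add: shuffle_class_def shuffle_component_cls[OF fl gl])
    also have "\<dots> = cls (Suc n) (fsum (\<lambda>j. homog (Suc n) (?f i \<star> ?g j)) {..n})"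
      by (rule TP_finsum) (auto intro: homog_in_length_words star_nonempty fn gn)
    also have "fsum (\<lambda>j. homog (Suc n) (?f i \<star> ?g j)) {..n} = homog (Suc n) (?f i \<star> fsum ?g {..n})"
      using star_nonempty[OF fn gn] by (simp add: homog_fsum star_fsum_right[OF _ fn gn])
    finally show ?thesis by (simp add: fsum_homog[OF g])
  qed
  have lg: "low (Suc n) g \<in> nonempty_words" by (rule low_in_words_mod[OF g])
  have "(shuffle_class f \<otimes>\<^bsub>CSh\<^esub> shuffle_class g) n = (\<Oplus>\<^bsub>TP (Suc n)\<^esub>i\<in>{..n}. cls (Suc n) (homog (Suc n) (?f i \<star> low (Suc n) g)))"
    unfolding CSh_simps(4) inner ..
  also have "\<dots> = cls (Suc n) (fsum (\<lambda>i. homog (Suc n) (?f i \<star> low (Suc n) g)) {..n})"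
    by (rule TP_finsum) (auto intro: homog_in_length_words star_nonempty fn lg)
  also have "fsum (\<lambda>i. homog (Suc n) (?f i \<star> low (Suc n) g)) {..n} = homog (Suc n) (fsum ?f {..n} \<star> low (Suc n) g)"
    using star_nonempty[OF fn lg] by (simp add: homog_fsum star_fsum_left[OF _ lg fn])
  also have "\<dots> = homog (Suc n) (f \<star> g)"
    unfolding fsum_homog[OF f] by (rule homog_star_low[OF f g, symmetric])
  finally show "shuffle_class (f \<star> g) n = (shuffle_class f \<otimes>\<^bsub>CSh\<^esub> shuffle_class g) n"
    by (simp add: shuffle_class_def)
qed

lemma gen_one_nonempty [simp]: "gen [\<one>\<^bsub>A\<^esub>] \<in> nonempty_words"
  by (intro gen_in_words_mod) auto

lemma shuffle_class_one: "shuffle_class (gen [\<one>\<^bsub>A\<^esub>]) = \<one>\<^bsub>CSh\<^esub>"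
proof -
  have "gen [\<one>\<^bsub>A\<^esub>] \<in> length_words (Suc 0)" by (simp add: letter_in)
  then show ?thesis by (auto simp: shuffle_class_def CSh_simps(3) homog_length_words intro!: ext)
qed

lemma shuffle_class_fzero: "shuffle_class fzero = \<zero>\<^bsub>CSh\<^esub>"
  by (simp add: shuffle_class_def CSh_simps(2))

text \<open>The degree-zero representative is prescribed: when it is a single letter, the
  degree-zero part of a power is known exactly as a function.\<close>

lemma shuffle_class_surj:
  assumes F: "F \<in> carrier Sh" and g: "g \<in> length_words (Suc 0)" "F 0 = cls (Suc 0) g"
  obtains f where "f \<in> nonempty_words" "shuffle_class f = F" "homog (Suc 0) f = g"
proof -
  have Fc: "F \<in> carrier CSh" and fin: "finite {k. F k \<noteq> Rel (Suc k)}" using F by (auto simp only: Sh_simps)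
  \<comment> \<open>Zero components in positive degree are represented by the zero function, which
    keeps the support of the assembled function finite.\<close>
  have "\<exists>r. r \<in> length_words (Suc k) \<and> F k = cls (Suc k) r \<and> (k = 0 \<longrightarrow> r = g) \<and> (k \<noteq> 0 \<and> F k = Rel (Suc k) \<longrightarrow> r = fzero)" for k
  proof -
    obtain r where "r \<in> length_words (Suc k)" "F k = cls (Suc k) r"
      using CSh_component[OF Fc, of k] by (auto simp: carrier_TP)
    then show ?thesis using g cls_fzero[of "Suc k"] by (cases "k = 0"; cases "F k = Rel (Suc k)") (auto simp only: intro: exI[of _ fzero] fzero_in_words_mod)
  qed
  then obtain r where r: "\<And>k. r k \<in> length_words (Suc k)" "\<And>k. F k = cls (Suc k) (r k)" "r 0 = g"
      "\<And>k. k \<noteq> 0 \<Longrightarrow> F k = Rel (Suc k) \<Longrightarrow> r k = fzero"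
    by metis
  define f where "f w = (if w = [] then \<zero> else r (length w - 1) w)" for w
  \<comment> \<open>\<open>g\<close> may be a nonzero function even if its class is zero, so index 0
    is always included.\<close>
  let ?K = "insert 0 {k. F k \<noteq> Rel (Suc k)}"
  have "f \<in> nonempty_words"
  proof (rule words_modI)
    show "f w \<in> carrier C" for w using words_mod_closed[OF r(1)] by (simp add: f_def)
    have "word_supp C f \<subseteq> (\<Union>k\<in>?K. word_supp C (r k))"
    proof
      fix w assume "w \<in> word_supp C f"
      then have w: "r (length w - 1) w \<noteq> \<zero>" by (auto simp: word_supp_def f_def split: if_splits)
      then have "length w - 1 \<in> ?K" using r(4)[of "length w - 1"] by (auto simp: fapply)
      then show "w \<in> (\<Union>k\<in>?K. word_supp C (r k))" using w by (auto simp: word_supp_def)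
    qed
    then show "finite (word_supp C f)"
      by (rule finite_subset) (use fin words_mod_finite[OF r(1)] in auto)
    show "set w \<subseteq> carrier A" "w \<noteq> []" if "f w \<noteq> \<zero>" for w
      using that words_mod_set[OF r(1)] by (auto simp: f_def split: if_splits)
  qed
  moreover have h: "homog (Suc k) f = r k" for k
  proof (rule ext)
    show "homog (Suc k) f w = r k w" for w
      using words_mod_pred[OF r(1), of k w] by (cases "r k w = \<zero>") (auto simp: homog_def f_def)
  qed
  moreover have "shuffle_class f = F" by (rule ext) (simp add: shuffle_class_def h r(2))
  ultimately show ?thesis using that[of f] r(3) by simp
qed

text \<open>Nested to the left like \<open>[^]\<close>, so that \<open>shuffle_class\<close> carries
  one to the other by multiplicativity alone.\<close>

primrec star_pow :: "('a list \<Rightarrow> 'c) \<Rightarrow> nat \<Rightarrow> 'a list \<Rightarrow> 'c" where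
  "star_pow f 0 = gen [\<one>\<^bsub>A\<^esub>]"
| "star_pow f (Suc k) = star_pow f k \<star> f"

lemma star_pow_nonempty [simp]: "f \<in> nonempty_words \<Longrightarrow> star_pow f k \<in> nonempty_words"
  by (induction k) (auto intro: star_nonempty)

lemma shuffle_class_pow: "f \<in> nonempty_words \<Longrightarrow> shuffle_class (star_pow f k) = shuffle_class f [^]\<^bsub>CSh\<^esub> k"
  by (induction k) (simp_all add: shuffle_class_one shuffle_class_mult)

lemma low_one: "f \<in> nonempty_words \<Longrightarrow> low (Suc 0) f = homog (Suc 0) f"
  using words_mod_pred[of f "\<lambda>w. w \<noteq> []" "[]"]
  by (cases "f [] = \<zero>") (auto simp: low_def homog_def le_Suc_eq intro!: ext)

text \<open>Only one-letter words contribute to the one-letter part of a product, so this is an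
  exact equality and not merely one up to relations.\<close>

lemma homog_star_pow:
  assumes f: "f \<in> nonempty_words" and a: "a \<in> carrier A" "homog (Suc 0) f = gen [a]"
  shows "homog (Suc 0) (star_pow f k) = gen [a [^]\<^bsub>A\<^esub> k]"
proof (induction k)
  case 0
  have "gen [\<one>\<^bsub>A\<^esub>] \<in> length_words (Suc 0)" by (simp add: letter_in)
  then show ?case by (simp add: homog_length_words)
next
  case (Suc k)
  have ak: "a [^]\<^bsub>A\<^esub> k \<in> carrier A" using a by simp
  have "homog (Suc 0) (star_pow f (Suc k)) = homog (Suc 0) (gen [a [^]\<^bsub>A\<^esub> k] \<star> gen [a])"
    using homog_star_low[OF star_pow_nonempty[OF f] f, of "Suc 0" k] f by (simp add: low_one Suc a(2))
  also have "gen [a [^]\<^bsub>A\<^esub> k] \<star> gen [a] = gen [a [^]\<^bsub>A\<^esub> k \<otimes>\<^bsub>A\<^esub> a]"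
    using ak a(1) by (simp add: star_gen wsh_Cons prefixed_gen)
  also have "homog (Suc 0) \<dots> = \<dots>"
  proof -
    have "gen [a [^]\<^bsub>A\<^esub> k \<otimes>\<^bsub>A\<^esub> a] \<in> length_words (Suc 0)" using ak a(1) by (intro gen_in_words_mod) auto
    then show ?thesis by (simp add: homog_length_words)
  qed
  finally show ?case by simp
qed

section \<open>Zero divisors\<close>

abbreviation ones :: "nat \<Rightarrow> 'a list" where "ones n \<equiv> replicate n \<one>\<^bsub>A\<^esub>"

lemma set_ones [simp]: "set (ones n) \<subseteq> carrier A"
  by auto

text \<open>The extra 1 can be inserted at \<open>n + 1\<close> places or merged with one of
  \<open>n\<close> letters, and all results of equal length coincide.\<close>

lemma qsh_one_ones:
  "qsh [\<one>\<^bsub>A\<^esub>] (ones n) =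
     ([Suc n] \<cdot> \<one>) \<bullet> gen (ones (Suc n)) \<boxplus> ([n] \<cdot> \<one> \<otimes> lam) \<bullet> gen (ones n)"
proof (induction n)
  case 0
  then show ?case by (auto simp: fapply intro!: ext)
next
  case (Suc n)
  have "qsh [\<one>\<^bsub>A\<^esub>] (ones (Suc n)) = gen (ones (Suc (Suc n)))
      \<boxplus> (([Suc n] \<cdot> \<one>) \<bullet> gen (ones (Suc (Suc n))) \<boxplus> ([n] \<cdot> \<one> \<otimes> lam) \<bullet> gen (ones (Suc n)))
      \<boxplus> lam \<bullet> gen (ones (Suc n))"
    by (simp add: qsh_Cons_Cons Suc prefixed_gen prefixed_fadd prefixed_fscale)
  also have "\<dots> = ([Suc (Suc n)] \<cdot> \<one>) \<bullet> gen (ones (Suc (Suc n))) \<boxplus> ([Suc n] \<cdot> \<one> \<otimes> lam) \<bullet> gen (ones (Suc n))"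
    by (rule ext) (simp add: fapply R.l_distr R.a_ac)
  finally show ?case .
qed

lemma zero_divisors:
  assumes one: "\<one>\<^bsub>A\<^esub> \<noteq> \<zero>\<^bsub>A\<^esub>" and n: "[Suc n] \<cdot> \<one> = \<zero>"
  obtains f g where "f \<in> nonempty_words" "g \<in> nonempty_words" "shuffle_class f \<noteq> \<zero>\<^bsub>CSh\<^esub>"
    "shuffle_class g \<noteq> \<zero>\<^bsub>CSh\<^esub>" "shuffle_class f \<otimes>\<^bsub>CSh\<^esub> shuffle_class g = \<zero>\<^bsub>CSh\<^esub>"
proof -
  let ?e = "\<lambda>n. gen (ones (Suc n))"
  let ?c = "\<ominus> ([n] \<cdot> \<one> \<otimes> lam)"
  \<comment> \<open>Since \<open>[Suc n] \<cdot> \<one>\<close> is zero, multiplication by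
    \<open>?e 1\<close> acts on \<open>?e n\<close> as the scalar
    \<open>[n] \<cdot> \<one> \<otimes> lam\<close>; this multiple of the unit \<open>?e 0\<close>
    is subtracted.\<close>
  let ?f = "?e 1 \<boxplus> ?c \<bullet> ?e 0"
  have el: "?e n \<in> length_words (Suc n)" for n by (intro gen_in_words_mod) auto
  have e: "?e n \<in> nonempty_words" for n using el length_words_nonempty by blast
  have c: "?c \<in> carrier C" by simp
  have f: "?f \<in> nonempty_words" using e[of 0] e[of 1] c by (intro fadd_in_words_mod fscale_in_words_mod)
  have prod_ones: "prod_word (ones k) = \<one>\<^bsub>A\<^esub>" for k by (induction k) auto
  have ne: "cls (Suc k) (?e k) \<noteq> Rel (Suc k)" for k
    by (rule cls_gen_neq_zero) (use one prod_ones[of "Suc k"] in auto)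
  \<comment> \<open>The part of length 2 shows that \<open>?f\<close> is nonzero whatever the scalar
    is.\<close>
  have "homog 2 ?f = ?e 1"
  proof -
    have "homog 2 (?e 1) = ?e 1" "homog 2 (?e 0) = fzero"
      using homog_length_words[OF el[of 1], of 2] homog_length_words[OF el[of 0], of 2] by simp_all
    then have "homog 2 ?f = ?e 1 \<boxplus> ?c \<bullet> fzero"
      using e[of 0] e[of 1] c by (simp only: homog_fadd_nonempty fscale_in_words_mod homog_fscale)
    then show ?thesis by (auto simp: fapply intro!: ext)
  qed
  then have "shuffle_class ?f 1 \<noteq> Rel (Suc 1)" using ne[of 1] by (simp add: shuffle_class_def numeral_2_eq_2)
  then have "shuffle_class ?f \<noteq> \<zero>\<^bsub>CSh\<^esub>" unfolding CSh_simps by metis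
  moreover have "shuffle_class (?e n) n \<noteq> Rel (Suc n)"
    using ne[of n] homog_length_words[OF el[of n], of "Suc n"] by (simp add: shuffle_class_def)
  then have "shuffle_class (?e n) \<noteq> \<zero>\<^bsub>CSh\<^esub>" unfolding CSh_simps by metis
  moreover have "?f \<star> ?e n = fzero"
  proof -
    have "?e 1 \<star> ?e n = prefixed C \<one>\<^bsub>A\<^esub> (qsh [\<one>\<^bsub>A\<^esub>] (ones n))"
      by (simp add: star_gen wsh_Cons)
    also have "\<dots> = ([n] \<cdot> \<one> \<otimes> lam) \<bullet> ?e n"
      unfolding qsh_one_ones n by (rule ext) (simp add: prefixed_fadd prefixed_fscale prefixed_gen fapply)
    finally have 1: "?e 1 \<star> ?e n = ([n] \<cdot> \<one> \<otimes> lam) \<bullet> ?e n" .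
    have "?e 0 \<star> ?e n = ?e n" using one_star[OF e[of n]] by simp
    then have "?f \<star> ?e n = ([n] \<cdot> \<one> \<otimes> lam) \<bullet> ?e n \<boxplus> ?c \<bullet> ?e n"
      using 1 e[of 0] e[of 1] e[of n] c by (simp only: star_fadd_left star_fscale_left words_mod_all fscale_in_words_mod)
    also have "\<dots> = fzero" by (rule ext) (simp add: fapply R.l_minus R.r_neg)
    finally show ?thesis .
  qed
  then have "shuffle_class ?f \<otimes>\<^bsub>CSh\<^esub> shuffle_class (?e n) = \<zero>\<^bsub>CSh\<^esub>"
    using shuffle_class_mult[OF f e[of n]] by (simp only: shuffle_class_fzero)
  ultimately show ?thesis using that[OF f e[of n]] by blast
qed

lemma not_domain_shuffle_algebras:
  assumes one: "\<one>\<^bsub>A\<^esub> \<noteq> \<zero>\<^bsub>A\<^esub>" and n: "[Suc n] \<cdot> \<one> = \<zero>"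
  shows "\<not> domain Sh" "\<not> domain CSh"
proof -
  obtain f g where fg: "f \<in> nonempty_words" "g \<in> nonempty_words" "shuffle_class f \<noteq> \<zero>\<^bsub>CSh\<^esub>"
    "shuffle_class g \<noteq> \<zero>\<^bsub>CSh\<^esub>" "shuffle_class f \<otimes>\<^bsub>CSh\<^esub> shuffle_class g = \<zero>\<^bsub>CSh\<^esub>"
    by (rule zero_divisors[OF assms])
  show "\<not> domain CSh"
    using domain.integral[of CSh "shuffle_class f" "shuffle_class g"] fg shuffle_class_CSh by blast
  show "\<not> domain Sh"
    using domain.integral[of Sh "shuffle_class f" "shuffle_class g"] fg shuffle_class_closed
    unfolding Sh_simps(2,4) by blast
qed

end

section \<open>Weight zero\<close>

context word_module
begin

definition remove_letter :: "'a \<Rightarrow> ('a list \<Rightarrow> 'c) \<Rightarrow> 'a list \<Rightarrow> 'c"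
  where "remove_letter c f = (\<lambda>w. case w of [] \<Rightarrow> \<zero> | z # v \<Rightarrow> f (z # c # v))"

text \<open>The companion of \<open>remove_letter\<close> for words whose head has been split off;
  it undoes \<open>prefixed C c\<close>.\<close>

definition strip_letter :: "'a \<Rightarrow> ('a list \<Rightarrow> 'c) \<Rightarrow> 'a list \<Rightarrow> 'c"
  where "strip_letter c f = (\<lambda>w. f (c # w))"

lemma remove_letter_in:
  assumes f: "f \<in> nonempty_words"
  shows "remove_letter c f \<in> nonempty_words"
proof (rule words_modI)
  show "remove_letter c f w \<in> carrier C" for w
    using words_mod_closed[OF f] by (auto simp: remove_letter_def split: list.split)
  have nz: "\<exists>z v. w = z # v \<and> f (z # c # v) \<noteq> \<zero>" if "remove_letter c f w \<noteq> \<zero>" for w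
    using that by (auto simp: remove_letter_def split: list.splits)
  have "word_supp C (remove_letter c f) \<subseteq> (\<lambda>w. hd w # tl (tl w)) ` word_supp C f"
  proof
    fix w assume "w \<in> word_supp C (remove_letter c f)"
    then have "remove_letter c f w \<noteq> \<zero>" by (simp add: word_supp_def)
    then obtain z v where "w = z # v" "f (z # c # v) \<noteq> \<zero>" using nz by blast
    then show "w \<in> (\<lambda>w. hd w # tl (tl w)) ` word_supp C f"
      by (intro image_eqI[of _ _ "z # c # v"]) (auto simp: word_supp_def)
  qed
  then show "finite (word_supp C (remove_letter c f))"
    using finite_subset words_mod_finite[OF f] by blast
  show "set w \<subseteq> carrier A" "w \<noteq> []" if "remove_letter c f w \<noteq> \<zero>" for w
    using nz[OF that] words_mod_set[OF f] by fastforce+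
qed

lemma remove_letter_fadd: "remove_letter c (f \<boxplus> g) = remove_letter c f \<boxplus> remove_letter c g"
  by (rule ext) (auto simp: remove_letter_def fapply split: list.split)

lemma remove_letter_fscale: "d \<in> carrier C \<Longrightarrow> remove_letter c (d \<bullet> f) = d \<bullet> remove_letter c f"
  by (rule ext) (auto simp: remove_letter_def fapply split: list.split)

lemma remove_letter_fzero [simp]: "remove_letter c fzero = fzero"
  by (rule ext) (auto simp: remove_letter_def fapply split: list.split)

lemma remove_letter_prefixed: "remove_letter c (prefixed C z f) = prefixed C z (strip_letter c f)"
  by (rule ext) (auto simp: remove_letter_def strip_letter_def split: list.split)

lemma strip_letter_fadd: "strip_letter c (f \<boxplus> g) = strip_letter c f \<boxplus> strip_letter c g"
  by (rule ext) (auto simp: strip_letter_def fapply)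

lemma strip_letter_prefixed: "strip_letter c (prefixed C z f) = (if c = z then f else fzero)"
  by (rule ext) (auto simp: strip_letter_def fapply)

lemma strip_letter_gen: "strip_letter c (gen w) = (case w of [] \<Rightarrow> fzero | z # v \<Rightarrow> if c = z then gen v else fzero)"
  by (rule ext) (auto simp: strip_letter_def fapply word_gen_def split: list.split)

lemma remove_letter_gen: "remove_letter c (gen (z # w)) = prefixed C z (strip_letter c (gen w))"
  unfolding remove_letter_prefixed[symmetric] prefixed_gen ..

text \<open>A word of length at least 2 has the form \<open>z # c # v\<close>, and its coefficient
  is that of \<open>z # v\<close> after removal of \<open>c\<close>. Equality can thus be proved by
  comparing derivatives, which involve shorter words.\<close>

lemma nonempty_words_eqI:
  assumes f: "f \<in> nonempty_words" and g: "g \<in> nonempty_words"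
    and "homog (Suc 0) f = homog (Suc 0) g" "\<And>c. remove_letter c f = remove_letter c g"
  shows "f = g"
proof (rule ext)
  fix w :: "'a list"
  consider "w = []" | z where "w = [z]" | z c v where "w = z # c # v"
    by (metis list.exhaust)
  then show "f w = g w"
  proof cases
    case 1
    then show ?thesis using words_mod_pred[OF f, of w] words_mod_pred[OF g, of w] by metis
  next
    case 2
    then show ?thesis using fun_cong[OF assms(3), of w] by (simp add: homog_def)
  next
    case 3
    then show ?thesis using fun_cong[OF assms(4)[of c], of "z # v"] by (simp add: remove_letter_def)
  qed
qed

lemma fadd_assoc:
  "f \<in> all_words \<Longrightarrow> g \<in> all_words \<Longrightarrow> h \<in> all_words \<Longrightarrow> f \<boxplus> g \<boxplus> h = f \<boxplus> (g \<boxplus> h)"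
  using words_mod_closed by (auto simp: fapply R.a_assoc intro!: ext)

lemma fadd_comm: "f \<in> all_words \<Longrightarrow> g \<in> all_words \<Longrightarrow> f \<boxplus> g = g \<boxplus> f"
  using words_mod_closed by (auto simp: fapply R.a_comm intro!: ext)

lemma fadd_fzero [simp]: "f \<in> all_words \<Longrightarrow> f \<boxplus> fzero = f" "f \<in> all_words \<Longrightarrow> fzero \<boxplus> f = f"
  using words_mod_closed by (auto simp: fapply intro!: ext)

end

locale shuffle_module_weight_zero = shuffle_module C A lam
  for C :: "('c, 'm) ring_scheme" (structure) and A :: "('c, 'a, 'n) module_scheme" (structure) and lam :: 'c +
  assumes lam_zero: "lam = \<zero>"
begin

section \<open>Letter removal as a derivation, and the right commutativity that follows from
  it\<close>

lemma qsh_Cons_Cons_zero: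
  assumes "set (x # xs) \<subseteq> carrier A" "set (y # ys) \<subseteq> carrier A"
  shows "qsh (x # xs) (y # ys) = prefixed C x (qsh xs (y # ys)) \<boxplus> prefixed C y (qsh (x # xs) ys)"
proof -
  have "lam \<bullet> prefixed C (x \<otimes>\<^bsub>A\<^esub> y) (qsh xs ys) = fzero"
    using words_mod_closed[OF prefixed_all_words[OF qsh_all_words]] assms by (auto simp: lam_zero fapply intro!: ext)
  moreover have "prefixed C x (qsh xs (y # ys)) \<boxplus> prefixed C y (qsh (x # xs) ys) \<in> all_words"
    using assms by (intro fadd_in_words_mod prefixed_all_words qsh_all_words) auto
  ultimately show ?thesis unfolding qsh_Cons_Cons by simp
qed

lemma strip_letter_qsh:
  assumes "set xs \<subseteq> carrier A" "set ys \<subseteq> carrier A"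
  shows "strip_letter c (qsh xs ys) =
    (case xs of [] \<Rightarrow> fzero | x # xs' \<Rightarrow> if c = x then qsh xs' ys else fzero) \<boxplus>
    (case ys of [] \<Rightarrow> fzero | y # ys' \<Rightarrow> if c = y then qsh xs ys' else fzero)"
proof (cases xs)
  case Nil
  have "gen ys' \<in> all_words" if "set ys' \<subseteq> carrier A" for ys' using that by auto
  then show ?thesis using Nil assms by (auto simp: strip_letter_gen split: list.split)
next
  case (Cons x xs')
  show ?thesis
  proof (cases ys)
    case Nil
    have "gen xs' \<in> all_words" using Cons assms by auto
    then show ?thesis using Nil Cons by (auto simp: strip_letter_gen)
  next
    case (Cons y ys')
    then show ?thesis using \<open>xs = x # xs'\<close> assms
      by (simp add: qsh_Cons_Cons_zero strip_letter_fadd strip_letter_prefixed)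
  qed
qed

lemma remove_letter_star_gen:
  assumes "set u \<subseteq> carrier A" "set v \<subseteq> carrier A" "u \<noteq> []" "v \<noteq> []"
  shows "remove_letter c (gen u \<star> gen v) = remove_letter c (gen u) \<star> gen v \<boxplus> gen u \<star> remove_letter c (gen v)"
proof -
  obtain x xs y ys where uv: "u = x # xs" "v = y # ys" using assms by (metis list.exhaust)
  have c: "x \<in> carrier A" "set xs \<subseteq> carrier A" "y \<in> carrier A" "set ys \<subseteq> carrier A" using assms uv by auto
  let ?X = "case xs of [] \<Rightarrow> fzero | z # xs' \<Rightarrow> if c = z then qsh xs' ys else fzero"
  let ?Y = "case ys of [] \<Rightarrow> fzero | z # ys' \<Rightarrow> if c = z then qsh xs ys' else fzero"
  have "remove_letter c (gen u \<star> gen v) = prefixed C (x \<otimes>\<^bsub>A\<^esub> y) (strip_letter c (qsh xs ys))"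
    using assms by (simp add: star_gen uv wsh_Cons remove_letter_prefixed)
  also have "\<dots> = prefixed C (x \<otimes>\<^bsub>A\<^esub> y) ?X \<boxplus> prefixed C (x \<otimes>\<^bsub>A\<^esub> y) ?Y"
    using c by (simp only: strip_letter_qsh prefixed_fadd)
  also have "prefixed C (x \<otimes>\<^bsub>A\<^esub> y) ?X = remove_letter c (gen u) \<star> gen v"
    using c by (auto simp: uv remove_letter_gen strip_letter_gen prefixed_gen star_gen wsh_Cons split: list.split)
  also have "prefixed C (x \<otimes>\<^bsub>A\<^esub> y) ?Y = gen u \<star> remove_letter c (gen v)"
    using c by (auto simp: uv remove_letter_gen strip_letter_gen prefixed_gen star_gen wsh_Cons split: list.split)
  finally show ?thesis .
qed

text \<open>
  Deleting a given letter in the position after the head is a derivation, because without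
  merging, the first letter of a shuffle is the first letter of one of the two factors.
\<close>

lemma remove_letter_star:
  assumes f: "f \<in> nonempty_words" and g: "g \<in> nonempty_words"
  shows "remove_letter c (f \<star> g) = remove_letter c f \<star> g \<boxplus> f \<star> remove_letter c g"
proof -
  let ?D = "remove_letter c"
  have swap: "p \<boxplus> q \<boxplus> (r \<boxplus> s) = p \<boxplus> r \<boxplus> (q \<boxplus> s)"
    if "p \<in> all_words" "q \<in> all_words" "r \<in> all_words" "s \<in> all_words" for p q r s
    using that[THEN words_mod_closed] by (auto simp: fapply R.a_ac intro!: ext)
  note lin = nonempty_all_words star_nonempty star_fadd_left star_fadd_right star_fscale_left star_fscale_right
    star_fzero_left star_fzero_right remove_letter_fadd remove_letter_fscale remove_letter_fzero remove_letter_in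
    fscale_fadd fadd_fzero fzero_in_words_mod
  show ?thesis using f
  proof (induction rule: words_mod_induct)
    case (gen u)
    then have u: "gen u \<in> nonempty_words" by auto
    show ?case using g
    proof (induction rule: words_mod_induct)
      case (gen v)
      then show ?case using remove_letter_star_gen \<open>set u \<subseteq> carrier A\<close> \<open>u \<noteq> []\<close> by blast
    next
      case (add g g')
      then show ?case using u by (simp only: lin(1-12)) (rule swap; intro nonempty_all_words star_nonempty remove_letter_in)
    qed (use u in \<open>simp_all only: lin\<close>)
  next
    case (add f f')
    then show ?case using g by (simp only: lin(1-12)) (rule swap; intro nonempty_all_words star_nonempty remove_letter_in)
  qed (use g in \<open>simp_all only: lin\<close>)
qed

text \<open>Removal sends a word to zero or to one shorter word, which is what an induction on the
  total length needs.\<close>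

lemma remove_letter_gen_cases:
  assumes "set u \<subseteq> carrier A" "u \<noteq> []"
  obtains "remove_letter c (gen u) = fzero"
  | u' where "remove_letter c (gen u) = gen u'" "set u' \<subseteq> carrier A" "u' \<noteq> []" "length u' < length u"
proof -
  obtain x xs where u: "u = x # xs" using assms by (metis list.exhaust)
  show ?thesis
  proof (cases "\<exists>xs'. xs = c # xs'")
    case True
    then obtain xs' where "xs = c # xs'" by auto
    then have "remove_letter c (gen u) = gen (x # xs')"
      by (simp add: u remove_letter_gen strip_letter_gen prefixed_gen)
    then show ?thesis using that(2)[of "x # xs'"] assms \<open>xs = c # xs'\<close> u by auto
  next
    case False
    then have "remove_letter c (gen u) = fzero"
      by (auto simp: u remove_letter_gen strip_letter_gen split: list.split)
    then show ?thesis using that(1) by blast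
  qed
qed

text \<open>Together with commutativity this exchange is equivalent to associativity. By the product
  rule each summand of a derivative has one factor shortened, so the induction hypothesis shows that
  both sides have equal derivatives; they also have equal one-letter parts.\<close>

lemma star_right_commute_gen:
  assumes "set u \<subseteq> carrier A" "u \<noteq> []" "set v \<subseteq> carrier A" "v \<noteq> []" "set w \<subseteq> carrier A" "w \<noteq> []"
  shows "gen u \<star> gen v \<star> gen w = gen u \<star> gen w \<star> gen v"
  using assms
proof (induction "length u + length v + length w" arbitrary: u v w rule: less_induct)
  case less
  note n [simp] = gen_in_words_mod[OF less(2), of "\<lambda>w. w \<noteq> []", OF less(3)] gen_in_words_mod[OF less(4), of "\<lambda>w. w \<noteq> []", OF less(5)]
    gen_in_words_mod[OF less(6), of "\<lambda>w. w \<noteq> []", OF less(7)]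
  note s = star_nonempty
  show ?case
  proof (rule nonempty_words_eqI)
    show "gen u \<star> gen v \<star> gen w \<in> nonempty_words" "gen u \<star> gen w \<star> gen v \<in> nonempty_words"
      by (intro s n)+
    show "homog (Suc 0) (gen u \<star> gen v \<star> gen w) = homog (Suc 0) (gen u \<star> gen w \<star> gen v)"
    proof (cases "length u = Suc 0 \<and> length v = Suc 0 \<and> length w = Suc 0")
      case True
      then obtain x y z where "u = [x]" "v = [y]" "w = [z]" by (auto simp: length_Suc_conv)
      then show ?thesis using less(2-) by (simp add: star_gen wsh_Cons prefixed_gen m_ac)
    next
      case False
      have g: "gen x \<in> words_mod (\<lambda>p. length p = length x)" if "set x \<subseteq> carrier A" for x
        using that by (intro gen_in_words_mod) auto
      have "gen x \<star> gen y \<star> gen z \<in> words_mod (\<lambda>p. p \<noteq> [] \<and> length x \<le> length p \<and> length y \<le> length p \<and> length z \<le> length p)"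
        if "set x \<subseteq> carrier A" "set y \<subseteq> carrier A" "set z \<subseteq> carrier A" "x \<noteq> []" "y \<noteq> []" "z \<noteq> []" for x y z
      proof (rule star_in_words_mod)
        show "gen z \<in> words_mod (\<lambda>p. length p = length z)" by (rule g[OF that(3)])
        show "gen x \<star> gen y \<in> words_mod (\<lambda>p. p \<noteq> [] \<and> length x \<le> length p \<and> length y \<le> length p)"
          by (rule star_in_words_mod[OF g[OF that(1)] g[OF that(2)]]) (use that in auto)
      qed (use that in auto)
      note m = this[OF less(2,4,6,3,5,7)] this[OF less(2,6,4,3,7,5)]
      \<comment> \<open>A product word is at least as long as each factor, so now there are no
        one-letter words on either side.\<close>
      have "length u > 1 \<or> length v > 1 \<or> length w > 1"
        using False less(3,5,7) by (cases u; cases v; cases w) auto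
      then have "homog (Suc 0) (gen u \<star> gen v \<star> gen w) = fzero" "homog (Suc 0) (gen u \<star> gen w \<star> gen v) = fzero"
        by (intro homog_eq_fzero[OF m(1)] homog_eq_fzero[OF m(2)]; auto)+
      then show ?thesis by simp
    qed
    show "remove_letter c (gen u \<star> gen v \<star> gen w) = remove_letter c (gen u \<star> gen w \<star> gen v)" for c
    proof -
      let ?D = "remove_letter c"
      note d = n[THEN remove_letter_in, of c]
      have 1: "?D (gen u) \<star> gen v \<star> gen w = ?D (gen u) \<star> gen w \<star> gen v"
        by (rule remove_letter_gen_cases[OF less(2,3), of c]) (use less in auto)
      have 2: "gen u \<star> ?D (gen v) \<star> gen w = gen u \<star> gen w \<star> ?D (gen v)"
        by (rule remove_letter_gen_cases[OF less(4,5), of c]) (use less in auto)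
      have 3: "gen u \<star> gen v \<star> ?D (gen w) = gen u \<star> ?D (gen w) \<star> gen v"
        by (rule remove_letter_gen_cases[OF less(6,7), of c]) (use less in auto)
      note a = nonempty_all_words
      have "?D (gen u \<star> gen v \<star> gen w) = ?D (gen u) \<star> gen v \<star> gen w \<boxplus> gen u \<star> ?D (gen v) \<star> gen w \<boxplus> gen u \<star> gen v \<star> ?D (gen w)"
        by (simp only: remove_letter_star s n d star_fadd_left a)
      also have "\<dots> = ?D (gen u) \<star> gen w \<star> gen v \<boxplus> gen u \<star> gen w \<star> ?D (gen v) \<boxplus> gen u \<star> ?D (gen w) \<star> gen v"
        by (simp only: 1 2 3)
      also have "\<dots> = ?D (gen u) \<star> gen w \<star> gen v \<boxplus> gen u \<star> ?D (gen w) \<star> gen v \<boxplus> gen u \<star> gen w \<star> ?D (gen v)"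
        by (subst (1 2) fadd_assoc; (intro a s n d)?) (subst fadd_comm; (intro a s n d)?; rule refl)
      also have "\<dots> = ?D (gen u \<star> gen w \<star> gen v)"
        by (simp only: remove_letter_star s n d star_fadd_left a)
      finally show ?thesis .
    qed
  qed
qed

lemma star_right_commute:
  assumes f: "f \<in> nonempty_words" and g: "g \<in> nonempty_words" and h: "h \<in> nonempty_words"
  shows "f \<star> g \<star> h = f \<star> h \<star> g"
  using f
proof (induction rule: words_mod_induct)
  note al = nonempty_all_words star_nonempty
  case (gen u)
  then have u: "gen u \<in> nonempty_words" by auto
  show ?case using g
  proof (induction rule: words_mod_induct)
    case (gen v)
    then have v: "gen v \<in> nonempty_words" by auto
    show ?case using h
    proof (induction rule: words_mod_induct)
      case (gen w)
      then show ?case using star_right_commute_gen \<open>set u \<subseteq> carrier A\<close> \<open>u \<noteq> []\<close> \<open>set v \<subseteq> carrier A\<close> \<open>v \<noteq> []\<close> by blast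
    next
      case zero
      show ?case by (simp only: star_fzero_right star_fzero_left)
    qed (use u v in \<open>simp_all only: star_fadd_left star_fadd_right star_fscale_left star_fscale_right al\<close>)
  next
    case zero
    show ?case by (simp only: star_fzero_right star_fzero_left)
  qed (use u h in \<open>simp_all only: star_fadd_left star_fadd_right star_fscale_left star_fscale_right al\<close>)
next
  case zero
  show ?case by (simp only: star_fzero_right star_fzero_left)
qed (use g h nonempty_all_words star_nonempty
    in \<open>simp_all only: star_fadd_left star_fadd_right star_fscale_left star_fscale_right\<close>)

text \<open>The power rule. As powers are nested to the left, the product rule leaves
  \<open>remove_letter c f\<close> inside; right commutativity moves it to the last place.\<close>

lemma remove_letter_star_pow:
  assumes f: "f \<in> nonempty_words"
  shows "remove_letter c (star_pow f (Suc k)) = ([Suc k] \<cdot> \<one>) \<bullet> (star_pow f k \<star> remove_letter c f)"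
proof (induction k)
  case 0
  have d: "remove_letter c f \<in> nonempty_words" by (rule remove_letter_in[OF f])
  have z: "remove_letter c (gen [\<one>\<^bsub>A\<^esub>]) = fzero" by (simp add: remove_letter_gen strip_letter_gen)
  have one: "\<one> \<bullet> g = g" if "g \<in> nonempty_words" for g
    using words_mod_closed[OF that] by (auto simp: fapply intro!: ext)
  show ?case
    using remove_letter_star[OF gen_one_nonempty f, of c] d star_nonempty[OF gen_one_nonempty d]
    by (simp add: z one nonempty_all_words)
next
  case (Suc k)
  let ?p = "star_pow f k" and ?d = "remove_letter c f" and ?m = "[Suc k] \<cdot> \<one>"
  have p: "?p \<in> nonempty_words" by (rule star_pow_nonempty[OF f])
  have pf: "?p \<star> f \<in> nonempty_words" by (rule star_nonempty[OF p f])
  have d: "?d \<in> nonempty_words" by (rule remove_letter_in[OF f])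
  have pfd: "?p \<star> f \<star> ?d \<in> nonempty_words" by (rule star_nonempty[OF pf d])
  note a = nonempty_all_words
  have "remove_letter c (star_pow f (Suc (Suc k))) = (?m \<bullet> (?p \<star> ?d)) \<star> f \<boxplus> ?p \<star> f \<star> ?d"
    using remove_letter_star[OF pf f, of c] Suc by simp
  also have "(?m \<bullet> (?p \<star> ?d)) \<star> f = ?m \<bullet> (?p \<star> ?d \<star> f)"
    by (rule star_fscale_left) (use a star_nonempty p d f in auto)
  also have "?p \<star> ?d \<star> f = ?p \<star> f \<star> ?d" by (rule star_right_commute[OF p d f])
  also have "?m \<bullet> (?p \<star> f \<star> ?d) \<boxplus> ?p \<star> f \<star> ?d = ([Suc (Suc k)] \<cdot> \<one>) \<bullet> (?p \<star> f \<star> ?d)"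
    using words_mod_closed[OF pfd] by (auto simp: fapply R.l_distr intro!: ext)
  finally show ?case by simp
qed

lemma nilpotent_of_degree_zero:
  fixes N :: nat
  assumes N: "[N] \<cdot> \<one> = \<zero>" "0 < N" and F: "F \<in> carrier Sh" and a: "a \<in> nilradical A" "F 0 = cls (Suc 0) (gen [a])"
  shows "F \<in> nilradical Sh"
proof -
  obtain r :: nat where r: "a [^]\<^bsub>A\<^esub> r = \<zero>\<^bsub>A\<^esub>" and ac: "a \<in> carrier A" using a(1) by (auto simp: nilradical_def)
  have "gen [a] \<in> length_words (Suc 0)" using ac by (intro gen_in_words_mod) auto
  then obtain f where f: "f \<in> nonempty_words" "shuffle_class f = F" "homog (Suc 0) f = gen [a]"
    using shuffle_class_surj[OF F _ a(2)] by blast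
  \<comment> \<open>A multiple of \<open>N\<close>, so that the power rule gives zero, and at least
    \<open>r\<close>, so that the \<open>K\<close>-th power of \<open>a\<close> vanishes.
    \<open>Suc r\<close> keeps it positive when \<open>r\<close> is 0.\<close>
  define K where "K = N * Suc r"
  obtain k where k: "K = Suc k" using N(2) by (cases K) (auto simp: K_def)
  have K0: "[K] \<cdot> \<one> = \<zero>"
    unfolding K_def using R.add.nat_pow_pow[OF R.one_closed, of "Suc r" N] R.add.nat_pow_one[of "Suc r"]
    by (simp only: N(1))
  have pw: "star_pow f K \<in> nonempty_words" by (rule star_pow_nonempty[OF f(1)])
  have D: "remove_letter c (star_pow f K) = fzero" for c
    using remove_letter_star_pow[OF f(1), of c k] K0 star_nonempty[OF star_pow_nonempty[OF f(1), of k] remove_letter_in[OF f(1), of c]]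
    by (auto simp: k fapply words_mod_closed intro!: ext)
  have "r \<le> N * Suc r" using N(2) by (cases N) auto
  then have "K = r + (K - r)" by (simp add: K_def)
  then have "a [^]\<^bsub>A\<^esub> K = \<zero>\<^bsub>A\<^esub>"
    using r ac nat_pow_mult[OF ac, of r "K - r"] by simp
  then have h: "homog (Suc 0) (star_pow f K) = gen [\<zero>\<^bsub>A\<^esub>]"
    using homog_star_pow[OF f(1) ac f(3), of K] by simp
  have "shuffle_class (star_pow f K) n = Rel (Suc n)" for n
  proof (cases n)
    case 0
    then show ?thesis using h cls_letter_eq_zero_iff[of "\<zero>\<^bsub>A\<^esub>"] by (simp add: shuffle_class_def)
  next
    case (Suc m)
    \<comment> \<open>In positive degree the power vanishes already as a function, because the
      removal of every letter gives zero.\<close>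
    have "homog (Suc n) (star_pow f K) = fzero"
    proof (rule ext)
      fix w
      show "homog (Suc n) (star_pow f K) w = fzero w"
      proof (cases "length w = Suc n")
        case True
        then obtain z c v where "w = z # c # v" using Suc by (auto simp: length_Suc_conv)
        then show ?thesis using fun_cong[OF D[of c], of "z # v"] by (simp add: homog_def remove_letter_def fapply)
      qed (simp add: homog_def fapply)
    qed
    then show ?thesis by (simp add: shuffle_class_def)
  qed
  then have "F [^]\<^bsub>Sh\<^esub> K = \<zero>\<^bsub>Sh\<^esub>"
    using shuffle_class_pow[OF f(1), of K] f(2) by (simp add: Sh_pow Sh_simps(2) CSh_simps(2) fun_eq_iff)
  then show ?thesis using F unfolding nilradical_def by blast
qed

lemma nilradical_Sh_weight_zero:
  fixes N :: nat
  assumes one: "\<one>\<^bsub>A\<^esub> \<noteq> \<zero>\<^bsub>A\<^esub>" and N: "[N] \<cdot> \<one> = \<zero>" "0 < N"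
  shows "nilradical Sh = {F \<in> carrier Sh. F 0 \<in> (\<lambda>a. pure_tensor C A [a]) ` nilradical A}"
proof (intro subset_antisym subsetI)
  fix F assume F: "F \<in> nilradical Sh"
  then show "F \<in> {F \<in> carrier Sh. F 0 \<in> (\<lambda>a. pure_tensor C A [a]) ` nilradical A}"
    using nilradical_CSh_degree_zero[OF one, of F] unfolding nilradical_Sh by blast
next
  fix F assume "F \<in> {F \<in> carrier Sh. F 0 \<in> (\<lambda>a. pure_tensor C A [a]) ` nilradical A}"
  then show "F \<in> nilradical Sh"
    using nilpotent_of_degree_zero[OF N, of F] by (auto simp: pure_tensor_eq_cls)
qed

lemma not_reduced_weight_zero:
  fixes N :: nat
  assumes one: "\<one>\<^bsub>A\<^esub> \<noteq> \<zero>\<^bsub>A\<^esub>" and N: "[N] \<cdot> \<one> = \<zero>" "0 < N"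
  shows "\<not> reduced Sh" "\<not> reduced CSh"
proof -
  \<comment> \<open>The witness 1 \<otimes> 1 has degree-zero component 0, which is nilpotent, and
    it is nonzero by the multiplication map.\<close>
  let ?e = "gen [\<one>\<^bsub>A\<^esub>, \<one>\<^bsub>A\<^esub>]"
  have e: "?e \<in> length_words (Suc 1)" by (intro gen_in_words_mod) auto
  have en: "?e \<in> nonempty_words" by (rule length_words_nonempty[OF e])
  have "shuffle_class ?e 0 = cls (Suc 0) (gen [\<zero>\<^bsub>A\<^esub>])"
    using cls_letter_eq_zero_iff[of "\<zero>\<^bsub>A\<^esub>"] homog_length_words[OF e, of "Suc 0"] by (simp add: shuffle_class_def)
  moreover have "\<zero>\<^bsub>A\<^esub> \<in> nilradical A" by (auto simp: nilradical_def intro!: exI[of _ "Suc 0"])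
  ultimately have nil: "shuffle_class ?e \<in> nilradical Sh"
    using nilpotent_of_degree_zero[OF N shuffle_class_closed[OF en]] by blast
  have "shuffle_class ?e 1 \<noteq> Rel (Suc 1)"
    using cls_gen_neq_zero[of "[\<one>\<^bsub>A\<^esub>, \<one>\<^bsub>A\<^esub>]" "Suc 1"] one homog_length_words[OF e, of "Suc 1"] by (simp add: shuffle_class_def)
  then have ne: "shuffle_class ?e \<noteq> \<zero>\<^bsub>CSh\<^esub>" unfolding CSh_simps by metis
  show "\<not> reduced Sh" using nil ne unfolding reduced_def Sh_simps(2) by blast
  show "\<not> reduced CSh" using nil ne unfolding reduced_def nilradical_Sh by blast
qed

end

theorem theorem4p8:
  fixes C :: "('c, 'm) ring_scheme" and A :: "('c, 'a, 'n) module_scheme" and lam :: 'c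
  assumes "algebra C A"
    and "\<one>\<^bsub>C\<^esub> \<noteq> \<zero>\<^bsub>C\<^esub>"
    and "ring_characteristic C > 0"
    and "inj_on (\<lambda>c. c \<odot>\<^bsub>A\<^esub> \<one>\<^bsub>A\<^esub>) (carrier C)"
    and "lam \<in> carrier C"
  shows
   "(\<not> domain (shuffle_algebra C A lam) \<and> \<not> domain (complete_shuffle_algebra C A lam))
    \<and>
    (lam = \<zero>\<^bsub>C\<^esub> \<longrightarrow>
       \<not> reduced (shuffle_algebra C A lam) \<and> \<not> reduced (complete_shuffle_algebra C A lam) \<and>
       nilradical (shuffle_algebra C A lam) =
         {F \<in> carrier (shuffle_algebra C A lam). F 0 \<in> (\<lambda>a. pure_tensor C A [a]) ` nilradical A} \<and>
       nilradical (complete_shuffle_algebra C A lam) \<subseteq>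
         {F \<in> carrier (complete_shuffle_algebra C A lam).
            F 0 \<in> (\<lambda>a. pure_tensor C A [a]) ` nilradical A})
    \<and>
    (lam \<noteq> \<zero>\<^bsub>C\<^esub> \<and>
     (\<forall>k\<ge>1. trivial_annihilator_in lam (tensor_power C A k) \<and> reduced (tensor_power C A k)) \<longrightarrow>
       reduced (shuffle_algebra C A lam) \<and> reduced (complete_shuffle_algebra C A lam))"
proof -
  interpret S: shuffle_module C A lam
    using assms(1,5) by (simp add: shuffle_module_def shuffle_module_axioms_def word_module_def)
  \<comment> \<open>If A were the zero ring, the scalars 1 and 0 of C would have the same
    image.\<close>
  have one: "\<one>\<^bsub>A\<^esub> \<noteq> \<zero>\<^bsub>A\<^esub>"
  proof
    assume "\<one>\<^bsub>A\<^esub> = \<zero>\<^bsub>A\<^esub>"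
    then have "\<one>\<^bsub>C\<^esub> \<odot>\<^bsub>A\<^esub> \<one>\<^bsub>A\<^esub> = \<zero>\<^bsub>C\<^esub> \<odot>\<^bsub>A\<^esub> \<one>\<^bsub>A\<^esub>" by simp
    then show False using inj_onD[OF assms(4)] assms(2) by blast
  qed
  let ?P = "\<lambda>n::nat. 0 < n \<and> [n] \<cdot>\<^bsub>C\<^esub> \<one>\<^bsub>C\<^esub> = \<zero>\<^bsub>C\<^esub>"
  have "\<exists>n. ?P n" using assms(3) by (auto simp: ring_characteristic_def split: if_splits)
  then obtain N where N: "?P N" by blast
  \<comment> \<open>The zero divisors are built from \<open>n = N - 1\<close>, for which the
    coefficient \<open>n + 1\<close> vanishes.\<close>
  then obtain n where n: "N = Suc n" by (cases N) auto
  have weight_zero: "\<not> reduced S.Sh \<and> \<not> reduced S.CSh \<and>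
      nilradical S.Sh = {F \<in> carrier S.Sh. F 0 \<in> (\<lambda>a. pure_tensor C A [a]) ` nilradical A}" if "lam = \<zero>\<^bsub>C\<^esub>"
  proof -
    interpret Z: shuffle_module_weight_zero C A lam by unfold_locales (rule that)
    show ?thesis using Z.not_reduced_weight_zero[OF one] Z.nilradical_Sh_weight_zero[OF one] N by blast
  qed
  \<comment> \<open>This inclusion holds for every weight, so it is proved outside
    \<open>weight_zero\<close>.\<close>
  moreover have "nilradical S.CSh \<subseteq> {F \<in> carrier S.CSh. F 0 \<in> (\<lambda>a. pure_tensor C A [a]) ` nilradical A}"
    using S.nilradical_CSh_degree_zero[OF one] by (auto simp: nilradical_def)
  ultimately show ?thesis
    using S.not_domain_shuffle_algebras[OF one, of n] N n S.reduced_shuffle_algebras[OF one] by blast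
qed

end
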